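(* Let $G$ be a second countable locally compact group with left Haar measure $\mu_L$, right Haar measure $\mu_R$ and modular element $\hat\delta=\frac{d\mu_R}{d\mu_L}$. The following conditions are equivalent: 1) $G$ is amenable. 2) For any $p\in\mathbb{R}$ and any measurable subset $\Omega\subseteq G$ such that $\int_\Omega\hat\delta^p\,d\mu_L<+\infty$ we have $$\int_\Omega\hat\delta^p\,d\mu_L\in\sigma\Big(\int_\Omega\hat\delta(\zeta)^p\lambda_\zeta\,d\mu_L(\zeta)\Big).$$ 3) For any measurable subset $\Omega\subseteq G$ such that $\Omega=\Omega^{-1}$ and $\int_\Omega\hat\delta^{1/2}\,d\mu_L<+\infty$ we have $$\int_\Omega\hat\delta^{1/2}\,d\mu_L\in\sigma\Big(\int_\Omega\hat\delta(\zeta)^{1/2}\lambda_\zeta\,d\mu_L(\zeta)\Big).$$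
   Context: Locally compact groups are Hausdorff. $\lambda$ is the left regular representation of $G$ on $L^2(G,\mu_L)$, $(\lambda_\zeta f)(\zeta')=f(\zeta^{-1}\zeta')$. The operator integrals are taken in the $\sigma$-weak topology of $B(L^2(G,\mu_L))$, and $\sigma(\cdot)$ denotes the spectrum of a bounded operator. The right Haar measure is $\mu_R(A)=\mu_L(A^{-1})$, so $\hat\delta:G\to\mathbb{R}_{>0}$ is a continuous homomorphism (note this is the Radon--Nikodym derivative of the right by the left Haar measure). *)

theory Defs
  imports "HOL-Analysis.Analysis"
begin

text \<open>
  A topological group is a type of class \<^class>\<open>topological_group_add\<close>. Despite the additive
  notation this class does not assume commutativity: \<open>x + y\<close> is the product of \<open>x\<close> and \<open>y\<close>,
  \<open>- x\<close> is the inverse of \<open>x\<close>, and \<open>0\<close> is the neutral element.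
\<close>

section \<open>Haar measures and the modular element\<close>

definition radon_measure :: "'a::topological_space measure \<Rightarrow> bool" where
  "radon_measure \<mu> \<longleftrightarrow>
     sets \<mu> = sets borel \<and>
     (\<forall>K. compact K \<longrightarrow> emeasure \<mu> K < \<infinity>) \<and>
     (\<forall>A\<in>sets borel. emeasure \<mu> A = (INF U\<in>{U. open U \<and> A \<subseteq> U}. emeasure \<mu> U)) \<and>
     (\<forall>U. open U \<longrightarrow> emeasure \<mu> U = (SUP K\<in>{K. compact K \<and> K \<subseteq> U}. emeasure \<mu> K))"

definition left_haar_measure :: "'a::topological_group_add measure \<Rightarrow> bool" where
  "left_haar_measure \<mu> \<longleftrightarrow>
     radon_measure \<mu> \<and> emeasure \<mu> UNIV \<noteq> 0 \<and>
     (\<forall>\<zeta>. \<forall>A\<in>sets borel. emeasure \<mu> ((\<lambda>x. \<zeta> + x) ` A) = emeasure \<mu> A)"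

text \<open>\<open>\<mu>\<^sub>R(A) = \<mu>\<^sub>L(A\<^sup>-\<^sup>1)\<close>\<close>

definition right_haar_of :: "'a::topological_group_add measure \<Rightarrow> 'a measure" where
  "right_haar_of \<mu> = distr \<mu> borel uminus"

text \<open>
  A Radon--Nikodym derivative is determined only almost everywhere. The modular element is its
  unique continuous version, which is a homomorphism into the positive reals.
\<close>

definition modular_element :: "'a::topological_group_add measure \<Rightarrow> ('a \<Rightarrow> real) \<Rightarrow> bool" where
  "modular_element \<mu> \<delta> \<longleftrightarrow>
     continuous_on UNIV \<delta> \<and> (\<forall>x. \<delta> x > 0) \<and> (\<forall>x y. \<delta> (x + y) = \<delta> x * \<delta> y) \<and>
     right_haar_of \<mu> = density \<mu> (\<lambda>x. ennreal (\<delta> x))"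

definition left_translate :: "'a::group_add \<Rightarrow> ('a \<Rightarrow> complex) \<Rightarrow> 'a \<Rightarrow> complex" where
  "left_translate \<zeta> f = (\<lambda>\<xi>. f (- \<zeta> + \<xi>))"

section \<open>Amenability\<close>

definition Linf :: "'a measure \<Rightarrow> ('a \<Rightarrow> complex) set" where
  "Linf M = {f \<in> borel_measurable M. \<exists>C. AE x in M. norm (f x) \<le> C}"

text \<open>
  A state on \<open>L\<^sup>\<infinity>(M)\<close>, written as a functional on representatives. Positivity and linearity force
  it to agree on functions that are equal almost everywhere.
\<close>

definition Linf_state :: "'a measure \<Rightarrow> (('a \<Rightarrow> complex) \<Rightarrow> complex) \<Rightarrow> bool" where
  "Linf_state M m \<longleftrightarrow>
     (\<forall>f\<in>Linf M. \<forall>g\<in>Linf M. m (\<lambda>x. f x + g x) = m f + m g) \<and>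
     (\<forall>f\<in>Linf M. \<forall>c. m (\<lambda>x. c * f x) = c * m f) \<and>
     (\<forall>f\<in>Linf M. (AE x in M. f x \<in> \<real>\<^sub>\<ge>\<^sub>0) \<longrightarrow> m f \<in> \<real>\<^sub>\<ge>\<^sub>0) \<and>
     m (\<lambda>x. 1) = 1"

definition amenable :: "'a::topological_group_add measure \<Rightarrow> bool" where
  "amenable \<mu> \<longleftrightarrow>
     (\<exists>m. Linf_state \<mu> m \<and> (\<forall>\<zeta>. \<forall>f\<in>Linf \<mu>. m (left_translate \<zeta> f) = m f))"

section \<open>Bounded operators on the Hilbert space \<open>L\<^sup>2(M)\<close>\<close>

text \<open>
  Vectors of \<open>L\<^sup>2(M)\<close> are represented by square integrable functions, and equality of vectors is
  equality almost everywhere. Operators are functions on representatives, of which only the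
  action on \<open>L2 M\<close> up to equality almost everywhere matters.
\<close>

definition L2 :: "'a measure \<Rightarrow> ('a \<Rightarrow> complex) set" where
  "L2 M = {f \<in> borel_measurable M. integrable M (\<lambda>x. (norm (f x))\<^sup>2)}"

definition L2_eq :: "'a measure \<Rightarrow> ('a \<Rightarrow> complex) \<Rightarrow> ('a \<Rightarrow> complex) \<Rightarrow> bool" where
  "L2_eq M f g \<longleftrightarrow> (AE x in M. f x = g x)"

definition L2_inner :: "'a measure \<Rightarrow> ('a \<Rightarrow> complex) \<Rightarrow> ('a \<Rightarrow> complex) \<Rightarrow> complex" where
  "L2_inner M f g = (LINT x|M. f x * cnj (g x))"

definition L2_norm :: "'a measure \<Rightarrow> ('a \<Rightarrow> complex) \<Rightarrow> real" where
  "L2_norm M f = sqrt (LINT x|M. (norm (f x))\<^sup>2)"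

definition L2_bounded_op ::
    "'a measure \<Rightarrow> (('a \<Rightarrow> complex) \<Rightarrow> ('a \<Rightarrow> complex)) \<Rightarrow> bool" where
  "L2_bounded_op M T \<longleftrightarrow>
     (\<forall>f\<in>L2 M. T f \<in> L2 M) \<and>
     (\<forall>f\<in>L2 M. \<forall>g\<in>L2 M. L2_eq M f g \<longrightarrow> L2_eq M (T f) (T g)) \<and>
     (\<forall>f\<in>L2 M. \<forall>g\<in>L2 M. L2_eq M (T (\<lambda>x. f x + g x)) (\<lambda>x. T f x + T g x)) \<and>
     (\<forall>f\<in>L2 M. \<forall>c. L2_eq M (T (\<lambda>x. c * f x)) (\<lambda>x. c * T f x)) \<and>
     (\<exists>C. \<forall>f\<in>L2 M. L2_norm M (T f) \<le> C * L2_norm M f)"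

text \<open>The scalars \<open>z\<close> for which \<open>T - z\<close> has no two-sided inverse among the bounded operators.\<close>

definition L2_spectrum ::
    "'a measure \<Rightarrow> (('a \<Rightarrow> complex) \<Rightarrow> ('a \<Rightarrow> complex)) \<Rightarrow> complex set" where
  "L2_spectrum M T = {z. \<not> (\<exists>S. L2_bounded_op M S \<and>
     (\<forall>f\<in>L2 M. L2_eq M (S (\<lambda>x. T f x - z * f x)) f \<and>
                L2_eq M (\<lambda>x. T (S f) x - z * S f x) f))}"

section \<open>Operator integrals in the \<open>\<sigma>\<close>-weak topology\<close>

definition L2_square_summable :: "'a measure \<Rightarrow> (nat \<Rightarrow> 'a \<Rightarrow> complex) \<Rightarrow> bool" where
  "L2_square_summable M v \<longleftrightarrow> (\<forall>n. v n \<in> L2 M) \<and> summable (\<lambda>n. (L2_norm M (v n))\<^sup>2)"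

text \<open>
  For square summable sequences \<open>v\<close> and \<open>w\<close> of vectors, these are exactly the \<open>\<sigma>\<close>-weakly
  continuous linear functionals on the bounded operators.
\<close>

definition L2_normal_functional ::
    "'a measure \<Rightarrow> (nat \<Rightarrow> 'a \<Rightarrow> complex) \<Rightarrow> (nat \<Rightarrow> 'a \<Rightarrow> complex) \<Rightarrow>
      (('a \<Rightarrow> complex) \<Rightarrow> ('a \<Rightarrow> complex)) \<Rightarrow> complex" where
  "L2_normal_functional M v w T = (\<Sum>n. L2_inner M (T (v n)) (w n))"

text \<open>\<open>T\<close> is the integral of the operator-valued function \<open>F\<close> over the measure space \<open>N\<close>.\<close>

definition has_sigma_weak_integral ::
    "'b measure \<Rightarrow> 'a measure \<Rightarrow> ('b \<Rightarrow> ('a \<Rightarrow> complex) \<Rightarrow> ('a \<Rightarrow> complex)) \<Rightarrow>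
      (('a \<Rightarrow> complex) \<Rightarrow> ('a \<Rightarrow> complex)) \<Rightarrow> bool" where
  "has_sigma_weak_integral N M F T \<longleftrightarrow>
     (\<forall>\<zeta>\<in>space N. L2_bounded_op M (F \<zeta>)) \<and> L2_bounded_op M T \<and>
     (\<forall>v w. L2_square_summable M v \<longrightarrow> L2_square_summable M w \<longrightarrow>
        integrable N (\<lambda>\<zeta>. L2_normal_functional M v w (F \<zeta>)) \<and>
        L2_normal_functional M v w T = (LINT \<zeta>|N. L2_normal_functional M v w (F \<zeta>)))"

text \<open>
  The choice is immaterial: by the lemmas below, two integrals of the same function agree
  up to equality almost everywhere and have the same spectrum.
\<close>

definition sigma_weak_integral ::
    "'b measure \<Rightarrow> 'a measure \<Rightarrow> ('b \<Rightarrow> ('a \<Rightarrow> complex) \<Rightarrow> ('a \<Rightarrow> complex)) \<Rightarrow>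
      ('a \<Rightarrow> complex) \<Rightarrow> ('a \<Rightarrow> complex)" where
  "sigma_weak_integral N M F = (SOME T. has_sigma_weak_integral N M F T)"

lemma L2_mult_cnj_integrable:
  assumes "f \<in> L2 M" "g \<in> L2 M"
  shows "integrable M (\<lambda>x. f x * cnj (g x))"
proof (rule Bochner_Integration.integrable_bound)
  show "integrable M (\<lambda>x. (norm (f x))\<^sup>2 + (norm (g x))\<^sup>2)"
    using assms by (auto simp: L2_def)
  have [measurable]: "f \<in> borel_measurable M" "g \<in> borel_measurable M"
    using assms by (auto simp: L2_def)
  have "(\<lambda>x. cnj (g x)) \<in> borel_measurable M"
    by (rule borel_measurable_continuous_on[where f = cnj]) (auto intro: continuous_intros)
  then show "(\<lambda>x. f x * cnj (g x)) \<in> borel_measurable M"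
    by measurable
  have "a * b \<le> a\<^sup>2 + b\<^sup>2" if "a \<ge> 0" "b \<ge> 0" for a b :: real
  proof -
    have "2 * (a * b) \<le> a\<^sup>2 + b\<^sup>2"
      using sum_squares_bound[of a b] by (simp add: mult.assoc)
    moreover have "0 \<le> a * b" using that by simp
    ultimately show ?thesis by linarith
  qed
  then show "AE x in M. norm (f x * cnj (g x)) \<le> norm ((norm (f x))\<^sup>2 + (norm (g x))\<^sup>2)"
    by (simp add: norm_mult)
qed

lemma L2_add:
  assumes "f \<in> L2 M" "g \<in> L2 M"
  shows "(\<lambda>x. f x + g x) \<in> L2 M"
proof -
  have [measurable]: "f \<in> borel_measurable M" "g \<in> borel_measurable M"
    using assms by (auto simp: L2_def)
  have "integrable M (\<lambda>x. (norm (f x + g x))\<^sup>2)"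
  proof (rule Bochner_Integration.integrable_bound)
    show "integrable M (\<lambda>x. 2 * (norm (f x))\<^sup>2 + 2 * (norm (g x))\<^sup>2)"
      using assms by (auto simp: L2_def)
    have "(norm (a + b))\<^sup>2 \<le> 2 * (norm a)\<^sup>2 + 2 * (norm b)\<^sup>2" for a b :: complex
    proof -
      have "(norm (a + b))\<^sup>2 \<le> (norm a + norm b)\<^sup>2"
        by (intro power_mono norm_triangle_ineq) simp
      also have "\<dots> \<le> 2 * (norm a)\<^sup>2 + 2 * (norm b)\<^sup>2"
        using sum_squares_bound[of "norm a" "norm b"] by (simp add: power2_sum)
      finally show ?thesis .
    qed
    then show "AE x in M. norm ((norm (f x + g x))\<^sup>2)
        \<le> norm (2 * (norm (f x))\<^sup>2 + 2 * (norm (g x))\<^sup>2)"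
      by simp
  qed measurable
  then show ?thesis by (simp add: L2_def)
qed

lemma L2_cmult:
  assumes "f \<in> L2 M"
  shows "(\<lambda>x. c * f x) \<in> L2 M"
  using assms by (auto simp: L2_def norm_mult power_mult_distrib)

lemma L2_diff:
  assumes "f \<in> L2 M" "g \<in> L2 M"
  shows "(\<lambda>x. f x - g x) \<in> L2 M"
  using L2_add[OF assms(1) L2_cmult[OF assms(2), of "-1"]] by simp

lemma has_sigma_weak_integral_unique:
  fixes M :: "'a measure"
  assumes S: "has_sigma_weak_integral N M F S" and T: "has_sigma_weak_integral N M F T"
    and f: "f \<in> L2 M"
  shows "L2_eq M (S f) (T f)"
proof -
  define g where "g = (\<lambda>x. S f x - T f x)"
  have Sf: "S f \<in> L2 M" and Tf: "T f \<in> L2 M"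
    using S T f by (auto simp: has_sigma_weak_integral_def L2_bounded_op_def)
  then have g: "g \<in> L2 M" unfolding g_def by (rule L2_diff)
  define v where "v h n = (if n = 0 then h else (\<lambda>x. 0))" for h :: "'a \<Rightarrow> complex" and n :: nat
  have v: "L2_square_summable M (v h)" if "h \<in> L2 M" for h
  proof -
    have "summable (\<lambda>n. (L2_norm M (v h n))\<^sup>2)"
      by (rule summable_finite[of "{0}"]) (auto simp: v_def L2_norm_def)
    moreover have "(\<lambda>x. 0) \<in> L2 M" by (simp add: L2_def)
    ultimately show ?thesis using that by (auto simp: L2_square_summable_def v_def)
  qed
  have *: "L2_normal_functional M (v f) (v g) R = L2_inner M (R f) g" for R
    unfolding L2_normal_functional_def
    by (subst suminf_finite[of "{0}"]) (auto simp: v_def L2_inner_def)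
  have "L2_inner M (S f) g = L2_inner M (T f) g"
    using S T v[OF f] v[OF g] unfolding has_sigma_weak_integral_def *[symmetric] by metis
  then have "(LINT x|M. S f x * cnj (g x) - T f x * cnj (g x)) = 0"
    unfolding L2_inner_def
    by (subst Bochner_Integration.integral_diff)
      (auto intro: L2_mult_cnj_integrable Sf Tf g)
  moreover have "S f x * cnj (g x) - T f x * cnj (g x) = complex_of_real ((norm (g x))\<^sup>2)" for x
    unfolding complex_norm_square by (simp add: g_def algebra_simps)
  ultimately have "(LINT x|M. (norm (g x))\<^sup>2) = 0"
    by (simp only: integral_complex_of_real of_real_eq_0_iff)
  moreover have "integrable M (\<lambda>x. (norm (g x))\<^sup>2)"
    using g by (simp add: L2_def)
  ultimately have "AE x in M. (norm (g x))\<^sup>2 = 0"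
    by (subst (asm) integral_nonneg_eq_0_iff_AE) auto
  then show ?thesis by (simp add: L2_eq_def g_def)
qed

lemma L2_spectrum_cong:
  assumes S: "L2_bounded_op M S" and T: "L2_bounded_op M T"
    and ST: "\<And>f. f \<in> L2 M \<Longrightarrow> L2_eq M (S f) (T f)"
  shows "L2_spectrum M S = L2_spectrum M T"
proof -
  have main: "z \<in> L2_spectrum M T"
    if z: "z \<in> L2_spectrum M S" and S: "L2_bounded_op M S" and T: "L2_bounded_op M T"
      and ST: "\<And>f. f \<in> L2 M \<Longrightarrow> L2_eq M (S f) (T f)" for S T z
  proof (rule ccontr)
    assume "z \<notin> L2_spectrum M T"
    then obtain R where R: "L2_bounded_op M R"
      and inv: "\<forall>f\<in>L2 M. L2_eq M (R (\<lambda>x. T f x - z * f x)) f \<and>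
        L2_eq M (\<lambda>x. T (R f) x - z * R f x) f"
      unfolding L2_spectrum_def by blast
    obtain f where f: "f \<in> L2 M"
      and nf: "\<not> (L2_eq M (R (\<lambda>x. S f x - z * f x)) f \<and> L2_eq M (\<lambda>x. S (R f) x - z * R f x) f)"
      using z R unfolding L2_spectrum_def by blast
    have "(\<lambda>x. S f x - z * f x) \<in> L2 M" "(\<lambda>x. T f x - z * f x) \<in> L2 M"
      using f S T by (auto intro!: L2_diff L2_cmult simp: L2_bounded_op_def)
    moreover have "L2_eq M (\<lambda>x. S f x - z * f x) (\<lambda>x. T f x - z * f x)"
      using ST[OF f] by (auto simp: L2_eq_def)
    ultimately have "L2_eq M (R (\<lambda>x. S f x - z * f x)) (R (\<lambda>x. T f x - z * f x))"
      using R by (simp add: L2_bounded_op_def)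
    moreover have "L2_eq M (R (\<lambda>x. T f x - z * f x)) f" using inv f by blast
    ultimately have 1: "L2_eq M (R (\<lambda>x. S f x - z * f x)) f"
      unfolding L2_eq_def by eventually_elim simp
    have "L2_eq M (S (R f)) (T (R f))"
      using R f by (intro ST) (simp add: L2_bounded_op_def)
    moreover have "L2_eq M (\<lambda>x. T (R f) x - z * R f x) f" using inv f by blast
    ultimately have "L2_eq M (\<lambda>x. S (R f) x - z * R f x) f"
      unfolding L2_eq_def by eventually_elim simp
    with 1 nf show False by blast
  qed
  have "L2_eq M (T f) (S f)" if "f \<in> L2 M" for f
    using ST[OF that] by (auto simp: L2_eq_def)
  then show ?thesis using main[OF _ S T ST] main[OF _ T S] by blast
qed

end

theory Submission
  imports Defs
begin

text \<open>
  Amenability is characterised by sequences of unit vectors \<open>f\<^sub>n\<close> in \<open>L\<^sup>2\<close> with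
  \<open>\<parallel>\<lambda>\<^sub>\<zeta> f\<^sub>n - f\<^sub>n\<parallel> \<longlonglongrightarrow> 0\<close> for every \<open>\<zeta>\<close>. Such a sequence consists of approximate eigenvectors of
  \<open>\<lambda>(k) = \<integral> k(\<zeta>) \<lambda>\<^sub>\<zeta>\<close> for the value \<open>\<integral> k\<close>, whatever the integrable \<open>k \<ge> 0\<close>. Conversely, if \<open>\<integral> k\<close> lies in
  the spectrum, then the Neumann series forces \<open>\<parallel>\<lambda>(k)\<parallel> = \<integral> k\<close>, so for some unit vector \<open>f\<close> the vectors
  \<open>\<lambda>\<^sub>\<zeta> f\<close> are close to one fixed vector for most \<open>\<zeta>\<close>. Letting \<open>k\<close> exhaust the group gives a sequence that
  is almost invariant under a conull subgroup, which is the whole group. A cluster point of the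
  functionals \<open>\<phi> \<mapsto> \<integral> \<phi> \<bar>f\<^sub>n\<bar>\<^sup>2\<close> is then an invariant mean.

  To get almost invariant vectors from a mean \<open>m\<close>, let \<open>e\<close> be the normalised indicator of a compact set
  and separate the convex set of all tuples \<open>(\<lambda>\<^sub>\<zeta>e * v - e * v)\<^sub>\<zeta>\<close>, with \<open>v\<close> a probability density and \<open>\<zeta>\<close>
  in a finite set, from \<open>0\<close> in \<open>L\<^sup>1\<close>. A separating \<open>\<Phi>\<close> would contradict the invariance of \<open>m\<close> on the
  functions \<open>y \<mapsto> \<integral> e(\<eta>) \<Phi>(\<eta>y) d\<eta>\<close>. Since \<open>\<zeta> \<mapsto> \<lambda>\<^sub>\<zeta>e\<close> is continuous in \<open>L\<^sup>1\<close>, densities \<open>u\<^sub>n = e * v\<^sub>n\<close>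
  that are almost invariant under a dense sequence are almost invariant everywhere; take \<open>f\<^sub>n = sqrt u\<^sub>n\<close>.
\<close>

section \<open>Separating convex sets in \<open>L\<^sup>1\<close>\<close>

text \<open>Amenability supplies a mean that is invariant under single translations, whereas the
  separation argument asks it to respect integrals of translates. Smoothing over a compact set
  bridges the gap: a smoothed function has a norm continuous orbit under left translation, so its
  integrals over compact sets are uniform limits of Riemann sums, and a mean respects those.
  Comparison with a smoothing over a small neighbourhood of the identity then handles an arbitrary
  bounded measurable function.

  The separating function is found by minimisation. A small quadratic penalty with an integrable
  weight makes the best test function for an element of L^1 unique and stable, and this stability
  along a minimising sequence takes the place of weak-* compactness.

  Both implications use of the weight \<delta>^p only that it is positive and integrable over the
  sets at hand. Exhausting compact sets can be made symmetric, so symmetric sets with p = 1/2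
  already detect amenability.\<close>

definition clamped_quotient :: "('a \<Rightarrow> real) \<Rightarrow> ('a \<Rightarrow> real) \<Rightarrow> 'a \<Rightarrow> real" where
  "clamped_quotient w g x = max (- 1) (min 1 (g x / w x))"

text \<open>The pairing of L^1 with its dual, minus a quadratic penalty that makes it strictly
  concave in \<open>\<phi>\<close>. Its maximiser over the unit ball is
  \<open>clamped_quotient w g\<close>, a stable substitute for the sign of \<open>g\<close>.\<close>

definition penalized_pairing ::
    "'a measure \<Rightarrow> ('a \<Rightarrow> real) \<Rightarrow> ('a \<Rightarrow> real) \<Rightarrow> ('a \<Rightarrow> real) \<Rightarrow> real" where
  "penalized_pairing M w \<phi> g = (LINT x|M. \<phi> x * g x - w x * (\<phi> x)\<^sup>2 / 2)"

lemma abs_clamped_quotient_le: "\<bar>clamped_quotient w g x\<bar> \<le> 1"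
  by (auto simp: clamped_quotient_def)

lemma clamped_quotient_measurable [measurable]:
  "w \<in> borel_measurable M \<Longrightarrow> g \<in> borel_measurable M \<Longrightarrow> clamped_quotient w g \<in> borel_measurable M"
  unfolding clamped_quotient_def[abs_def] by simp

text \<open>Expanding both sides leaves (a - b)(g - w a) \<ge> 0 for the clamped value a. This is
  the first-order condition: the slope g - w a vanishes where nothing is clamped and points out of
  [-1, 1] at an endpoint. The square on the left is the gain from strong concavity, kept because it
  later measures distances between test functions.\<close>

lemma clamped_quotient_maximizes:
  fixes b :: real
  assumes "w x > 0" "\<bar>b\<bar> \<le> 1"
  shows "b * g x - w x * b\<^sup>2 / 2 + w x * (clamped_quotient w g x - b)\<^sup>2 / 2
    \<le> clamped_quotient w g x * g x - w x * (clamped_quotient w g x)\<^sup>2 / 2"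
proof -
  let ?a = "clamped_quotient w g x"
  have "0 \<le> (?a - b) * (g x - w x * ?a)"
  proof (cases "g x / w x > 1")
    case True
    then have "?a = 1" "g x > w x" using assms by (auto simp: clamped_quotient_def field_simps)
    then show ?thesis using assms by (intro mult_nonneg_nonneg) auto
  next
    case False
    show ?thesis
    proof (cases "g x / w x < - 1")
      case True
      then have "?a = - 1" "g x < - w x" using assms
        by (auto simp: clamped_quotient_def field_simps)
      then show ?thesis using assms by (intro mult_nonpos_nonpos) auto
    next
      case F: False
      then have "?a = g x / w x" using False by (auto simp: clamped_quotient_def)
      then show ?thesis using assms by simp
    qed
  qed
  then show ?thesis by (simp add: field_simps power2_eq_square)
qed

lemma integrable_bounded_mult:
  fixes \<phi> g :: "'a \<Rightarrow> real"
  assumes "integrable M g" and [measurable]: "\<phi> \<in> borel_measurable M" and "\<And>x. \<bar>\<phi> x\<bar> \<le> C"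
  shows "integrable M (\<lambda>x. \<phi> x * g x)"
proof (rule Bochner_Integration.integrable_bound)
  show "integrable M (\<lambda>x. C * g x)" using assms by simp
  have [measurable]: "g \<in> borel_measurable M" using assms by auto
  show "(\<lambda>x. \<phi> x * g x) \<in> borel_measurable M" by measurable
  have "0 \<le> C" using assms(3)[of undefined] by linarith
  then show "AE x in M. norm (\<phi> x * g x) \<le> norm (C * g x)"
    using assms(3) by (auto simp: abs_mult mult_right_mono)
qed

lemma integrable_penalty:
  fixes \<phi> \<psi> w :: "'a \<Rightarrow> real"
  assumes "integrable M w" and [measurable]: "\<phi> \<in> borel_measurable M" "\<psi> \<in> borel_measurable M"
    and "\<And>x. \<bar>\<phi> x\<bar> \<le> 1" "\<And>x. \<bar>\<psi> x\<bar> \<le> 1"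
  shows "integrable M (\<lambda>x. w x * (\<phi> x - \<psi> x)\<^sup>2)"
proof -
  have "integrable M (\<lambda>x. (\<phi> x - \<psi> x)\<^sup>2 * w x)"
  proof (rule integrable_bounded_mult[where C = 4])
    show "\<bar>(\<phi> x - \<psi> x)\<^sup>2\<bar> \<le> 4" for x
    proof -
      have "\<bar>\<phi> x - \<psi> x\<bar> \<le> 2" using assms(4)[of x] assms(5)[of x] by linarith
      then have "\<bar>\<phi> x - \<psi> x\<bar>\<^sup>2 \<le> 2\<^sup>2" by (rule power_mono) simp
      then show ?thesis by simp
    qed
  qed (use assms in auto)
  then show ?thesis by (simp add: mult.commute)
qed

lemma integrable_penalized_pairing:
  fixes \<phi> g w :: "'a \<Rightarrow> real"
  assumes "integrable M w" "integrable M g" "\<phi> \<in> borel_measurable M" "\<And>x. \<bar>\<phi> x\<bar> \<le> 1"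
  shows "integrable M (\<lambda>x. \<phi> x * g x - w x * (\<phi> x)\<^sup>2 / 2)"
  using integrable_bounded_mult[OF assms(2,3,4)] integrable_penalty[OF assms(1,3), of "\<lambda>x. 0"] assms
  by auto

lemma penalized_pairing_le:
  fixes \<phi> g w :: "'a \<Rightarrow> real"
  assumes w: "integrable M w" "\<And>x. w x > 0" and g: "integrable M g"
    and \<phi>: "\<phi> \<in> borel_measurable M" "\<And>x. \<bar>\<phi> x\<bar> \<le> 1"
  shows "penalized_pairing M w \<phi> g + (LINT x|M. w x * (clamped_quotient w g x - \<phi> x)\<^sup>2) / 2
    \<le> penalized_pairing M w (clamped_quotient w g) g"
proof -
  have [measurable]: "w \<in> borel_measurable M" "g \<in> borel_measurable M" using w g by auto
  have m: "clamped_quotient w g \<in> borel_measurable M" by measurable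
  note int = integrable_penalized_pairing[OF w(1) g]
  have "penalized_pairing M w \<phi> g + (LINT x|M. w x * (clamped_quotient w g x - \<phi> x)\<^sup>2) / 2
    = (LINT x|M. (\<phi> x * g x - w x * (\<phi> x)\<^sup>2 / 2) + w x * (clamped_quotient w g x - \<phi> x)\<^sup>2 / 2)"
    unfolding penalized_pairing_def
    using int[OF \<phi>] integrable_penalty[OF w(1) m \<phi>(1) abs_clamped_quotient_le \<phi>(2)]
    by (subst Bochner_Integration.integral_add) auto
  also have "\<dots> \<le> penalized_pairing M w (clamped_quotient w g) g"
    unfolding penalized_pairing_def
  proof (rule integral_mono)
    show "integrable M (\<lambda>x. (\<phi> x * g x - w x * (\<phi> x)\<^sup>2 / 2)
        + w x * (clamped_quotient w g x - \<phi> x)\<^sup>2 / 2)"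
      using int[OF \<phi>] integrable_penalty[OF w(1) m \<phi>(1) abs_clamped_quotient_le \<phi>(2)]
      by auto
    show "integrable M (\<lambda>x. clamped_quotient w g x * g x - w x * (clamped_quotient w g x)\<^sup>2 / 2)"
      by (rule int[OF m abs_clamped_quotient_le])
    show "(\<phi> x * g x - w x * (\<phi> x)\<^sup>2 / 2) + w x * (clamped_quotient w g x - \<phi> x)\<^sup>2 / 2
      \<le> clamped_quotient w g x * g x - w x * (clamped_quotient w g x)\<^sup>2 / 2" for x
      by (rule clamped_quotient_maximizes[where w = w and b = "\<phi> x", OF w(2) \<phi>(2)])
  qed
  finally show ?thesis .
qed

text \<open>The penalty does not depend on the L^1 argument; since the coefficients add up to 1, it
  reappears exactly once.\<close>

lemma penalized_pairing_affine:
  fixes \<phi> g h w :: "'a \<Rightarrow> real"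
  assumes w: "integrable M w" and g: "integrable M g" "integrable M h"
    and \<phi>: "\<phi> \<in> borel_measurable M" "\<And>x. \<bar>\<phi> x\<bar> \<le> 1"
  shows "penalized_pairing M w \<phi> (\<lambda>x. (1 - t) * g x + t * h x)
    = (1 - t) * penalized_pairing M w \<phi> g + t * penalized_pairing M w \<phi> h"
proof -
  have "(1 - t) * penalized_pairing M w \<phi> g + t * penalized_pairing M w \<phi> h
    = (LINT x|M. (1 - t) * (\<phi> x * g x - w x * (\<phi> x)\<^sup>2 / 2) + t * (\<phi> x * h x - w x * (\<phi> x)\<^sup>2 / 2))"
    unfolding penalized_pairing_def
    using integrable_penalized_pairing[OF w g(1) \<phi>] integrable_penalized_pairing[OF w g(2) \<phi>]
    by (subst Bochner_Integration.integral_add) auto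
  also have "\<dots> = penalized_pairing M w \<phi> (\<lambda>x. (1 - t) * g x + t * h x)"
    unfolding penalized_pairing_def
    by (rule Bochner_Integration.integral_cong) (auto simp: field_simps)
  finally show ?thesis by simp
qed

text \<open>By monotone convergence the sum has a finite integral and is therefore finite almost
  everywhere. This converts summable bounds on integrals into pointwise convergence.\<close>

lemma AE_summable_if_summable_integral:
  fixes f :: "nat \<Rightarrow> 'a \<Rightarrow> real"
  assumes int: "\<And>n. integrable M (f n)" and nn: "\<And>n x. 0 \<le> f n x"
    and sm: "summable (\<lambda>n. LINT x|M. f n x)"
  shows "AE x in M. summable (\<lambda>n. f n x)"
proof -
  have [measurable]: "f n \<in> borel_measurable M" for n using int by auto
  have "(\<integral>\<^sup>+x. (\<Sum>n. ennreal (f n x)) \<partial>M) = (\<Sum>n. \<integral>\<^sup>+x. ennreal (f n x) \<partial>M)"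
    by (rule nn_integral_suminf) measurable
  also have "\<dots> = (\<Sum>n. ennreal (LINT x|M. f n x))"
    using int nn by (subst nn_integral_eq_integral) auto
  also have "\<dots> = ennreal (\<Sum>n. LINT x|M. f n x)"
    using sm nn by (intro suminf_ennreal2) (auto intro: Bochner_Integration.integral_nonneg)
  finally have "(\<integral>\<^sup>+x. (\<Sum>n. ennreal (f n x)) \<partial>M) \<noteq> \<infinity>" by simp
  then have "AE x in M. (\<Sum>n. ennreal (f n x)) \<noteq> \<infinity>"
    by (intro nn_integral_PInf_AE) measurable
  then show ?thesis
  proof eventually_elim
    case (elim x)
    then show ?case using nn by (intro summable_suminf_not_top) (auto simp: top_ennreal_def)
  qed
qed

lemma (in sigma_finite_measure) obtain_positive_integrable:
  assumes "\<epsilon> > 0"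
  obtains w :: "'a \<Rightarrow> real" where "integrable M w" "\<And>x. w x > 0" "(LINT x|M. w x) \<le> \<epsilon>"
proof -
  obtain h where h: "h \<in> borel_measurable M" "integral\<^sup>N M h \<noteq> \<infinity>"
    "\<And>x. x \<in> space M \<Longrightarrow> 0 < h x \<and> h x < \<infinity>"
    using Ex_finite_integrable_function by blast
  note [measurable] = h(1)
  define v where "v x = (if x \<in> space M then enn2real (h x) else 1)" for x
  have v0: "v x > 0" for x using h(3)[of x] by (auto simp: v_def enn2real_positive_iff)
  have [measurable]: "v \<in> borel_measurable M" unfolding v_def by measurable
  have "integrable M v"
  proof (rule integrableI_nonneg)
    have "(\<integral>\<^sup>+x. ennreal (v x) \<partial>M) = integral\<^sup>N M h"
      using h(3) by (intro nn_integral_cong) (auto simp: v_def less_top)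
    then show "(\<integral>\<^sup>+x. ennreal (v x) \<partial>M) < \<infinity>" using h(2) by (simp add: top.not_eq_extremum)
  qed (use v0 in \<open>auto intro!: less_imp_le\<close>)
  define c where "c = \<epsilon> / (1 + (LINT x|M. v x))"
  have I: "(LINT x|M. v x) \<ge> 0" using v0 by (intro Bochner_Integration.integral_nonneg) (auto intro: less_imp_le)
  then have c: "c > 0" using assms by (simp add: c_def)
  show ?thesis
  proof
    show "integrable M (\<lambda>x. c * v x)" using \<open>integrable M v\<close> by simp
    show "c * v x > 0" for x using c v0 by simp
    have "c * (LINT x|M. v x) \<le> c * (1 + (LINT x|M. v x))" using c by simp
    also have "\<dots> = \<epsilon>" using I by (simp add: c_def)
    finally show "(LINT x|M. c * v x) \<le> \<epsilon>" by simp
  qed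
qed

text \<open>
  The clamped quotient of \<open>g\<close> maximises the penalised pairing with \<open>g\<close>. Along a sequence in \<open>C\<close> minimising
  this maximum, strict concavity makes the clamped quotients converge, and their limit separates.
\<close>

lemma (in sigma_finite_measure) L1_convex_separation:
  fixes C :: "('a \<Rightarrow> real) set"
  assumes int: "\<And>g. g \<in> C \<Longrightarrow> integrable M g"
    and ne: "C \<noteq> {}"
    and conv: "\<And>g h t. g \<in> C \<Longrightarrow> h \<in> C \<Longrightarrow> 0 < t \<Longrightarrow> t < 1 \<Longrightarrow> (\<lambda>x. (1 - t) * g x + t * h x) \<in> C"
    and away: "\<And>g. g \<in> C \<Longrightarrow> \<epsilon> \<le> (LINT x|M. \<bar>g x\<bar>)" and "\<epsilon> > 0"
  obtains \<Phi> where "\<Phi> \<in> borel_measurable M" "\<And>x. \<bar>\<Phi> x\<bar> \<le> 1"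
    "\<And>g. g \<in> C \<Longrightarrow> \<epsilon> / 2 \<le> (LINT x|M. \<Phi> x * g x)"
proof -
  \<comment> \<open>The mass bound limits the penalty to \<epsilon> / 2, which is why half of
    \<epsilon> survives in the conclusion.\<close>
  obtain w :: "'a \<Rightarrow> real" where w: "integrable M w" "\<And>x. w x > 0" "(LINT x|M. w x) \<le> \<epsilon>"
    using obtain_positive_integrable[OF \<open>\<epsilon> > 0\<close>] by blast
  have [measurable]: "w \<in> borel_measurable M" using w by auto
  have gm: "g \<in> borel_measurable M" if "g \<in> C" for g using int[OF that] by auto
  define D where "D = penalized_pairing M w"
  define cl where "cl g = clamped_quotient w g" for g
  define J where "J g = D (cl g) g" for g
  define E where "E \<phi> \<psi> = (LINT x|M. w x * (\<phi> x - \<psi> x)\<^sup>2)" for \<phi> \<psi> :: "'a \<Rightarrow> real"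
  have clm: "cl g \<in> borel_measurable M" if "g \<in> C" for g
    unfolding cl_def using gm[OF that] by measurable
  have cl1: "\<bar>cl g x\<bar> \<le> 1" for g x unfolding cl_def by (rule abs_clamped_quotient_le)
  have E0: "0 \<le> E \<phi> \<psi>" for \<phi> \<psi> unfolding E_def using w(2)
      by (intro Bochner_Integration.integral_nonneg) (simp add: less_imp_le)
  have Dle: "D \<phi> g + E (cl g) \<phi> / 2 \<le> J g"
    if "g \<in> C" "\<phi> \<in> borel_measurable M" "\<And>x. \<bar>\<phi> x\<bar> \<le> 1" for \<phi> g
    unfolding D_def E_def J_def cl_def
    by (rule penalized_pairing_le[OF w(1,2) int[OF that(1)] that(2,3)])
  \<comment> \<open>The sign of \<open>g\<close> as a test function recovers the L^1 norm and costs
    at most half of the mass of \<open>w\<close>.\<close>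
  have Jge: "\<epsilon> / 2 \<le> J g" if g: "g \<in> C" for g
  proof -
    note [measurable] = gm[OF g]
    have "\<epsilon> / 2 \<le> (LINT x|M. \<bar>g x\<bar>) - (LINT x|M. w x / 2)" using away[OF g] w(3) by simp
    also have "\<dots> = (LINT x|M. \<bar>g x\<bar> - w x / 2)"
      using int[OF g] w(1) by (subst Bochner_Integration.integral_diff) auto
    also have "\<dots> \<le> D (\<lambda>x. sgn (g x)) g"
      unfolding D_def penalized_pairing_def
    proof (rule integral_mono)
      show "integrable M (\<lambda>x. \<bar>g x\<bar> - w x / 2)" using int[OF g] w(1) by auto
      show "integrable M (\<lambda>x. sgn (g x) * g x - w x * (sgn (g x))\<^sup>2 / 2)"
        by (rule integrable_penalized_pairing[OF w(1) int[OF g]]) (auto simp: sgn_if)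
      show "\<bar>g x\<bar> - w x / 2 \<le> sgn (g x) * g x - w x * (sgn (g x))\<^sup>2 / 2" for x
        using w(2)[of x] by (auto simp: sgn_if)
    qed
    also have "\<dots> \<le> J g"
      using Dle[OF g, of "\<lambda>x. sgn (g x)"] E0[of "cl g" "\<lambda>x. sgn (g x)"]
      by (force simp: abs_sgn_eq)
    finally show ?thesis .
  qed
  define I where "I = (INF g\<in>C. J g)"
  have bdd: "bdd_below (J ` C)" using Jge by (intro bdd_belowI[of _ "\<epsilon> / 2"]) auto
  have Ile: "I \<le> J g" if "g \<in> C" for g unfolding I_def using bdd that by (rule cINF_lower)
  have Ige: "\<epsilon> / 2 \<le> I" unfolding I_def using ne Jge by (rule cINF_greatest)
  \<comment> \<open>The optimal test function of a point on the segment is tried on both endpoints;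
    at \<open>g\<close> the strong concavity term records how far it is from optimal there.\<close>
  have seg: "I \<le> (1 - t) * (J g - E (cl g) \<phi> / 2) + t * D \<phi> h"
    if g: "g \<in> C" and h: "h \<in> C" and t: "0 < t" "t < 1"
      and \<phi>: "\<phi> = cl (\<lambda>x. (1 - t) * g x + t * h x)" for g h t \<phi>
  proof -
    have mid: "(\<lambda>x. (1 - t) * g x + t * h x) \<in> C" using g h t by (rule conv)
    have \<phi>m: "\<phi> \<in> borel_measurable M" "\<And>x. \<bar>\<phi> x\<bar> \<le> 1" using clm[OF mid] cl1 by (auto simp: \<phi>)
    have "I \<le> J (\<lambda>x. (1 - t) * g x + t * h x)" using Ile[OF mid] .
    also have "\<dots> = (1 - t) * D \<phi> g + t * D \<phi> h"
      unfolding J_def \<phi>[symmetric] D_def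
      by (rule penalized_pairing_affine[OF w(1) int[OF g] int[OF h] \<phi>m])
    also have "\<dots> \<le> (1 - t) * (J g - E (cl g) \<phi> / 2) + t * D \<phi> h"
      using Dle[OF g \<phi>m] t by (intro add_right_mono mult_left_mono) auto
    finally show ?thesis .
  qed
  \<comment> \<open>The rate is chosen against the step sizes \<open>1 / 4 ^ Suc n\<close> used
    below: the optimality gap still tends to 0 after division by the step.\<close>
  have "\<exists>g\<in>C. J g < I + 1 / 16 ^ n" for n :: nat
  proof -
    have "(INF g\<in>C. J g) < I + 1 / 16 ^ n" unfolding I_def by simp
    then show ?thesis using cINF_less_iff[OF ne bdd] by simp
  qed
  then obtain g where g: "\<And>n. g n \<in> C" and gJ: "\<And>n. J (g n) < I + 1 / 16 ^ n" by metis
  note [measurable] = gm[OF g] clm[OF g]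
  \<comment> \<open>Squared distances of order 4^-n remain summable with the weight 2^n, and 2 |d|
    \<le> 2^-n + 2^n d^2 turns pointwise summability of the weighted squares into absolute
    convergence.\<close>
  have close: "AE x in M. summable (\<lambda>n. a n x - b n x)"
    if m: "\<And>n. a n \<in> borel_measurable M" "\<And>n. b n \<in> borel_measurable M"
      and bd: "\<And>n x. \<bar>a n x\<bar> \<le> 1" "\<And>n x. \<bar>b n x\<bar> \<le> 1" and E: "\<And>n. E (a n) (b n) \<le> B / 4 ^ n"
    for a b :: "nat \<Rightarrow> 'a \<Rightarrow> real" and B
  proof -
    have "AE x in M. summable (\<lambda>n. 2 ^ n * (w x * (a n x - b n x)\<^sup>2))"
    proof (rule AE_summable_if_summable_integral)
      show "integrable M (\<lambda>x. 2 ^ n * (w x * (a n x - b n x)\<^sup>2))" for n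
        using integrable_penalty[OF w(1) m bd] by simp
      show "0 \<le> 2 ^ n * (w x * (a n x - b n x)\<^sup>2)" for n x
        using w(2)[of x] by simp
      have "summable (\<lambda>n. 2 ^ n * E (a n) (b n))"
      proof (rule summable_comparison_test')
        show "summable (\<lambda>n. B * (1 / 2) ^ n)" by (intro summable_mult summable_geometric) simp
        have "2 ^ n * E (a n) (b n) \<le> 2 ^ n * (B / 4 ^ n)" for n
          using E by (intro mult_left_mono) auto
        also have "2 ^ n * (B / 4 ^ n) = B * (1 / 2) ^ n" for n
          using power_mult_distrib[of "2::real" 2 n] by (simp add: field_simps)
        finally show "norm (2 ^ n * E (a n) (b n)) \<le> B * (1 / 2) ^ n" for n
          using E0 by simp
      qed
      then show "summable (\<lambda>n. LINT x|M. 2 ^ n * (w x * (a n x - b n x)\<^sup>2))"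
        by (simp add: E_def)
    qed
    then show ?thesis
    proof eventually_elim
      case (elim x)
      have "summable (\<lambda>n. inverse (w x) * (2 ^ n * (w x * (a n x - b n x)\<^sup>2)))"
        using elim by (rule summable_mult)
      then have "summable (\<lambda>n. (1 / 2) ^ n + 2 ^ n * (a n x - b n x)\<^sup>2)"
        using w(2)[of x] by (intro summable_add summable_geometric) (auto simp: field_simps)
      then show ?case
      proof (rule summable_comparison_test')
        fix n
        let ?d = "\<bar>a n x - b n x\<bar>"
        have "0 \<le> (1 - 2 ^ n * ?d)\<^sup>2" by simp
        then have "2 ^ n * (2 * ?d) \<le> 2 ^ n * ((1 / 2) ^ n + 2 ^ n * ?d\<^sup>2)"
          by (simp add: power2_eq_square algebra_simps power_one_over)
        then have "2 * ?d \<le> (1 / 2) ^ n + 2 ^ n * ?d\<^sup>2" by simp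
        then show "norm (a n x - b n x) \<le> (1 / 2) ^ n + 2 ^ n * (a n x - b n x)\<^sup>2"
            using order_trans[of ?d "2 * ?d" "(1 / 2) ^ n + 2 ^ n * ?d\<^sup>2"] by simp
      qed
    qed
  qed
  \<comment> \<open>The test function of the midpoint of two consecutive members is close to those
    of both, so consecutive clamped quotients are close to each other.\<close>
  define \<psi> where "\<psi> n = cl (\<lambda>x. (1 - 1 / 2) * g n x + 1 / 2 * g (Suc n) x)" for n
  have midC: "(\<lambda>x. (1 - 1 / 2) * g n x + 1 / 2 * g (Suc n) x) \<in> C" for n
    by (rule conv[OF g g]) auto
  have \<psi>m: "\<psi> n \<in> borel_measurable M" "\<bar>\<psi> n x\<bar> \<le> 1" for n x
    using clm[OF midC] cl1 by (auto simp: \<psi>_def)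
  have arith: "E' + F \<le> 4 * r"
    if "I \<le> (1 - 1 / 2) * (G - E' / 2) + 1 / 2 * H" "H + F / 2 \<le> L" "L < I + r" "G < I + r"
    for E' F G H L r :: real using that by (simp add: field_simps)
  have mid: "E (cl (g n)) (\<psi> n) \<le> 4 / 4 ^ n \<and> E (cl (g (Suc n))) (\<psi> n) \<le> 4 / 4 ^ n" for n
  proof -
    have "I \<le> (1 - 1 / 2) * (J (g n) - E (cl (g n)) (\<psi> n) / 2) + 1 / 2 * D (\<psi> n) (g (Suc n))"
      by (rule seg[OF g g]) (auto simp: \<psi>_def)
    moreover have "D (\<psi> n) (g (Suc n)) + E (cl (g (Suc n))) (\<psi> n) / 2 \<le> J (g (Suc n))"
      by (rule Dle[OF g \<psi>m])
    moreover have "J (g (Suc n)) < I + 1 / 16 ^ n"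
      using gJ[of "Suc n"] by (rule less_le_trans) (auto intro!: divide_left_mono)
    ultimately have "E (cl (g n)) (\<psi> n) + E (cl (g (Suc n))) (\<psi> n) \<le> 4 * (1 / 16 ^ n)"
      using gJ[of n] by (rule arith)
    moreover have "4 * (1 / 16 ^ n) \<le> (4::real) / 4 ^ n"
      unfolding times_divide_eq_right mult_1_right
      by (intro divide_left_mono power_mono) auto
    ultimately show ?thesis using E0[of "cl (g n)" "\<psi> n"] E0[of "cl (g (Suc n))" "\<psi> n"] by linarith
  qed
  have "AE x in M. summable (\<lambda>n. cl (g n) x - \<psi> n x)"
    by (rule close) (use mid clm[OF g] \<psi>m cl1 in auto)
  moreover have "AE x in M. summable (\<lambda>n. cl (g (Suc n)) x - \<psi> n x)"
    by (rule close) (use mid clm[OF g] \<psi>m cl1 in auto)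
  ultimately have conv_cl: "AE x in M. convergent (\<lambda>n. cl (g n) x)"
  proof eventually_elim
    case (elim x)
    then have "summable (\<lambda>n. cl (g (Suc n)) x - cl (g n) x)"
      using summable_diff[OF elim(2) elim(1)] by simp
    then have "convergent (\<lambda>n. \<Sum>i<n. cl (g (Suc i)) x - cl (g i) x)"
      by (simp add: summable_iff_convergent)
    then have "convergent (\<lambda>n. cl (g n) x - cl (g 0) x)"
      by (simp add: sum_lessThan_telescope[of "\<lambda>n. cl (g n) x"])
    then show ?case
      using convergent_add_const_iff[of "- cl (g 0) x" "\<lambda>n. cl (g n) x"] by simp
  qed
  \<comment> \<open>Clamping again keeps the bound also on the null set where the sequence may
    diverge and \<open>lim\<close> is arbitrary.\<close>
  define \<Phi> where "\<Phi> x = max (- 1) (min 1 (lim (\<lambda>n. cl (g n) x)))" for x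
  have \<Phi>m: "\<Phi> \<in> borel_measurable M"
    unfolding \<Phi>_def[abs_def] by (intro borel_measurable_max borel_measurable_min borel_measurable_lim_metric) auto
  have \<Phi>1: "\<bar>\<Phi> x\<bar> \<le> 1" for x by (auto simp: \<Phi>_def)
  have lim: "AE x in M. (\<lambda>n. cl (g n) x) \<longlonglongrightarrow> \<Phi> x"
    using conv_cl
  proof eventually_elim
    case (elim x)
    then have *: "(\<lambda>n. cl (g n) x) \<longlonglongrightarrow> lim (\<lambda>n. cl (g n) x)" by (simp add: convergent_LIMSEQ_iff)
    have "cl (g n) x \<le> 1" "- 1 \<le> cl (g n) x" for n using cl1[of "g n" x] by linarith+
    then have "lim (\<lambda>n. cl (g n) x) \<le> 1" "- 1 \<le> lim (\<lambda>n. cl (g n) x)"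
      by (blast intro: LIMSEQ_le_const2[OF *], blast intro: LIMSEQ_le_const[OF *])
    with * show ?case by (simp add: \<Phi>_def)
  qed
  have "\<epsilon> / 2 \<le> (LINT x|M. \<Phi> x * h x)" if h: "h \<in> C" for h
  proof -
    note [measurable] = gm[OF h] \<Phi>m
    \<comment> \<open>A directional derivative test at the infimum: \<open>g n\<close> is moved
      towards \<open>h\<close> by a step that tends to 0 more slowly than the optimality gap. The
      gap divided by the step is \<open>4 * (1 / 4) ^ n\<close>.\<close>
    define t where "t n = (1::real) / 4 ^ Suc n" for n
    have t: "0 < t n" "t n < 1" "t n \<le> 1 / 2" for n
    proof -
      have "(1::real) \<le> 4 ^ n" by simp
      then have "1 < 4 * (4::real) ^ n" "1 \<le> 2 * (4::real) ^ n" by linarith+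
      then show "0 < t n" "t n < 1" "t n \<le> 1 / 2" by (simp_all add: t_def field_simps)
    qed
    define \<eta> where "\<eta> n = cl (\<lambda>x. (1 - t n) * g n x + t n * h x)" for n
    have \<eta>m: "\<eta> n \<in> borel_measurable M" "\<bar>\<eta> n x\<bar> \<le> 1" for n x
      using clm[OF conv[OF g h t(1,2)]] cl1 by (auto simp: \<eta>_def)
    note [measurable] = \<eta>m(1)
    have s: "I \<le> (1 - t n) * (J (g n) - E (cl (g n)) (\<eta> n) / 2) + t n * D (\<eta> n) h" for n
      using seg[OF g h t(1,2) \<eta>_def] .
    have "E (cl (g n)) (\<eta> n) \<le> 4 * (1 + J h) / 4 ^ n" for n
    proof -
      have "D (\<eta> n) h \<le> J h"
        using Dle[OF h \<eta>m, of n] E0[of "cl h" "\<eta> n"] by linarith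
      then have "t n * D (\<eta> n) h \<le> t n * J h" using t(1)[of n] by (intro mult_left_mono) auto
      moreover have "(1 - t n) * J (g n) \<le> (1 - t n) * (I + 1 / 16 ^ n)"
        using gJ[of n] t(2)[of n] by (intro mult_left_mono) auto
      moreover have "(1 / 2) * E (cl (g n)) (\<eta> n) \<le> (1 - t n) * E (cl (g n)) (\<eta> n)"
        using t(3)[of n] E0 by (intro mult_right_mono) auto
      moreover have "0 \<le> t n * I" using t(1)[of n] Ige \<open>\<epsilon> > 0\<close> by simp
      moreover have "0 \<le> t n * (1 / 16 ^ n)" using t(1)[of n] by simp
      ultimately have "E (cl (g n)) (\<eta> n) \<le> 4 * (1 / 16 ^ n) + 4 * (t n * J h)"
        using s[of n] by (simp only: ring_distribs)
      also have "\<dots> \<le> 4 * (1 / 4 ^ n) + 4 * (1 / 4 ^ n * J h)"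
        using Jge[OF h] \<open>\<epsilon> > 0\<close>
        by (intro add_mono mult_left_mono mult_right_mono divide_left_mono power_mono)
          (auto simp: t_def field_simps)
      also have "\<dots> = 4 * (1 + J h) / 4 ^ n" by (simp add: field_simps)
      finally show ?thesis .
    qed
    then have "AE x in M. summable (\<lambda>n. cl (g n) x - \<eta> n x)"
      by (intro close[where B = "4 * (1 + J h)"]) (use clm[OF g] \<eta>m cl1 in auto)
    with lim have lim\<eta>: "AE x in M. (\<lambda>n. \<eta> n x) \<longlonglongrightarrow> \<Phi> x"
    proof eventually_elim
      case (elim x)
      have "(\<lambda>n. cl (g n) x - (cl (g n) x - \<eta> n x)) \<longlonglongrightarrow> \<Phi> x - 0"
        using elim by (intro tendsto_diff summable_LIMSEQ_zero)
      then show ?case by simp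
    qed
    have "(\<lambda>n. D (\<eta> n) h) \<longlonglongrightarrow> D \<Phi> h"
      unfolding D_def penalized_pairing_def
    proof (rule integral_dominated_convergence[where w = "\<lambda>x. \<bar>h x\<bar> + w x"])
      show "AE x in M. (\<lambda>n. \<eta> n x * h x - w x * (\<eta> n x)\<^sup>2 / 2) \<longlonglongrightarrow> \<Phi> x * h x - w x * (\<Phi> x)\<^sup>2 / 2"
        using lim\<eta> by eventually_elim (intro tendsto_intros, auto)
      have "\<bar>\<eta> n x * h x - w x * (\<eta> n x)\<^sup>2 / 2\<bar> \<le> \<bar>h x\<bar> + w x" for n x
      proof -
        have "\<bar>\<eta> n x * h x\<bar> \<le> 1 * \<bar>h x\<bar>"
          unfolding abs_mult by (intro mult_right_mono \<eta>m) auto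
        moreover have "w x * (\<eta> n x)\<^sup>2 \<le> w x * 1"
          using \<eta>m(2)[of n x] w(2)[of x] by (intro mult_left_mono) (auto simp: abs_square_le_1)
        moreover have "0 \<le> w x * (\<eta> n x)\<^sup>2" using w(2)[of x] by simp
        ultimately show ?thesis by linarith
      qed
      then show "AE x in M. norm (\<eta> n x * h x - w x * (\<eta> n x)\<^sup>2 / 2) \<le> \<bar>h x\<bar> + w x" for n
        by simp
    qed (use int[OF h] w(1) in auto)
    moreover have "(\<lambda>n. I - 4 * (1 / 4) ^ n) \<longlonglongrightarrow> I - 4 * 0"
      by (intro tendsto_intros LIMSEQ_power_zero) auto
    moreover have "I - 4 * (1 / 4) ^ n \<le> D (\<eta> n) h" for n
    proof -
      have "(1 - t n) * (J (g n) - E (cl (g n)) (\<eta> n) / 2) \<le> (1 - t n) * (I + 1 / 16 ^ n)"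
        using gJ[of n] t(2)[of n] E0[of "cl (g n)" "\<eta> n"] by (intro mult_left_mono) auto
      moreover have "0 \<le> t n * (1 / 16 ^ n)" using t(1)[of n] by simp
      ultimately have "t n * I \<le> 1 / 16 ^ n + t n * D (\<eta> n) h"
        using s[of n] by (simp only: ring_distribs)
      also have "1 / 16 ^ n = t n * (4 * (1 / 4) ^ n)"
        using power_mult_distrib[of "4::real" 4 n] by (simp add: t_def field_simps)
      finally have "t n * (I - 4 * (1 / 4) ^ n) \<le> t n * D (\<eta> n) h" by (simp add: algebra_simps)
      then show ?thesis using t(1)[of n] by simp
    qed
    ultimately have "I \<le> D \<Phi> h" using LIMSEQ_le by fastforce
    also have "\<dots> \<le> (LINT x|M. \<Phi> x * h x)"
      unfolding D_def penalized_pairing_def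
    proof (rule integral_mono)
      show "integrable M (\<lambda>x. \<Phi> x * h x - w x * (\<Phi> x)\<^sup>2 / 2)"
        by (rule integrable_penalized_pairing[OF w(1) int[OF h] \<Phi>m \<Phi>1])
      show "integrable M (\<lambda>x. \<Phi> x * h x)" by (rule integrable_bounded_mult[OF int[OF h] \<Phi>m \<Phi>1])
      show "\<Phi> x * h x - w x * (\<Phi> x)\<^sup>2 / 2 \<le> \<Phi> x * h x" for x using w(2)[of x] by simp
    qed
    finally show ?thesis using Ige by linarith
  qed
  with \<Phi>m \<Phi>1 show ?thesis by (rule that)
qed

section \<open>The Hilbert space \<open>L\<^sup>2\<close>\<close>

lemma L2_measurable: "f \<in> L2 M \<Longrightarrow> f \<in> borel_measurable M"
  by (simp add: L2_def)

lemma L2_integrable: "f \<in> L2 M \<Longrightarrow> integrable M (\<lambda>x. (norm (f x))\<^sup>2)"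
  by (simp add: L2_def)

lemma L2_zero [simp]: "(\<lambda>x. 0) \<in> L2 M"
  by (simp add: L2_def)

lemma L2_norm_nonneg [simp]: "0 \<le> L2_norm M f"
  by (simp add: L2_norm_def)

lemma L2_norm_zero [simp]: "L2_norm M (\<lambda>x. 0) = 0"
  by (simp add: L2_norm_def)

lemma L2_norm_power2: "(L2_norm M f)\<^sup>2 = (LINT x|M. (norm (f x))\<^sup>2)"
  by (simp add: L2_norm_def)

lemma L2_norm_cmult: "L2_norm M (\<lambda>x. c * f x) = norm c * L2_norm M f"
  by (simp add: L2_norm_def norm_mult power_mult_distrib real_sqrt_mult)

lemma L2_norm_cong:
  assumes "f \<in> L2 M" "g \<in> L2 M" "L2_eq M f g"
  shows "L2_norm M f = L2_norm M g"
proof -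
  have "(LINT x|M. (norm (f x))\<^sup>2) = (LINT x|M. (norm (g x))\<^sup>2)"
    by (rule integral_cong_AE) (use assms in \<open>auto simp: L2_eq_def L2_def\<close>)
  then show ?thesis by (simp add: L2_norm_def)
qed

lemma L2_norm_eq_0:
  assumes "f \<in> L2 M" "L2_norm M f = 0"
  shows "AE x in M. f x = 0"
  using assms integral_nonneg_eq_0_iff_AE[OF L2_integrable[OF assms(1)]]
  by (simp add: L2_norm_def)

lemma L2_norm_mult_integral_le:
  assumes f: "f \<in> L2 M" and g: "g \<in> L2 M"
  shows "integrable M (\<lambda>x. norm (f x) * norm (g x))"
    and "(LINT x|M. norm (f x) * norm (g x)) \<le> L2_norm M f * L2_norm M g"
proof -
  note [measurable] = L2_measurable[OF f] L2_measurable[OF g]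
  show int: "integrable M (\<lambda>x. norm (f x) * norm (g x))"
    using integrable_norm[OF L2_mult_cnj_integrable[OF f g]] by (simp add: norm_mult)
  have "ennreal ((LINT x|M. norm (f x) * norm (g x))\<^sup>2)
      = (\<integral>\<^sup>+x. ennreal (norm (f x)) * ennreal (norm (g x)) \<partial>M)\<^sup>2"
    using nn_integral_eq_integral[OF int]
    by (simp add: ennreal_mult' ennreal_power Bochner_Integration.integral_nonneg)
  also have "\<dots> \<le> (\<integral>\<^sup>+x. (ennreal (norm (f x)))\<^sup>2 \<partial>M) * (\<integral>\<^sup>+x. (ennreal (norm (g x)))\<^sup>2 \<partial>M)"
    by (rule Cauchy_Schwarz_nn_integral) measurable
  also have "\<dots> = ennreal ((L2_norm M f)\<^sup>2) * ennreal ((L2_norm M g)\<^sup>2)"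
    using nn_integral_eq_integral[OF L2_integrable[OF f]] nn_integral_eq_integral[OF L2_integrable[OF g]]
    by (simp add: L2_norm_power2 ennreal_power)
  also have "\<dots> = ennreal ((L2_norm M f * L2_norm M g)\<^sup>2)"
    by (simp add: power_mult_distrib ennreal_mult')
  finally have "(LINT x|M. norm (f x) * norm (g x))\<^sup>2 \<le> (L2_norm M f * L2_norm M g)\<^sup>2"
    by (simp add: ennreal_le_iff)
  then show "(LINT x|M. norm (f x) * norm (g x)) \<le> L2_norm M f * L2_norm M g"
    by (rule power2_le_imp_le) simp
qed

lemma norm_L2_inner_le:
  assumes "f \<in> L2 M" "g \<in> L2 M"
  shows "norm (L2_inner M f g) \<le> L2_norm M f * L2_norm M g"
proof -
  have "norm (L2_inner M f g) \<le> (LINT x|M. norm (f x * cnj (g x)))"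
    unfolding L2_inner_def by (rule integral_norm_bound)
  also have "\<dots> \<le> L2_norm M f * L2_norm M g"
    using L2_norm_mult_integral_le(2)[OF assms] by (simp add: norm_mult)
  finally show ?thesis .
qed

lemma L2_norm_add_le:
  assumes f: "f \<in> L2 M" and g: "g \<in> L2 M"
  shows "L2_norm M (\<lambda>x. f x + g x) \<le> L2_norm M f + L2_norm M g"
proof -
  note int = L2_norm_mult_integral_le[OF f g]
  have "(LINT x|M. (norm (f x + g x))\<^sup>2)
      \<le> (LINT x|M. (norm (f x))\<^sup>2 + (2 * (norm (f x) * norm (g x)) + (norm (g x))\<^sup>2))"
  proof (rule integral_mono)
    show "integrable M (\<lambda>x. (norm (f x + g x))\<^sup>2)" by (rule L2_integrable[OF L2_add[OF f g]])
    show "integrable M (\<lambda>x. (norm (f x))\<^sup>2 + (2 * (norm (f x) * norm (g x)) + (norm (g x))\<^sup>2))"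
      using int L2_integrable[OF f] L2_integrable[OF g] by auto
    show "(norm (f x + g x))\<^sup>2 \<le> (norm (f x))\<^sup>2 + (2 * (norm (f x) * norm (g x)) + (norm (g x))\<^sup>2)" for x
    proof -
      have "(norm (f x + g x))\<^sup>2 \<le> (norm (f x) + norm (g x))\<^sup>2"
        by (intro power_mono norm_triangle_ineq) simp
      then show ?thesis by (simp add: power2_sum)
    qed
  qed
  also have "\<dots> = (L2_norm M f)\<^sup>2 + (2 * (LINT x|M. norm (f x) * norm (g x)) + (L2_norm M g)\<^sup>2)"
    using int L2_integrable[OF f] L2_integrable[OF g] by (simp add: L2_norm_power2)
  also have "\<dots> \<le> (L2_norm M f + L2_norm M g)\<^sup>2"
    using int(2) by (simp add: power2_sum)
  finally have "(L2_norm M (\<lambda>x. f x + g x))\<^sup>2 \<le> (L2_norm M f + L2_norm M g)\<^sup>2"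
    by (simp add: L2_norm_power2)
  then show ?thesis by (rule power2_le_imp_le) simp
qed

lemma L2_norm_diff_le:
  assumes "f \<in> L2 M" "g \<in> L2 M"
  shows "L2_norm M (\<lambda>x. f x - g x) \<le> L2_norm M f + L2_norm M g"
  using L2_norm_add_le[OF assms(1) L2_cmult[OF assms(2), of "- 1"]] L2_norm_cmult[of M "- 1" g]
      by simp

lemma L2_norm_triangle_diff:
  assumes "f \<in> L2 M" "g \<in> L2 M" "h \<in> L2 M"
  shows "L2_norm M (\<lambda>x. f x - h x) \<le> L2_norm M (\<lambda>x. f x - g x) + L2_norm M (\<lambda>x. g x - h x)"
  using L2_norm_add_le[OF L2_diff[OF assms(1,2)] L2_diff[OF assms(2,3)]] by simp

lemma L2_inner_self: "L2_inner M f f = complex_of_real ((L2_norm M f)\<^sup>2)"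
proof -
  have "L2_inner M f f = (LINT x|M. complex_of_real ((norm (f x))\<^sup>2))"
    unfolding L2_inner_def by (rule Bochner_Integration.integral_cong) (simp_all only: complex_norm_square)
  then show ?thesis by (simp only: integral_complex_of_real L2_norm_power2)
qed

lemma L2_inner_diff_left:
  assumes "f \<in> L2 M" "g \<in> L2 M" "h \<in> L2 M"
  shows "L2_inner M (\<lambda>x. f x - g x) h = L2_inner M f h - L2_inner M g h"
  unfolding L2_inner_def
  using L2_mult_cnj_integrable[OF assms(1,3)] L2_mult_cnj_integrable[OF assms(2,3)]
  by (simp add: left_diff_distrib)

lemma L2_inner_cmult_left: "L2_inner M (\<lambda>x. c * f x) g = c * L2_inner M f g"
  unfolding L2_inner_def by (simp add: mult.assoc)

lemma L2_norm_diff_power2: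
  assumes f: "f \<in> L2 M" and g: "g \<in> L2 M"
  shows "(L2_norm M (\<lambda>x. f x - g x))\<^sup>2
    = (L2_norm M f)\<^sup>2 - 2 * Re (L2_inner M f g) + (L2_norm M g)\<^sup>2"
proof -
  have "(L2_norm M (\<lambda>x. f x - g x))\<^sup>2
      = (LINT x|M. (norm (f x))\<^sup>2 - 2 * Re (f x * cnj (g x)) + (norm (g x))\<^sup>2)"
    unfolding L2_norm_power2
    by (rule Bochner_Integration.integral_cong)
      (unfold cmod_power2, simp_all add: power2_eq_square algebra_simps)
  also have "\<dots> = (L2_norm M f)\<^sup>2 - 2 * Re (L2_inner M f g) + (L2_norm M g)\<^sup>2"
  proof -
    have "(LINT x|M. (norm (f x))\<^sup>2 - 2 * Re (p x) + (norm (g x))\<^sup>2)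
        = (L2_norm M f)\<^sup>2 - 2 * Re (integral\<^sup>L M p) + (L2_norm M g)\<^sup>2" if "integrable M p" for p
      using L2_integrable[OF f] L2_integrable[OF g] that
      unfolding L2_norm_power2 by simp
    from this[OF L2_mult_cnj_integrable[OF f g]] show ?thesis by (simp only: L2_inner_def)
  qed
  finally show ?thesis .
qed

lemma L2_sum: "(\<And>i. i \<in> I \<Longrightarrow> g i \<in> L2 M) \<Longrightarrow> (\<lambda>x. \<Sum>i\<in>I. g i x) \<in> L2 M"
  by (induction I rule: infinite_finite_induct) (auto intro: L2_add)

lemma L2_norm_sum_le:
  "(\<And>i. i \<in> I \<Longrightarrow> g i \<in> L2 M) \<Longrightarrow> L2_norm M (\<lambda>x. \<Sum>i\<in>I. g i x) \<le> (\<Sum>i\<in>I. L2_norm M (g i))"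
proof (induction I rule: infinite_finite_induct)
  case (insert i I)
  have "L2_norm M (\<lambda>x. g i x + (\<Sum>i\<in>I. g i x)) \<le> L2_norm M (g i) + L2_norm M (\<lambda>x. \<Sum>i\<in>I. g i x)"
    by (rule L2_norm_add_le) (use insert in \<open>auto intro: L2_sum\<close>)
  then show ?case using insert by auto
qed auto

text \<open>This takes the role of completeness of L^2, with the pointwise sum as a concrete
  representative. Divided by q^n, the squares still have summable integrals, and 2 |g| \<le> q^n +
  |g|^2 / q^n turns this into absolute pointwise convergence. Fatou's lemma along the partial sums
  gives the norm bound.\<close>

lemma L2_geometric_series:
  fixes g :: "nat \<Rightarrow> 'a \<Rightarrow> complex"
  assumes g: "\<And>n. g n \<in> L2 M" and le: "\<And>n. L2_norm M (g n) \<le> K * q ^ n" and q: "0 < q" "q < 1"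
  shows "AE x in M. summable (\<lambda>n. norm (g n x))"
    and "(\<lambda>x. \<Sum>n. g n x) \<in> L2 M"
    and "L2_norm M (\<lambda>x. \<Sum>n. g n x) \<le> K / (1 - q)"
proof -
  note [measurable] = L2_measurable[OF g]
  have K: "0 \<le> K" using order_trans[OF L2_norm_nonneg le[of 0]] by simp
  have "AE x in M. summable (\<lambda>n. (norm (g n x))\<^sup>2 / q ^ n)"
  proof (rule AE_summable_if_summable_integral)
    show "integrable M (\<lambda>x. (norm (g n x))\<^sup>2 / q ^ n)" for n using L2_integrable[OF g] by simp
    show "0 \<le> (norm (g n x))\<^sup>2 / q ^ n" for n x using q by simp
    show "summable (\<lambda>n. LINT x|M. (norm (g n x))\<^sup>2 / q ^ n)"
    proof (rule summable_comparison_test')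
      show "summable (\<lambda>n. K\<^sup>2 * q ^ n)" using q by (intro summable_mult summable_geometric) simp
      fix n
      have "(L2_norm M (g n))\<^sup>2 \<le> (K * q ^ n)\<^sup>2" by (intro power_mono le) simp
      then have "(L2_norm M (g n))\<^sup>2 / q ^ n \<le> K\<^sup>2 * q ^ n"
        using q by (simp add: divide_le_eq power2_eq_square algebra_simps)
      then show "norm (LINT x|M. (norm (g n x))\<^sup>2 / q ^ n) \<le> K\<^sup>2 * q ^ n"
        using q by (simp add: L2_norm_power2[symmetric])
    qed
  qed
  then show sm: "AE x in M. summable (\<lambda>n. norm (g n x))"
  proof eventually_elim
    case (elim x)
    have "summable (\<lambda>n. q ^ n + (norm (g n x))\<^sup>2 / q ^ n)"
      using elim q by (intro summable_add summable_geometric) auto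
    then show ?case
    proof (rule summable_comparison_test')
      fix n
      have "2 * norm (g n x) * q ^ n \<le> q ^ n * q ^ n + (norm (g n x))\<^sup>2"
        using sum_squares_bound[of "norm (g n x)" "q ^ n"] by (simp add: power2_eq_square)
      also have "\<dots> = (q ^ n + (norm (g n x))\<^sup>2 / q ^ n) * q ^ n"
        using q by (simp add: distrib_right)
      finally have "2 * norm (g n x) * q ^ n \<le> (q ^ n + (norm (g n x))\<^sup>2 / q ^ n) * q ^ n" .
      then have "2 * norm (g n x) \<le> q ^ n + (norm (g n x))\<^sup>2 / q ^ n"
        by (rule mult_right_le_imp_le) (use q in simp)
      then show "norm (norm (g n x)) \<le> q ^ n + (norm (g n x))\<^sup>2 / q ^ n"
        using order_trans[of "norm (g n x)" "2 * norm (g n x)"] by simp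
    qed
  qed
  define s where "s n x = (\<Sum>i<n. g i x)" for n x
  have s: "s n \<in> L2 M" for n unfolding s_def using g by (intro L2_sum) auto
  note [measurable] = L2_measurable[OF s]
  have sle: "L2_norm M (s n) \<le> K / (1 - q)" for n
  proof -
    have "L2_norm M (s n) \<le> (\<Sum>i<n. L2_norm M (g i))" unfolding s_def using g
        by (intro L2_norm_sum_le) auto
    also have "\<dots> \<le> (\<Sum>i<n. K * q ^ i)" by (intro sum_mono le)
    also have "\<dots> = K * (\<Sum>i<n. q ^ i)" by (simp add: sum_distrib_left)
    also have "\<dots> \<le> K * (1 / (1 - q))"
      using q K by (intro mult_left_mono) (auto simp: sum_gp_strict divide_right_mono)
    finally show ?thesis by simp
  qed
  have [measurable]: "(\<lambda>x. \<Sum>n. g n x) \<in> borel_measurable M" by measurable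
  have "(\<integral>\<^sup>+x. ennreal ((norm (\<Sum>n. g n x))\<^sup>2) \<partial>M) = (\<integral>\<^sup>+x. liminf (\<lambda>n. ennreal ((norm (s n x))\<^sup>2)) \<partial>M)"
  proof (rule nn_integral_cong_AE)
    show "AE x in M. ennreal ((norm (\<Sum>n. g n x))\<^sup>2) = liminf (\<lambda>n. ennreal ((norm (s n x))\<^sup>2))"
      using sm
    proof eventually_elim
      case (elim x)
      have "(\<lambda>n. s n x) \<longlonglongrightarrow> (\<Sum>n. g n x)"
        unfolding s_def by (rule summable_LIMSEQ[OF summable_norm_cancel[OF elim]])
      then have "(\<lambda>n. ennreal ((norm (s n x))\<^sup>2)) \<longlonglongrightarrow> ennreal ((norm (\<Sum>n. g n x))\<^sup>2)"
        by (intro tendsto_intros)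
      then show ?case by (intro lim_imp_Liminf[symmetric]) auto
    qed
  qed
  also have "\<dots> \<le> liminf (\<lambda>n. \<integral>\<^sup>+x. ennreal ((norm (s n x))\<^sup>2) \<partial>M)"
    by (rule nn_integral_liminf) measurable
  also have "\<dots> \<le> liminf (\<lambda>n. ennreal ((K / (1 - q))\<^sup>2))"
  proof (rule Liminf_mono, rule always_eventually, rule allI)
    fix n
    have "(\<integral>\<^sup>+x. ennreal ((norm (s n x))\<^sup>2) \<partial>M) = ennreal ((L2_norm M (s n))\<^sup>2)"
      using nn_integral_eq_integral[OF L2_integrable[OF s]] by (simp add: L2_norm_power2)
    also have "\<dots> \<le> ennreal ((K / (1 - q))\<^sup>2)" by (intro ennreal_leI power_mono sle) simp
    finally show "(\<integral>\<^sup>+x. ennreal ((norm (s n x))\<^sup>2) \<partial>M) \<le> ennreal ((K / (1 - q))\<^sup>2)" .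
  qed
  also have "\<dots> = ennreal ((K / (1 - q))\<^sup>2)" by (simp add: Liminf_const)
  finally have bd: "(\<integral>\<^sup>+x. ennreal ((norm (\<Sum>n. g n x))\<^sup>2) \<partial>M) \<le> ennreal ((K / (1 - q))\<^sup>2)" .
  have int: "integrable M (\<lambda>x. (norm (\<Sum>n. g n x))\<^sup>2)"
    by (rule integrableI_nonneg) (use bd in \<open>auto intro: le_less_trans\<close>)
  then show "(\<lambda>x. \<Sum>n. g n x) \<in> L2 M" by (simp add: L2_def)
  have "(L2_norm M (\<lambda>x. \<Sum>n. g n x))\<^sup>2 \<le> (K / (1 - q))\<^sup>2"
    using bd nn_integral_eq_integral[OF int] by (simp add: L2_norm_power2)
  then show "L2_norm M (\<lambda>x. \<Sum>n. g n x) \<le> K / (1 - q)"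
    by (rule power2_le_imp_le) (use K q in simp)
qed

section \<open>Neumann series\<close>

lemma L2_bounded_op_mem: "L2_bounded_op M T \<Longrightarrow> f \<in> L2 M \<Longrightarrow> T f \<in> L2 M"
  by (simp add: L2_bounded_op_def)

lemma L2_bounded_op_cong:
  "L2_bounded_op M T \<Longrightarrow> f \<in> L2 M \<Longrightarrow> g \<in> L2 M \<Longrightarrow> AE x in M. f x = g x \<Longrightarrow> AE x in M. T f x = T g x"
  by (simp add: L2_bounded_op_def L2_eq_def)

lemma L2_bounded_op_add:
  "L2_bounded_op M T \<Longrightarrow> f \<in> L2 M \<Longrightarrow> g \<in> L2 M \<Longrightarrow> AE x in M. T (\<lambda>x. f x + g x) x = T f x + T g x"
  by (simp add: L2_bounded_op_def L2_eq_def)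

lemma L2_bounded_op_cmult:
  "L2_bounded_op M T \<Longrightarrow> f \<in> L2 M \<Longrightarrow> AE x in M. T (\<lambda>x. c * f x) x = c * T f x"
  by (simp add: L2_bounded_op_def L2_eq_def)

lemma L2_bounded_op_diff:
  assumes T: "L2_bounded_op M T" and f: "f \<in> L2 M" and g: "g \<in> L2 M"
  shows "AE x in M. T (\<lambda>x. f x - g x) x = T f x - T g x"
  using L2_bounded_op_add[OF T f L2_cmult[OF g, of "- 1"]] L2_bounded_op_cmult[OF T g, of "- 1"]
  by eventually_elim simp

lemma L2_bounded_op_sum:
  assumes T: "L2_bounded_op M T" and "\<And>i. g i \<in> L2 M"
  shows "AE x in M. T (\<lambda>x. \<Sum>i<n. g i x) x = (\<Sum>i<(n::nat). T (g i) x)"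
proof (induction n)
  case 0
  show ?case using L2_bounded_op_cmult[OF T L2_zero, of 0] by simp
next
  case (Suc n)
  have "AE x in M. T (\<lambda>x. (\<Sum>i<n. g i x) + g n x) x = T (\<lambda>x. \<Sum>i<n. g i x) x + T (g n) x"
    using assms by (intro L2_bounded_op_add L2_sum) auto
  with Suc show ?case by eventually_elim simp
qed

lemma L2_bounded_op_bound:
  assumes "L2_bounded_op M T"
  obtains C where "0 < C" "\<And>f. f \<in> L2 M \<Longrightarrow> L2_norm M (T f) \<le> C * L2_norm M f"
proof -
  obtain C where C: "\<And>f. f \<in> L2 M \<Longrightarrow> L2_norm M (T f) \<le> C * L2_norm M f"
    using assms unfolding L2_bounded_op_def by blast
  show ?thesis
  proof (rule that)
    show "0 < \<bar>C\<bar> + 1" by linarith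
    show "L2_norm M (T f) \<le> (\<bar>C\<bar> + 1) * L2_norm M f" if "f \<in> L2 M" for f
      by (rule order_trans[OF C[OF that] mult_right_mono]) auto
  qed
qed

lemma L2_bounded_op_id: "L2_bounded_op M (\<lambda>f. f)"
  unfolding L2_bounded_op_def L2_eq_def by (auto intro!: exI[of _ 1])

lemma L2_bounded_op_comp:
  assumes S: "L2_bounded_op M S" and T: "L2_bounded_op M T"
  shows "L2_bounded_op M (\<lambda>f. S (T f))"
  unfolding L2_bounded_op_def L2_eq_def
proof (intro conjI ballI allI impI)
  note mem = L2_bounded_op_mem[OF S] L2_bounded_op_mem[OF T]
  show "S (T f) \<in> L2 M" if "f \<in> L2 M" for f using mem that by blast
  show "AE x in M. S (T f) x = S (T g) x" if "f \<in> L2 M" "g \<in> L2 M" "AE x in M. f x = g x" for f g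
    using that mem by (intro L2_bounded_op_cong[OF S] L2_bounded_op_cong[OF T]) auto
  show "AE x in M. S (T (\<lambda>x. f x + g x)) x = S (T f) x + S (T g) x" if f: "f \<in> L2 M"
      and g: "g \<in> L2 M" for f g
  proof -
    have "AE x in M. S (T (\<lambda>x. f x + g x)) x = S (\<lambda>x. T f x + T g x) x"
      using f g mem by (intro L2_bounded_op_cong[OF S] L2_bounded_op_add[OF T]) (auto intro: L2_add)
    moreover have "AE x in M. S (\<lambda>x. T f x + T g x) x = S (T f) x + S (T g) x"
      using f g mem by (intro L2_bounded_op_add[OF S]) auto
    ultimately show ?thesis by eventually_elim simp
  qed
  show "AE x in M. S (T (\<lambda>x. c * f x)) x = c * S (T f) x" if f: "f \<in> L2 M" for f c
  proof -
    have "AE x in M. S (T (\<lambda>x. c * f x)) x = S (\<lambda>x. c * T f x) x"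
      using f mem by (intro L2_bounded_op_cong[OF S] L2_bounded_op_cmult[OF T]) (auto intro: L2_cmult)
    moreover have "AE x in M. S (\<lambda>x. c * T f x) x = c * S (T f) x"
      using f mem by (intro L2_bounded_op_cmult[OF S]) auto
    ultimately show ?thesis by eventually_elim simp
  qed
  obtain C where C: "0 < C" "\<And>f. f \<in> L2 M \<Longrightarrow> L2_norm M (S f) \<le> C * L2_norm M f"
    using L2_bounded_op_bound[OF S] by blast
  obtain D where D: "0 < D" "\<And>f. f \<in> L2 M \<Longrightarrow> L2_norm M (T f) \<le> D * L2_norm M f"
    using L2_bounded_op_bound[OF T] by blast
  have "L2_norm M (S (T f)) \<le> (C * D) * L2_norm M f" if "f \<in> L2 M" for f
  proof -
    have "L2_norm M (S (T f)) \<le> C * L2_norm M (T f)" using C(2) mem that by blast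
    also have "\<dots> \<le> C * (D * L2_norm M f)" using D(2)[OF that] C(1) by (intro mult_left_mono) auto
    finally show ?thesis by (simp add: mult.assoc)
  qed
  then show "\<exists>C. \<forall>f\<in>L2 M. L2_norm M (S (T f)) \<le> C * L2_norm M f" by blast
qed

lemma L2_bounded_op_funpow: "L2_bounded_op M T \<Longrightarrow> L2_bounded_op M (T ^^ n)"
proof (induction n)
  case 0
  then show ?case using L2_bounded_op_id by (simp add: id_def)
next
  case (Suc n)
  then show ?case using L2_bounded_op_comp[of M T "T ^^ n"] by (simp add: comp_def)
qed

lemma L2_bounded_op_scale:
  assumes T: "L2_bounded_op M T"
  shows "L2_bounded_op M (\<lambda>f x. c * T f x)"
  unfolding L2_bounded_op_def L2_eq_def
proof (intro conjI ballI allI impI)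
  show "(\<lambda>x. c * T f x) \<in> L2 M" if "f \<in> L2 M" for f using L2_bounded_op_mem[OF T that]
      by (rule L2_cmult)
  show "AE x in M. c * T f x = c * T g x" if "f \<in> L2 M" "g \<in> L2 M" "AE x in M. f x = g x" for f g
    using L2_bounded_op_cong[OF T that] by eventually_elim simp
  show "AE x in M. c * T (\<lambda>x. f x + g x) x = c * T f x + c * T g x" if "f \<in> L2 M" "g \<in> L2 M" for f g
    using L2_bounded_op_add[OF T that] by eventually_elim (simp add: algebra_simps)
  show "AE x in M. c * T (\<lambda>x. d * f x) x = d * (c * T f x)" if "f \<in> L2 M" for f d
    using L2_bounded_op_cmult[OF T that, of d] by eventually_elim simp
  obtain D where D: "0 < D" "\<And>f. f \<in> L2 M \<Longrightarrow> L2_norm M (T f) \<le> D * L2_norm M f"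
    using L2_bounded_op_bound[OF T] by blast
  have "L2_norm M (\<lambda>x. c * T f x) \<le> (norm c * D) * L2_norm M f" if "f \<in> L2 M" for f
    unfolding L2_norm_cmult using D(2)[OF that] by (simp add: mult.assoc mult_left_mono)
  then show "\<exists>C. \<forall>f\<in>L2 M. L2_norm M (\<lambda>x. c * T f x) \<le> C * L2_norm M f" by blast
qed

context
  fixes M :: "'a measure" and B :: "('a \<Rightarrow> complex) \<Rightarrow> 'a \<Rightarrow> complex" and q :: real
  assumes B: "L2_bounded_op M B" and q: "0 < q" "q < 1"
    and contraction: "\<forall>f\<in>L2 M. L2_norm M (B f) \<le> q * L2_norm M f"
begin

text \<open>The sum is pointwise, so the result is again a map on representatives. For
  \<open>f\<close> in \<open>L2 M\<close> the series converges off a null set.\<close>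

definition neumann_series :: "('a \<Rightarrow> complex) \<Rightarrow> 'a \<Rightarrow> complex" where
  "neumann_series f x = (\<Sum>n. (B ^^ n) f x)"

lemmas contraction_funpow = L2_bounded_op_funpow[OF B]

lemma L2_norm_funpow_le: "f \<in> L2 M \<Longrightarrow> L2_norm M ((B ^^ n) f) \<le> L2_norm M f * q ^ n"
proof (induction n)
  case (Suc n)
  have "L2_norm M (B ((B ^^ n) f)) \<le> q * L2_norm M ((B ^^ n) f)"
    by (rule contraction[rule_format, OF L2_bounded_op_mem[OF contraction_funpow Suc.prems]])
  also have "\<dots> \<le> q * (L2_norm M f * q ^ n)" using Suc q by (intro mult_left_mono) auto
  finally show ?case by (simp add: algebra_simps)
qed simp

lemma neumann_summable: "f \<in> L2 M \<Longrightarrow> AE x in M. summable (\<lambda>n. (B ^^ n) f x)"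
  using L2_geometric_series(1)[where g = "\<lambda>n. (B ^^ n) f",
      OF L2_bounded_op_mem[OF contraction_funpow] L2_norm_funpow_le q]
  by (auto elim!: eventually_mono intro: summable_norm_cancel)

lemma neumann_series_mem: "f \<in> L2 M \<Longrightarrow> neumann_series f \<in> L2 M"
  using L2_geometric_series(2)[where g = "\<lambda>n. (B ^^ n) f",
      OF L2_bounded_op_mem[OF contraction_funpow] L2_norm_funpow_le q]
  by (simp add: neumann_series_def[abs_def])

lemma L2_bounded_op_neumann_series: "L2_bounded_op M neumann_series"
  unfolding L2_bounded_op_def L2_eq_def
proof (intro conjI ballI allI impI)
  show "neumann_series f \<in> L2 M" if "f \<in> L2 M" for f using that by (rule neumann_series_mem)
  show "AE x in M. neumann_series f x = neumann_series g x"
    if "f \<in> L2 M" "g \<in> L2 M" "AE x in M. f x = g x" for f g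
  proof -
    have "AE x in M. \<forall>n. (B ^^ n) f x = (B ^^ n) g x"
      unfolding AE_all_countable using L2_bounded_op_cong[OF contraction_funpow that] by blast
    then show ?thesis by eventually_elim (simp add: neumann_series_def)
  qed
  show "AE x in M. neumann_series (\<lambda>x. f x + g x) x = neumann_series f x + neumann_series g x"
    if "f \<in> L2 M" "g \<in> L2 M" for f g
  proof -
    have "AE x in M. \<forall>n. (B ^^ n) (\<lambda>x. f x + g x) x = (B ^^ n) f x + (B ^^ n) g x"
      unfolding AE_all_countable using L2_bounded_op_add[OF contraction_funpow that] by blast
    with neumann_summable[OF that(1)] neumann_summable[OF that(2)]
    show ?thesis by eventually_elim (simp add: neumann_series_def suminf_add)
  qed
  show "AE x in M. neumann_series (\<lambda>x. c * f x) x = c * neumann_series f x" if "f \<in> L2 M" for f c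
  proof -
    have "AE x in M. \<forall>n. (B ^^ n) (\<lambda>x. c * f x) x = c * (B ^^ n) f x"
      unfolding AE_all_countable using L2_bounded_op_cmult[OF contraction_funpow that] by blast
    with neumann_summable[OF that]
    show ?thesis by eventually_elim (simp add: neumann_series_def suminf_mult)
  qed
  show "\<exists>C. \<forall>f\<in>L2 M. L2_norm M (neumann_series f) \<le> C * L2_norm M f"
    using L2_geometric_series(3)[where g = "\<lambda>n. (B ^^ n) _",
      OF L2_bounded_op_mem[OF contraction_funpow] L2_norm_funpow_le q]
    by (intro exI[of _ "1 / (1 - q)"]) (auto simp: neumann_series_def[abs_def])
qed

lemma neumann_series_left_inverse:
  assumes f: "f \<in> L2 M"
  shows "AE x in M. neumann_series f x - neumann_series (B f) x = f x"
  using neumann_summable[OF f]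
proof eventually_elim
  case (elim x)
  have "(B ^^ n) (B f) x = (B ^^ Suc n) f x" for n by (simp add: funpow_swap1)
  then have "neumann_series (B f) x = (\<Sum>n. (B ^^ Suc n) f x)" by (simp add: neumann_series_def)
  also have "\<dots> = neumann_series f x - f x"
    using suminf_split_head[OF elim] by (simp add: neumann_series_def)
  finally show ?case by simp
qed

text \<open>An index shift gives only the left inverse of 1 - B. For the right inverse, B has to
  pass through the infinite sum, which an operator determined up to null sets does not do pointwise.
  It is applied to finite partial sums instead; the tails are Neumann series of B^n f and have norm
  of order q^n.\<close>

lemma neumann_series_commute:
  assumes f: "f \<in> L2 M"
  shows "AE x in M. B (neumann_series f) x = neumann_series (B f) x"
proof -
  define s where "s n x = (\<Sum>i<n. (B ^^ i) f x)" for n x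
  have pm: "(B ^^ n) f \<in> L2 M" for n by (rule L2_bounded_op_mem[OF contraction_funpow f])
  have s: "s n \<in> L2 M" for n unfolding s_def[abs_def] using pm by (intro L2_sum) auto
  note N = neumann_series_mem[OF f] and Bf = L2_bounded_op_mem[OF B f]
  note NB = neumann_series_mem[OF Bf]
  note BN = L2_bounded_op_mem[OF B N]
  define d where "d x = B (neumann_series f) x - neumann_series (B f) x" for x
  have d: "d \<in> L2 M" unfolding d_def[abs_def] by (rule L2_diff[OF BN NB])
  have tail: "L2_norm M (\<lambda>x. neumann_series f x - s n x) \<le> (L2_norm M f * q ^ n) / (1 - q)" for n
  proof -
    have "L2_norm M (\<lambda>x. neumann_series f x - s n x) = L2_norm M (neumann_series ((B ^^ n) f))"
    proof (rule L2_norm_cong[OF L2_diff[OF N s] neumann_series_mem[OF pm]])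
      show "L2_eq M (\<lambda>x. neumann_series f x - s n x) (neumann_series ((B ^^ n) f))"
        unfolding L2_eq_def using neumann_summable[OF f]
      proof eventually_elim
        case (elim x)
        have "neumann_series ((B ^^ n) f) x = (\<Sum>k. (B ^^ (k + n)) f x)"
          by (simp add: neumann_series_def funpow_add)
        also have "\<dots> = neumann_series f x - s n x"
          using suminf_minus_initial_segment[OF elim, of n] by (simp add: neumann_series_def s_def)
        finally show ?case by simp
      qed
    qed
    also have "\<dots> \<le> (L2_norm M f * q ^ n) / (1 - q)"
    proof -
      have "L2_norm M ((B ^^ k) ((B ^^ n) f)) \<le> (L2_norm M f * q ^ n) * q ^ k" for k
        using L2_norm_funpow_le[OF pm, of k n] L2_norm_funpow_le[OF f, of n] q
        by (meson mult_right_mono order_trans zero_le_power less_imp_le)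
      then show ?thesis
        using L2_geometric_series(3)[OF L2_bounded_op_mem[OF contraction_funpow pm], where K
            = "L2_norm M f * q ^ n"] q
        by (simp add: neumann_series_def[abs_def])
    qed
    finally show ?thesis .
  qed
  have "L2_norm M d \<le> 2 * (L2_norm M f / (1 - q)) * q ^ n" for n
  proof -
    \<comment> \<open>On the partial sum, B raises the index and loses the term f; the left inverse
      identity loses the same f, so only two tails remain.\<close>
    have "AE x in M. d x = B (\<lambda>x. neumann_series f x - s n x) x - (neumann_series f x - s (Suc n) x)"
    proof -
      have "AE x in M. B (s n) x = (\<Sum>i<n. B ((B ^^ i) f) x)"
        unfolding s_def[abs_def] using pm by (intro L2_bounded_op_sum[OF B]) auto
      moreover have "(\<Sum>i<n. B ((B ^^ i) f) x) = s (Suc n) x - f x" for x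
        by (simp add: s_def sum.lessThan_Suc_shift del: sum.lessThan_Suc)
      ultimately have "AE x in M. B (s n) x = s (Suc n) x - f x" by simp
      with L2_bounded_op_diff[OF B N s[of n]] neumann_series_left_inverse[OF f]
      show ?thesis by eventually_elim (simp add: d_def algebra_simps)
    qed
    then have "L2_norm M d = L2_norm M (\<lambda>x. B (\<lambda>x. neumann_series f x - s n x) x - (neumann_series f x - s (Suc n) x))"
      using d by (intro L2_norm_cong) (auto simp: L2_eq_def intro!: L2_diff L2_bounded_op_mem[OF B] N s)
    also have "\<dots> \<le> L2_norm M (B (\<lambda>x. neumann_series f x - s n x)) + L2_norm M (\<lambda>x. neumann_series f x
        - s (Suc n) x)"
      by (intro L2_norm_diff_le) (auto intro!: L2_diff L2_bounded_op_mem[OF B] N s)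
    also have "\<dots> \<le> 1 * ((L2_norm M f * q ^ n) / (1 - q)) + (L2_norm M f * q ^ Suc n) / (1 - q)"
    proof (rule add_mono[OF _ tail])
      have "L2_norm M (B (\<lambda>x. neumann_series f x - s n x)) \<le> q * L2_norm M (\<lambda>x. neumann_series f x
          - s n x)"
        by (rule contraction[rule_format]) (intro L2_diff N s)
      also have "\<dots> \<le> 1 * ((L2_norm M f * q ^ n) / (1 - q))"
        using q tail by (intro mult_mono) auto
      finally show "L2_norm M (B (\<lambda>x. neumann_series f x - s n x)) \<le> 1 * ((L2_norm M f * q ^ n) / (1
          - q))" .
    qed
    also have "\<dots> = (L2_norm M f / (1 - q)) * (q ^ n + q * q ^ n)"
      by (simp add: distrib_left mult.left_commute)
    also have "\<dots> \<le> (L2_norm M f / (1 - q)) * (2 * q ^ n)"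
      using q by (intro mult_left_mono) auto
    finally show ?thesis by (simp add: algebra_simps)
  qed
  moreover have "(\<lambda>n. 2 * (L2_norm M f / (1 - q)) * q ^ n) \<longlonglongrightarrow> 2 * (L2_norm M f / (1 - q)) * 0"
    using q by (intro tendsto_intros LIMSEQ_power_zero) auto
  ultimately have "L2_norm M d \<le> 0"
    by (intro LIMSEQ_le_const[where a = "L2_norm M d"]) auto
  then have "AE x in M. d x = 0"
    using d by (intro L2_norm_eq_0) (auto intro: antisym)
  then show ?thesis by (simp add: d_def)
qed

end

text \<open>The resolvent is -1/c times the Neumann series of T/c. Read contrapositively, a spectral
  value pushes every norm bound of T up to its modulus, which is how the spectral conditions are
  exploited.\<close>

lemma not_in_L2_spectrum:
  assumes T: "L2_bounded_op M T"
    and C: "\<And>f. f \<in> L2 M \<Longrightarrow> L2_norm M (T f) \<le> C * L2_norm M f" "0 \<le> C" "C < norm c"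
  shows "c \<notin> L2_spectrum M T"
proof -
  \<comment> \<open>The midpoint of C / |c| and 1: below 1, and positive even for C = 0, as the
    geometric estimates divide by powers of q.\<close>
  define q where "q = (C + norm c) / (2 * norm c)"
  have q: "0 < q" "q < 1" "C \<le> q * norm c" and c: "c \<noteq> 0"
  proof -
    have "0 < norm c" using C by linarith
    then show "0 < q" "q < 1" "C \<le> q * norm c" "c \<noteq> 0"
      using C(2,3) by (auto simp: q_def divide_less_eq)
  qed
  define B where "B f x = inverse c * T f x" for f x
  have B: "L2_bounded_op M B" unfolding B_def[abs_def] by (rule L2_bounded_op_scale[OF T])
  have contr: "\<forall>f\<in>L2 M. L2_norm M (B f) \<le> q * L2_norm M f"
  proof
    fix f assume f: "f \<in> L2 M"
    have "L2_norm M (B f) = L2_norm M (T f) / norm c"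
      unfolding B_def[abs_def] L2_norm_cmult by (simp add: norm_inverse divide_inverse)
    also have "\<dots> \<le> (C * L2_norm M f) / norm c" using C(1)[OF f] by (intro divide_right_mono) auto
    also have "\<dots> \<le> (q * norm c * L2_norm M f) / norm c"
      using q by (intro divide_right_mono mult_right_mono) auto
    finally show "L2_norm M (B f) \<le> q * L2_norm M f" using c by simp
  qed
  let ?N = "neumann_series B"
  have N: "L2_bounded_op M ?N" using L2_bounded_op_neumann_series[OF B q(1,2) contr] .
  define S where "S f x = - inverse c * ?N f x" for f x
  have S: "L2_bounded_op M S" unfolding S_def[abs_def] by (rule L2_bounded_op_scale[OF N])
  have TB: "T f x = c * B f x" for f x using c by (simp add: B_def)
  have "L2_eq M (S (\<lambda>x. T f x - c * f x)) f \<and> L2_eq M (\<lambda>x. T (S f) x - c * S f x) f" if f: "f \<in> L2 M"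
      for f
  proof
    note Bf = L2_bounded_op_mem[OF B f] and Nf = L2_bounded_op_mem[OF N f]
    show "L2_eq M (S (\<lambda>x. T f x - c * f x)) f"
      unfolding L2_eq_def
      using L2_bounded_op_diff[OF N L2_cmult[OF Bf, of c] L2_cmult[OF f, of c]]
        L2_bounded_op_cmult[OF N Bf, of c] L2_bounded_op_cmult[OF N f, of c]
        neumann_series_left_inverse[OF B q(1,2) contr f]
    proof eventually_elim
      case (elim x)
      have "S (\<lambda>x. T f x - c * f x) x = - inverse c * (c * ?N (B f) x - c * ?N f x)"
        unfolding S_def TB using elim(1-3) by simp
      also have "\<dots> = ?N f x - ?N (B f) x" using c by (simp add: field_simps)
      finally show ?case using elim(4) by simp
    qed
    show "L2_eq M (\<lambda>x. T (S f) x - c * S f x) f"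
      unfolding L2_eq_def
      using L2_bounded_op_cmult[OF B Nf, of "- inverse c"] neumann_series_left_inverse[OF B q(1,2) contr f]
        neumann_series_commute[OF B q(1,2) contr f]
    proof eventually_elim
      case (elim x)
      have "T (S f) x - c * S f x = c * (- inverse c * B (?N f) x) - c * (- inverse c * ?N f x)"
        unfolding TB S_def[abs_def] using elim(1) by simp
      also have "\<dots> = ?N f x - B (?N f) x" using c by (simp add: field_simps)
      finally show ?case using elim(2,3) by simp
    qed
  qed
  with S show ?thesis unfolding L2_spectrum_def by blast
qed

section \<open>Haar measure and translations\<close>

lemma borel_measurable_group_uminus [measurable (raw)]:
  fixes g :: "'b \<Rightarrow> 'a::{topological_group_add, t2_space}"
  assumes "g \<in> borel_measurable M"
  shows "(\<lambda>x. - g x) \<in> borel_measurable M"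
  by (rule borel_measurable_continuous_on[OF _ assms]) (intro continuous_intros)

locale modular_haar_measure =
  fixes \<mu> :: "'a::{topological_group_add, t2_space, second_countable_topology} measure"
    and \<delta> :: "'a \<Rightarrow> real"
  assumes locally_compact: "locally_compact_space (euclidean :: 'a topology)"
    and haar: "left_haar_measure \<mu>"
    and modular: "modular_element \<mu> \<delta>"
begin

lemma sets_haar [simp, measurable_cong]: "sets \<mu> = sets borel"
  using haar by (simp add: left_haar_measure_def radon_measure_def)

lemma space_haar [simp]: "space \<mu> = UNIV"
  using sets_eq_imp_space_eq[OF sets_haar] by simp

lemma borel_measurable_haar [simp]: "borel_measurable \<mu> = borel_measurable borel"
  by (rule measurable_cong_sets) auto

lemma emeasure_compact_finite: "compact K \<Longrightarrow> emeasure \<mu> K < \<infinity>"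
  using haar by (simp add: left_haar_measure_def radon_measure_def)

lemma emeasure_compact [simp]: "compact K \<Longrightarrow> emeasure \<mu> K \<noteq> top"
  using emeasure_compact_finite[of K] by simp

lemma emeasure_outer_regular:
  "A \<in> sets borel \<Longrightarrow> emeasure \<mu> A = (INF U\<in>{U. open U \<and> A \<subseteq> U}. emeasure \<mu> U)"
  using haar unfolding left_haar_measure_def radon_measure_def by blast

lemma emeasure_inner_regular:
  "open U \<Longrightarrow> emeasure \<mu> U = (SUP K\<in>{K. compact K \<and> K \<subseteq> U}. emeasure \<mu> K)"
  using haar unfolding left_haar_measure_def radon_measure_def by blast

lemma emeasure_left_translate: "A \<in> sets borel \<Longrightarrow> emeasure \<mu> ((\<lambda>x. \<zeta> + x) ` A) = emeasure \<mu> A"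
  using haar unfolding left_haar_measure_def by blast

lemma compact_borel [measurable]: "compact K \<Longrightarrow> K \<in> sets (borel :: 'a measure)"
  by (simp add: compact_imp_closed)

text \<open>Second countability gives the Lindeloef property, so countably many of the open sets
  with compact supersets already cover the group.\<close>

lemma exhausting_compacts:
  obtains K :: "nat \<Rightarrow> 'a set" where "\<And>n. compact (K n)" "(\<Union>n. K n) = UNIV"
proof -
  define F where "F = {U :: 'a set. open U \<and> (\<exists>K. compact K \<and> U \<subseteq> K)}"
  have "\<Union>F = UNIV"
  proof (intro UNIV_eq_I[symmetric])
    fix x :: 'a
    have "\<exists>U K. open U \<and> compact K \<and> x \<in> U \<and> U \<subseteq> K"
      using locally_compact[unfolded locally_compact_space_def, THEN bspec, of x] by simp
    then show "x \<in> \<Union>F" by (auto simp: F_def)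
  qed
  obtain F' where F': "F' \<subseteq> F" "countable F'" "\<Union>F' = \<Union>F"
    using Lindelof[of F] by (auto simp: F_def)
  have "F' \<noteq> {}" using F'(3) \<open>\<Union>F = UNIV\<close> by auto
  then have r: "range (from_nat_into F') = F'" using F'(2) by simp
  have "\<exists>K. compact K \<and> from_nat_into F' n \<subseteq> K" for n
    using from_nat_into[OF \<open>F' \<noteq> {}\<close>, of n] F'(1) by (auto simp: F_def)
  then obtain K where K: "\<And>n. compact (K n)" "\<And>n. from_nat_into F' n \<subseteq> K n" by metis
  have "(\<Union>n. K n) = UNIV"
  proof (intro UNIV_eq_I[symmetric])
    fix x :: 'a
    have "x \<in> \<Union>F'" using F'(3) \<open>\<Union>F = UNIV\<close> by auto
    then have "x \<in> (\<Union>n. from_nat_into F' n)" using r by auto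
    then show "x \<in> (\<Union>n. K n)" using K(2) by blast
  qed
  with K(1) show ?thesis by (rule that)
qed

sublocale sigma_finite_measure \<mu>
proof
  obtain K :: "nat \<Rightarrow> 'a set" where K: "\<And>n. compact (K n)" "(\<Union>n. K n) = UNIV"
    using exhausting_compacts by blast
  show "\<exists>A. countable A \<and> A \<subseteq> sets \<mu> \<and> \<Union> A = space \<mu> \<and> (\<forall>a\<in>A. emeasure \<mu> a \<noteq> \<infinity>)"
    using K by (intro exI[of _ "range K"]) (auto intro: compact_borel)
qed

sublocale pair: pair_sigma_finite \<mu> \<mu> ..

section \<open>Translation, inversion and the modular element\<close>

lemma distr_left_translation: "distr \<mu> \<mu> (\<lambda>x. \<zeta> + x) = \<mu>"
proof (rule measure_eqI)
  fix A assume "A \<in> sets (distr \<mu> \<mu> (\<lambda>x. \<zeta> + x))"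
  then have A: "A \<in> sets borel" by simp
  have "(\<lambda>x. \<zeta> + x) -` A = (\<lambda>x. - \<zeta> + x) ` A"
    by (auto simp: image_iff) (metis add.assoc add.left_inverse add_0 )
  then have "emeasure (distr \<mu> \<mu> (\<lambda>x. \<zeta> + x)) A = emeasure \<mu> ((\<lambda>x. - \<zeta> + x) ` A)"
    using A by (subst emeasure_distr) auto
  also have "\<dots> = emeasure \<mu> A" using A by (rule emeasure_left_translate)
  finally show "emeasure (distr \<mu> \<mu> (\<lambda>x. \<zeta> + x)) A = emeasure \<mu> A" .
qed simp

lemma nn_integral_left_translation:
  assumes [measurable]: "h \<in> borel_measurable borel"
  shows "(\<integral>\<^sup>+x. h (\<zeta> + x) \<partial>\<mu>) = (\<integral>\<^sup>+x. h x \<partial>\<mu>)"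
  using nn_integral_distr[of "\<lambda>x. \<zeta> + x" \<mu> \<mu> h] by (simp add: distr_left_translation)

lemma integral_left_translation:
  fixes h :: "'a \<Rightarrow> 'b::{banach, second_countable_topology}"
  assumes [measurable]: "h \<in> borel_measurable borel"
  shows "(LINT x|\<mu>. h (\<zeta> + x)) = (LINT x|\<mu>. h x)"
  using integral_distr[of "\<lambda>x. \<zeta> + x" \<mu> \<mu> h] by (simp add: distr_left_translation)

lemma integrable_left_translation:
  fixes h :: "'a \<Rightarrow> 'b::{banach, second_countable_topology}"
  assumes "integrable \<mu> h"
  shows "integrable \<mu> (\<lambda>x. h (\<zeta> + x))"
  using integrable_distr[of "\<lambda>x. \<zeta> + x" \<mu> \<mu> h] assms by (simp add: distr_left_translation)

lemma AE_left_translation: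
  assumes "AE x in \<mu>. P x"
  shows "AE x in \<mu>. P (\<zeta> + x)"
  using AE_distrD[of "\<lambda>x. \<zeta> + x" \<mu> \<mu> P] assms unfolding distr_left_translation by simp

lemma modular_pos [simp]: "0 < \<delta> x"
  using modular by (simp add: modular_element_def)

lemma modular_add: "\<delta> (x + y) = \<delta> x * \<delta> y"
  using modular by (simp add: modular_element_def)

lemma continuous_on_modular: "continuous_on UNIV \<delta>"
  using modular by (simp add: modular_element_def)

lemma modular_measurable [measurable]: "\<delta> \<in> borel_measurable borel"
  by (rule borel_measurable_continuous_onI[OF continuous_on_modular])

lemma modular_zero [simp]: "\<delta> 0 = 1"
  using modular_add[of 0 0] modular_pos[of 0] by simp

lemma nn_integral_inversion:
  assumes [measurable]: "h \<in> borel_measurable borel"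
  shows "(\<integral>\<^sup>+x. ennreal (\<delta> x) * h (- x) \<partial>\<mu>) = (\<integral>\<^sup>+x. h x \<partial>\<mu>)"
proof -
  have "(\<integral>\<^sup>+x. h x \<partial>\<mu>) = (\<integral>\<^sup>+x. h (- x) \<partial>distr \<mu> borel uminus)"
    by (subst nn_integral_distr) auto
  also have "\<dots> = (\<integral>\<^sup>+x. h (- x) \<partial>density \<mu> (\<lambda>x. ennreal (\<delta> x)))"
    using modular by (simp add: modular_element_def right_haar_of_def)
  also have "\<dots> = (\<integral>\<^sup>+x. ennreal (\<delta> x) * h (- x) \<partial>\<mu>)"
    by (rule nn_integral_density) auto
  finally show ?thesis ..
qed

text \<open>Inversion exchanges right and left translations at the price of the density \<delta>.
  Applying it before and after one left translation leaves the factor \<open>\<delta> z\<close>, by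
  multiplicativity.\<close>

lemma nn_integral_right_translation:
  assumes [measurable]: "h \<in> borel_measurable borel"
  shows "(\<integral>\<^sup>+x. h (x + z) \<partial>\<mu>) = ennreal (\<delta> z) * (\<integral>\<^sup>+x. h x \<partial>\<mu>)"
proof -
  have "(\<integral>\<^sup>+x. h (x + z) \<partial>\<mu>) = (\<integral>\<^sup>+x. ennreal (\<delta> x) * h (- x + z) \<partial>\<mu>)"
    by (rule nn_integral_inversion[symmetric]) auto
  also have "\<dots> = (\<integral>\<^sup>+x. ennreal (\<delta> (z + x)) * h (- (z + x) + z) \<partial>\<mu>)"
    by (rule nn_integral_left_translation[symmetric]) auto
  also have "\<dots> = (\<integral>\<^sup>+x. ennreal (\<delta> z) * (ennreal (\<delta> x) * h (- x)) \<partial>\<mu>)"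
    by (rule nn_integral_cong)
      (simp add: modular_add minus_add add.assoc ennreal_mult' less_imp_le mult.assoc)
  also have "\<dots> = ennreal (\<delta> z) * (\<integral>\<^sup>+x. h x \<partial>\<mu>)"
    by (subst nn_integral_cmult) (auto simp: nn_integral_inversion)
  finally show ?thesis .
qed

lemma distr_right_translation: "distr \<mu> \<mu> (\<lambda>x. x + z) = density \<mu> (\<lambda>_. ennreal (\<delta> z))"
proof (rule measure_eqI)
  fix A assume "A \<in> sets (distr \<mu> \<mu> (\<lambda>x. x + z))"
  then have A [measurable]: "A \<in> sets borel" by simp
  have "emeasure (distr \<mu> \<mu> (\<lambda>x. x + z)) A = (\<integral>\<^sup>+x. indicator A x \<partial>distr \<mu> \<mu> (\<lambda>x. x + z))"
    using A by simp
  also have "\<dots> = (\<integral>\<^sup>+x. indicator A (x + z) \<partial>\<mu>)"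
    by (subst nn_integral_distr) auto
  also have "\<dots> = ennreal (\<delta> z) * (\<integral>\<^sup>+x. indicator A x \<partial>\<mu>)"
    by (rule nn_integral_right_translation) auto
  also have "\<dots> = emeasure (density \<mu> (\<lambda>_. ennreal (\<delta> z))) A"
    by (subst emeasure_density) (auto simp: nn_integral_cmult)
  finally show "emeasure (distr \<mu> \<mu> (\<lambda>x. x + z)) A = emeasure (density \<mu> (\<lambda>_. ennreal (\<delta> z))) A" .
qed simp

lemma integral_right_translation:
  fixes h :: "'a \<Rightarrow> real"
  assumes [measurable]: "h \<in> borel_measurable borel"
  shows "(LINT x|\<mu>. h (x + z)) = \<delta> z * (LINT x|\<mu>. h x)"
proof -
  have "(LINT x|\<mu>. h (x + z)) = (LINT x|distr \<mu> \<mu> (\<lambda>x. x + z). h x)"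
    by (subst integral_distr) auto
  also have "\<dots> = \<delta> z * (LINT x|\<mu>. h x)"
    unfolding distr_right_translation by (subst integral_density) (auto simp: less_imp_le)
  finally show ?thesis .
qed

text \<open>Countably many translates of a nonempty open set cover a second countable group; if the
  set were null, the whole measure would vanish.\<close>

lemma emeasure_open_pos:
  assumes U: "open U" "U \<noteq> {}"
  shows "emeasure \<mu> U \<noteq> 0"
proof
  assume 0: "emeasure \<mu> U = 0"
  have opn: "open ((\<lambda>x. \<zeta> + x) ` U)" for \<zeta>
  proof -
    have "(\<lambda>x. \<zeta> + x) ` U = (\<lambda>x. - \<zeta> + x) -` U"
      by (auto simp: image_iff) (metis add.assoc add.right_inverse add_0 add_minus_cancel)
    moreover have "open ((\<lambda>x. - \<zeta> + x) -` U)"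
      by (rule open_vimage[OF U(1)]) (intro continuous_intros)
    ultimately show ?thesis by simp
  qed
  obtain F where F: "F \<subseteq> range (\<lambda>\<zeta>. (\<lambda>x. \<zeta> + x) ` U)" "countable F"
    "\<Union>F = (\<Union>\<zeta>. (\<lambda>x. \<zeta> + x) ` U)"
    using Lindelof[of "range (\<lambda>\<zeta>. (\<lambda>x. \<zeta> + x) ` U)"] opn by auto
  obtain u where u: "u \<in> U" using U by auto
  have "x \<in> (\<lambda>y. (x - u) + y) ` U" for x using u by (auto simp: image_iff intro!: bexI[of _ u])
  then have "\<Union>F = UNIV" unfolding F(3) by blast
  moreover have "emeasure \<mu> (\<Union>F) = 0"
  proof -
    have "(\<Union>X\<in>F. X) \<in> null_sets \<mu>"
    proof (rule null_sets_UN'[OF F(2)])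
      fix X assume "X \<in> F"
      then obtain \<zeta> where X: "X = (\<lambda>x. \<zeta> + x) ` U" using F(1) by auto
      have "emeasure \<mu> X = emeasure \<mu> U"
        using U unfolding X by (intro emeasure_left_translate) simp
      then show "X \<in> null_sets \<mu>" using 0 opn unfolding X by (auto simp: null_sets_def)
    qed
    then show ?thesis by (simp add: null_sets_def)
  qed
  ultimately show False using haar by (simp add: left_haar_measure_def)
qed

section \<open>Regular approximation and continuity of translations in L^1\<close>

lemma compact_subset_positive_measure:
  assumes U: "open U" "U \<noteq> {}"
  obtains K where "compact K" "K \<subseteq> U" "measure \<mu> K > 0"
proof -
  note emeasure_inner_regular[OF U(1)]
  moreover have "emeasure \<mu> U > 0" using emeasure_open_pos[OF U] by (simp add: zero_less_iff_neq_zero)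
  ultimately obtain K where K: "compact K" "K \<subseteq> U" "emeasure \<mu> K > 0"
    by (auto simp: less_SUP_iff)
  moreover have "measure \<mu> K > 0"
    using K emeasure_compact_finite[OF K(1)] by (simp add: measure_def enn2real_positive_iff)
  ultimately show ?thesis using that by blast
qed

lemma outer_approximation:
  assumes K: "compact K" and "\<epsilon> > (0::real)"
  obtains U where "open U" "K \<subseteq> U" "emeasure \<mu> U \<noteq> top" "measure \<mu> (U - K) \<le> \<epsilon>"
proof -
  note emeasure_outer_regular[OF compact_borel[OF K]]
  moreover have "emeasure \<mu> K < emeasure \<mu> K + ennreal \<epsilon>"
    using emeasure_compact[OF K] \<open>\<epsilon> > 0\<close> by (cases "emeasure \<mu> K") (auto simp:
        ennreal_plus[symmetric] ennreal_less_iff simp del: ennreal_plus)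
  ultimately obtain U where U: "open U" "K \<subseteq> U" "emeasure \<mu> U < emeasure \<mu> K + ennreal \<epsilon>"
    by (metis (mono_tags, lifting) INF_less_iff mem_Collect_eq)
  have fin: "emeasure \<mu> U \<noteq> top"
    using less_le_trans[OF U(3) top_greatest] by simp
  have "emeasure \<mu> (U - K) = emeasure \<mu> U - emeasure \<mu> K"
    using U K by (intro emeasure_Diff) auto
  also have "\<dots> \<le> ennreal \<epsilon>"
    using U(3) fin by (simp add: ennreal_minus_le_iff add.commute less_imp_le)
  finally have "measure \<mu> (U - K) \<le> \<epsilon>"
    using \<open>\<epsilon> > 0\<close> by (simp add: measure_def enn2real_leI)
  with U(1,2) fin show ?thesis by (rule that)
qed

text \<open>The tube lemma around the slice {0} x K lets one neighbourhood serve all points of K at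
  once.\<close>

lemma left_translate_nhd:
  assumes "compact K" "open U" "K \<subseteq> U"
  obtains W where "open W" "(0::'a) \<in> W" "\<And>z x. z \<in> W \<Longrightarrow> x \<in> K \<Longrightarrow> z + x \<in> U"
proof -
  have o: "open ((\<lambda>p. fst p + snd p) -` U)" using assms by (intro open_vimage continuous_intros) auto
  have i: "{0} \<times> K \<subseteq> (\<lambda>p. fst p + snd p) -` U" using assms by auto
  obtain W where "0 \<in> W" "open W" "W \<times> K \<subseteq> (\<lambda>p. fst p + snd p) -` U"
    using Elementary_Topology.tube_lemma[OF assms(1) o i] by blast
  then show ?thesis by (intro that[of W]) auto
qed

lemma right_translate_nhd:
  assumes "compact K" "open U" "K \<subseteq> U"
  obtains W where "open W" "(0::'a) \<in> W" "\<And>z x. z \<in> W \<Longrightarrow> x \<in> K \<Longrightarrow> x + z \<in> U"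
proof -
  have o: "open ((\<lambda>p. snd p + fst p) -` U)" using assms by (intro open_vimage continuous_intros) auto
  have i: "{0} \<times> K \<subseteq> (\<lambda>p. snd p + fst p) -` U" using assms by auto
  obtain W where "0 \<in> W" "open W" "W \<times> K \<subseteq> (\<lambda>p. snd p + fst p) -` U"
    using Elementary_Topology.tube_lemma[OF assms(1) o i] by blast
  then show ?thesis by (intro that[of W]) auto
qed

text \<open>For equal integrals, \<open>\<bar>a - b\<bar> = 2 max (a - b) 0 - (a - b)\<close> reduces the distance to the excess
    outside \<open>B\<close>.\<close>

lemma integral_abs_diff_indicator_le:
  assumes [measurable]: "A \<in> sets borel" "B \<in> sets borel" "U \<in> sets borel"
    and sub: "A \<subseteq> U" "B \<subseteq> U" and fin: "emeasure \<mu> U \<noteq> top"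
    and c: "0 \<le> c" "c * measure \<mu> A = measure \<mu> B"
  shows "(LINT x|\<mu>. \<bar>c * indicator A x - indicator B x\<bar>)
    \<le> 2 * (c * measure \<mu> (U - B) + \<bar>c - 1\<bar> * measure \<mu> B)"
proof -
  have ind: "integrable \<mu> (indicator S :: 'a \<Rightarrow> real)" if "S \<subseteq> U" "S \<in> sets borel" for S
  proof -
    have "emeasure \<mu> S \<le> emeasure \<mu> U" using that by (intro emeasure_mono) auto
    then show ?thesis using that fin by (auto simp: less_top top_unique)
  qed
  have i: "integrable \<mu> (indicator A :: 'a \<Rightarrow> real)" "integrable \<mu> (indicator B :: 'a \<Rightarrow> real)"
    "integrable \<mu> (indicator (U - B) :: 'a \<Rightarrow> real)"
    using sub by (auto intro!: ind)
  have "(LINT x|\<mu>. \<bar>c * indicator A x - indicator B x\<bar>)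
      \<le> (LINT x|\<mu>. 2 * (c * indicator (U - B) x + \<bar>c - 1\<bar> * indicator B x) - (c * indicator A x
          - indicator B x))"
  proof (rule integral_mono)
    show "integrable \<mu> (\<lambda>x. \<bar>c * indicator A x - indicator B x\<bar>)" using i by auto
    show "integrable \<mu> (\<lambda>x. 2 * (c * indicator (U - B) x + \<bar>c - 1\<bar> * indicator B x) - (c * indicator A x - indicator B x))"
      using i by auto
    show "\<bar>c * indicator A x - indicator B x\<bar>
        \<le> 2 * (c * indicator (U - B) x + \<bar>c - 1\<bar> * indicator B x) - (c * indicator A x - indicator B x)" for x
      using sub c(1) by (auto simp: indicator_def)
  qed
  also have "\<dots> = 2 * (c * measure \<mu> (U - B) + \<bar>c - 1\<bar> * measure \<mu> B)"
    using i c(2) by simp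
  finally show ?thesis .
qed

text \<open>For z in W the translate of K lies in U and has the measure of K, so the distance is at
  most twice its excess over K, which is contained in U - K.\<close>

lemma indicator_left_translate_continuous:
  assumes K: "compact K" and "\<epsilon> > (0::real)"
  obtains W where "open W" "(0::'a) \<in> W"
    "\<And>z. z \<in> W \<Longrightarrow> (LINT x|\<mu>. \<bar>indicator K (- z + x) - indicator K x :: real\<bar>) \<le> \<epsilon>"
proof -
  have half: "0 < \<epsilon> / 2" using \<open>\<epsilon> > 0\<close> by simp
  obtain U where U: "open U" "K \<subseteq> U" "emeasure \<mu> U \<noteq> top" "measure \<mu> (U - K) \<le> \<epsilon> / 2"
    using outer_approximation[OF K half] by blast
  obtain W where W: "open W" "(0::'a) \<in> W" "\<And>z x. z \<in> W \<Longrightarrow> x \<in> K \<Longrightarrow> z + x \<in> U"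
    using left_translate_nhd[OF K U(1,2)] by blast
  show ?thesis
  proof (rule that[OF W(1,2)])
    fix z assume z: "z \<in> W"
    let ?A = "(\<lambda>x. z + x) ` K"
    have "compact ?A" using K by (intro compact_continuous_image continuous_intros)
    have eq: "indicator K (- z + x) = (indicator ?A x :: real)" for x
      by (auto simp: indicator_def image_iff add.assoc[symmetric] intro!: bexI[of _ "- z + x"])
    have "measure \<mu> ?A = measure \<mu> K"
      using emeasure_left_translate[OF compact_borel[OF K]] by (simp add: measure_def)
    then have "(LINT x|\<mu>. \<bar>1 * indicator ?A x - indicator K x\<bar>) \<le> 2 * (1 * measure \<mu> (U - K)
        + \<bar>1 - 1\<bar> * measure \<mu> K)"
      using W(3)[OF z] U K \<open>compact ?A\<close> by (intro integral_abs_diff_indicator_le) auto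
    then show "(LINT x|\<mu>. \<bar>indicator K (- z + x) - indicator K x :: real\<bar>) \<le> \<epsilon>"
      using U(4) by (simp add: eq)
  qed
qed

text \<open>The factor \<open>\<delta> z\<close> gives the right translate of the indicator the
  integral of the original. This normalised form arises when a smoothing is evaluated at a left
  translate of its argument.\<close>

lemma indicator_right_translate_continuous:
  assumes K: "compact K" and "\<epsilon> > (0::real)"
  obtains W where "open W" "(0::'a) \<in> W"
    "\<And>z. z \<in> W \<Longrightarrow> (LINT x|\<mu>. \<bar>\<delta> z * indicator K (x + - z) - indicator K x\<bar>) \<le> \<epsilon>"
proof -
  have half: "0 < \<epsilon> / 8" using \<open>\<epsilon> > 0\<close> by simp
  obtain U where U: "open U" "K \<subseteq> U" "emeasure \<mu> U \<noteq> top" "measure \<mu> (U - K) \<le> \<epsilon> / 8"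
    using outer_approximation[OF K half] by blast
  obtain W where W: "open W" "(0::'a) \<in> W" "\<And>z x. z \<in> W \<Longrightarrow> x \<in> K \<Longrightarrow> x + z \<in> U"
    using right_translate_nhd[OF K U(1,2)] by blast
  \<comment> \<open>The bound 1 keeps \<open>\<delta> z\<close> at most 2, so the excess of measure
    \<epsilon> / 8 contributes at most \<epsilon> / 2; the second bound limits the other term to
    \<epsilon> / 2, and the added 1 covers a null set K.\<close>
  define \<eta> where "\<eta> = min 1 (\<epsilon> / (4 * (measure \<mu> K + 1)))"
  have \<eta>: "\<eta> > 0" using \<open>\<epsilon> > 0\<close> by (auto simp: \<eta>_def add_nonneg_pos)
  define W' where "W' = W \<inter> \<delta> -` {1 - \<eta> <..< 1 + \<eta>}"
  show ?thesis
  proof (rule that[of W'])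
    show "open W'" unfolding W'_def
      using W(1) continuous_on_modular by (intro open_Int open_vimage) auto
    show "0 \<in> W'" using W(2) \<eta> by (simp add: W'_def)
    fix z assume z: "z \<in> W'"
    then have zW: "z \<in> W" and dz: "\<bar>\<delta> z - 1\<bar> \<le> \<eta>" by (auto simp: W'_def)
    let ?A = "(\<lambda>x. x + z) ` K"
    have cA: "compact ?A" using K by (intro compact_continuous_image continuous_intros)
    have eq: "indicator K (x - z) = (indicator ?A x :: real)" for x
      by (auto simp: indicator_def image_iff intro!: bexI[of _ "x - z"])
    have [measurable]: "K \<in> sets borel" using K by (rule compact_borel)
    have "measure \<mu> K = (LINT x|\<mu>. indicator K (x + z + - z))"
      by (simp add: add.assoc)
    also have "\<dots> = \<delta> z * (LINT x|\<mu>. indicator K (x + - z))"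
      by (rule integral_right_translation) measurable
    finally have "\<delta> z * measure \<mu> ?A = measure \<mu> K"
      using cA by (simp add: eq)
    then have "(LINT x|\<mu>. \<bar>\<delta> z * indicator ?A x - indicator K x\<bar>) \<le> 2 * (\<delta> z * measure \<mu> (U - K)
        + \<bar>\<delta> z - 1\<bar> * measure \<mu> K)"
      using W(3)[OF zW] U K cA by (intro integral_abs_diff_indicator_le) (auto simp: less_imp_le)
    also have "\<dots> \<le> 2 * (2 * (\<epsilon> / 8) + \<eta> * measure \<mu> K)"
      using U(4) dz by (intro mult_left_mono add_mono mult_mono) (auto simp: \<eta>_def)
    also have "\<eta> * measure \<mu> K \<le> (\<epsilon> / (4 * (measure \<mu> K + 1))) * (measure \<mu> K + 1)"
      using \<open>\<epsilon> > 0\<close> by (intro mult_mono) (auto simp: \<eta>_def)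
    also have "\<dots> = \<epsilon> / 4" by (simp add: field_simps add_nonneg_eq_0_iff)
    finally show "(LINT x|\<mu>. \<bar>\<delta> z * indicator K (x + - z) - indicator K x\<bar>) \<le> \<epsilon>"
      by (simp add: eq)
  qed
qed

end

section \<open>Convolution\<close>

text \<open>The bound holds at every point and not just almost everywhere, so that translates and
  integrals over translates are bounded pointwise.\<close>

definition bounded_borel :: "('a::topological_space \<Rightarrow> real) \<Rightarrow> bool" where
  "bounded_borel \<phi> \<longleftrightarrow> \<phi> \<in> borel_measurable borel \<and> (\<exists>C. \<forall>x. \<bar>\<phi> x\<bar> \<le> C)"

lemma bounded_borelI: "\<phi> \<in> borel_measurable borel \<Longrightarrow> (\<And>x. \<bar>\<phi> x\<bar> \<le> C) \<Longrightarrow> bounded_borel \<phi>"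
  by (auto simp: bounded_borel_def)

lemma bounded_borel_const [simp]: "bounded_borel (\<lambda>x. c)"
  by (auto simp: bounded_borel_def)

lemma bounded_borel_add:
  assumes "bounded_borel \<phi>" "bounded_borel \<psi>"
  shows "bounded_borel (\<lambda>x. \<phi> x + \<psi> x)"
proof -
  obtain C D where "\<And>x. \<bar>\<phi> x\<bar> \<le> C" "\<And>x. \<bar>\<psi> x\<bar> \<le> D" using assms by (auto simp: bounded_borel_def)
  then have "\<bar>\<phi> x + \<psi> x\<bar> \<le> C + D" for x
    using abs_triangle_ineq[of "\<phi> x" "\<psi> x"] by (meson add_mono order_trans)
  then show ?thesis using assms by (auto simp: bounded_borel_def)
qed

lemma bounded_borel_cmult:
  assumes "bounded_borel \<phi>"
  shows "bounded_borel (\<lambda>x. c * \<phi> x)"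
proof -
  obtain C where "\<And>x. \<bar>\<phi> x\<bar> \<le> C" using assms by (auto simp: bounded_borel_def)
  then have "\<bar>c * \<phi> x\<bar> \<le> \<bar>c\<bar> * C" for x by (simp add: abs_mult mult_left_mono)
  then show ?thesis using assms by (auto simp: bounded_borel_def)
qed

lemma bounded_borel_diff:
  assumes "bounded_borel \<phi>" "bounded_borel \<psi>"
  shows "bounded_borel (\<lambda>x. \<phi> x - \<psi> x)"
  using bounded_borel_add[OF assms(1) bounded_borel_cmult[OF assms(2), of "- 1"]] by simp

lemma bounded_borel_sum:
  "(\<And>i. i \<in> I \<Longrightarrow> bounded_borel (\<phi> i)) \<Longrightarrow> bounded_borel (\<lambda>x. \<Sum>i\<in>I. \<phi> i x)"
  by (induction I rule: infinite_finite_induct) (auto intro: bounded_borel_add)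

lemma bounded_borel_translate:
  fixes \<phi> :: "'a::{topological_group_add, t2_space, second_countable_topology} \<Rightarrow> real"
  assumes "bounded_borel \<phi>"
  shows "bounded_borel (\<lambda>x. \<phi> (\<zeta> + x))"
  using assms by (auto simp: bounded_borel_def)

text \<open>An n-tuple of integrable functions is encoded as one function on a sigma-finite product,
  so that the separation lemma for a single measure applies to tuples.\<close>

lemma finite_sum_measure_integral:
  fixes f :: "nat \<times> 'a \<Rightarrow> real"
  assumes "sigma_finite_measure M" and int: "\<And>i. i < n \<Longrightarrow> integrable M (\<lambda>x. f (i, x))"
  shows "integrable (count_space {..<n} \<Otimes>\<^sub>M M) f"
    and "(LINT p|(count_space {..<n} \<Otimes>\<^sub>M M). f p) = (\<Sum>i<n. LINT x|M. f (i, x))"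
proof -
  interpret M: sigma_finite_measure M by fact
  interpret C: sigma_finite_measure "count_space {..<n}"
    by (rule sigma_finite_measure_count_space_finite) simp
  interpret pair_sigma_finite "count_space {..<n}" M ..
  have [measurable]: "f \<in> borel_measurable (count_space {..<n} \<Otimes>\<^sub>M M)"
    by (rule measurable_pair_measure_countable1) (use int in auto)
  show i: "integrable (count_space {..<n} \<Otimes>\<^sub>M M) f"
    by (rule Fubini_integrable) (use int in \<open>auto intro!: integrable_count_space simp: AE_count_space\<close>)
  show "(LINT p|(count_space {..<n} \<Otimes>\<^sub>M M). f p) = (\<Sum>i<n. LINT x|M. f (i, x))"
    by (subst integral_fst'[OF i, symmetric]) (simp add: lebesgue_integral_count_space_finite)
qed

context modular_haar_measure
begin

definition convolution :: "('a \<Rightarrow> real) \<Rightarrow> ('a \<Rightarrow> real) \<Rightarrow> 'a \<Rightarrow> real" where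
  "convolution a v x = (LINT \<eta>|\<mu>. a \<eta> * v (- \<eta> + x))"

text \<open>The transpose of \<open>convolution a\<close> under the pairing of integrable with
  bounded functions.\<close>

definition smoothing :: "('a \<Rightarrow> real) \<Rightarrow> ('a \<Rightarrow> real) \<Rightarrow> 'a \<Rightarrow> real" where
  "smoothing a \<Phi> y = (LINT \<eta>|\<mu>. a \<eta> * \<Phi> (\<eta> + y))"

lemma integrable_convolution_kernel:
  fixes a v :: "'a \<Rightarrow> 'c::{real_normed_field, banach, second_countable_topology}"
  assumes a: "integrable \<mu> a" and v: "integrable \<mu> v"
  shows "integrable (\<mu> \<Otimes>\<^sub>M \<mu>) (\<lambda>(\<eta>, x). a \<eta> * v (- \<eta> + x))"
proof (rule pair.Fubini_integrable)
  have [measurable]: "a \<in> borel_measurable borel" "v \<in> borel_measurable borel" using a v by auto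
  show "(\<lambda>(\<eta>, x). a \<eta> * v (- \<eta> + x)) \<in> borel_measurable (\<mu> \<Otimes>\<^sub>M \<mu>)" by measurable
  have "(LINT y|\<mu>. norm (a x * v (- x + y))) = norm (a x) * (LINT y|\<mu>. norm (v y))" for x
    using integral_left_translation[of "\<lambda>y. norm (v y)" "- x"] by (simp add: norm_mult)
  then show "integrable \<mu> (\<lambda>x. LINT y|\<mu>. norm (case (x, y) of (\<eta>, x) \<Rightarrow> a \<eta> * v (- \<eta> + x)))"
    using a by simp
  show "AE x in \<mu>. integrable \<mu> (\<lambda>y. case (x, y) of (\<eta>, x) \<Rightarrow> a \<eta> * v (- \<eta> + x))"
    using integrable_left_translation[OF v] by simp
qed

lemma integrable_convolution:
  assumes "integrable \<mu> a" "integrable \<mu> v"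
  shows "integrable \<mu> (convolution a v)"
  using pair.integrable_snd[OF integrable_convolution_kernel[OF assms]]
  by (simp add: convolution_def[abs_def])

lemma AE_integrable_convolution:
  fixes a v :: "'a \<Rightarrow> real"
  assumes "integrable \<mu> a" "integrable \<mu> v"
  shows "AE x in \<mu>. integrable \<mu> (\<lambda>\<eta>. a \<eta> * v (- \<eta> + x))"
  using pair.AE_integrable_snd[OF integrable_convolution_kernel[OF assms]] by simp

lemma integral_convolution:
  assumes a: "integrable \<mu> a" and v: "integrable \<mu> v"
  shows "(LINT x|\<mu>. convolution a v x) = (LINT x|\<mu>. a x) * (LINT x|\<mu>. v x)"
proof -
  have vm: "v \<in> borel_measurable borel" using v by auto
  have "(LINT x|\<mu>. convolution a v x) = (LINT \<eta>|\<mu>. LINT x|\<mu>. a \<eta> * v (- \<eta> + x))"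
    unfolding convolution_def
    using pair.Fubini_integral[OF integrable_convolution_kernel[OF a v]] by simp
  also have "\<dots> = (LINT \<eta>|\<mu>. a \<eta> * (LINT x|\<mu>. v x))"
    using integral_left_translation[OF vm] by simp
  finally show ?thesis by simp
qed

lemma integral_abs_convolution_le:
  assumes a: "integrable \<mu> a" and v: "integrable \<mu> v"
  shows "(LINT x|\<mu>. \<bar>convolution a v x\<bar>) \<le> (LINT x|\<mu>. \<bar>a x\<bar>) * (LINT x|\<mu>. \<bar>v x\<bar>)"
proof -
  have "(LINT x|\<mu>. \<bar>convolution a v x\<bar>) \<le> (LINT x|\<mu>. convolution (\<lambda>x. \<bar>a x\<bar>) (\<lambda>x. \<bar>v x\<bar>) x)"
  proof (rule integral_mono)
    show "integrable \<mu> (\<lambda>x. \<bar>convolution a v x\<bar>)" using integrable_convolution[OF a v] by simp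
    show "integrable \<mu> (convolution (\<lambda>x. \<bar>a x\<bar>) (\<lambda>x. \<bar>v x\<bar>))"
      using a v by (intro integrable_convolution) auto
    show "\<bar>convolution a v x\<bar> \<le> convolution (\<lambda>x. \<bar>a x\<bar>) (\<lambda>x. \<bar>v x\<bar>) x" for x
      using integral_norm_bound[of \<mu> "\<lambda>\<eta>. a \<eta> * v (- \<eta> + x)"] by (simp add: convolution_def abs_mult)
  qed
  also have "\<dots> = (LINT x|\<mu>. \<bar>a x\<bar>) * (LINT x|\<mu>. \<bar>v x\<bar>)"
    using a v by (intro integral_convolution) auto
  finally show ?thesis .
qed

lemma convolution_left_translate:
  assumes "integrable \<mu> a" "integrable \<mu> v"
  shows "convolution (\<lambda>\<eta>. a (- \<zeta> + \<eta>)) v x = convolution a v (- \<zeta> + x)"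
proof -
  have [measurable]: "a \<in> borel_measurable borel" "v \<in> borel_measurable borel" using assms by auto
  have "convolution (\<lambda>\<eta>. a (- \<zeta> + \<eta>)) v x = (LINT \<eta>|\<mu>. a (- \<zeta> + (\<zeta> + \<eta>)) * v (- (\<zeta> + \<eta>) + x))"
    unfolding convolution_def by (rule integral_left_translation[symmetric]) measurable
  also have "\<dots> = convolution a v (- \<zeta> + x)"
    by (simp add: convolution_def minus_add add.assoc del: add_uminus_conv_diff)
  finally show ?thesis .
qed

lemma convolution_diff_left:
  assumes a: "integrable \<mu> a" and b: "integrable \<mu> b" and v: "integrable \<mu> v"
  shows "AE x in \<mu>. convolution (\<lambda>\<eta>. a \<eta> - b \<eta>) v x = convolution a v x - convolution b v x"
  using AE_integrable_convolution[OF a v] AE_integrable_convolution[OF b v]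
  by eventually_elim (simp add: convolution_def left_diff_distrib)

lemma convolution_affine_right:
  assumes a: "integrable \<mu> a" and v: "integrable \<mu> v" and w: "integrable \<mu> w"
  shows "AE x in \<mu>. convolution a (\<lambda>x. s * v x + t * w x) x
    = s * convolution a v x + t * convolution a w x"
  using AE_integrable_convolution[OF a v] AE_integrable_convolution[OF a w]
proof eventually_elim
  case (elim x)
  have "convolution a (\<lambda>x. s * v x + t * w x) x
      = (LINT \<eta>|\<mu>. s * (a \<eta> * v (- \<eta> + x)) + t * (a \<eta> * w (- \<eta> + x)))"
    unfolding convolution_def by (rule Bochner_Integration.integral_cong) (auto simp: algebra_simps)
  then show ?case using elim by (simp add: convolution_def)
qed

lemma integrable_smoothing_kernel:
  fixes a \<Phi> :: "'a \<Rightarrow> real"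
  assumes "integrable \<mu> a" "\<Phi> \<in> borel_measurable borel" "\<And>x. \<bar>\<Phi> x\<bar> \<le> C"
  shows "integrable \<mu> (\<lambda>\<eta>. a \<eta> * \<Phi> (\<eta> + y))"
  using integrable_bounded_mult[OF assms(1), of "\<lambda>\<eta>. \<Phi> (\<eta> + y)" C] assms(2,3)
      by (simp add: mult.commute)

lemma smoothing_measurable [measurable]:
  assumes [measurable]: "a \<in> borel_measurable borel" "\<Phi> \<in> borel_measurable borel"
  shows "smoothing a \<Phi> \<in> borel_measurable borel"
  unfolding smoothing_def[abs_def] by measurable

lemma abs_smoothing_le:
  assumes a: "integrable \<mu> a" and \<Phi>: "\<Phi> \<in> borel_measurable borel" "\<And>x. \<bar>\<Phi> x\<bar> \<le> C"
  shows "\<bar>smoothing a \<Phi> y\<bar> \<le> (LINT \<eta>|\<mu>. \<bar>a \<eta>\<bar>) * C"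
proof -
  have "\<bar>smoothing a \<Phi> y\<bar> \<le> (LINT \<eta>|\<mu>. \<bar>a \<eta> * \<Phi> (\<eta> + y)\<bar>)"
    unfolding smoothing_def using integral_norm_bound[of \<mu> "\<lambda>\<eta>. a \<eta> * \<Phi> (\<eta> + y)"] by simp
  also have "\<dots> \<le> (LINT \<eta>|\<mu>. \<bar>a \<eta>\<bar> * C)"
    using integrable_abs[OF integrable_smoothing_kernel[OF a \<Phi>, of y]] a \<Phi>(2)
    by (intro integral_mono) (auto simp: abs_mult intro: mult_left_mono)
  finally show ?thesis by simp
qed

lemma bounded_borel_smoothing:
  assumes "integrable \<mu> a" "\<Phi> \<in> borel_measurable borel" "\<And>x. \<bar>\<Phi> x\<bar> \<le> C"
  shows "bounded_borel (smoothing a \<Phi>)"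
  using smoothing_measurable[of a \<Phi>] abs_smoothing_le[OF assms] assms by (intro bounded_borelI) auto

lemma smoothing_diff:
  assumes a: "integrable \<mu> a" and b: "integrable \<mu> b"
    and \<Phi>: "\<Phi> \<in> borel_measurable borel" "\<And>x. \<bar>\<Phi> x\<bar> \<le> C"
  shows "smoothing (\<lambda>\<eta>. a \<eta> - b \<eta>) \<Phi> y = smoothing a \<Phi> y - smoothing b \<Phi> y"
  using integrable_smoothing_kernel[OF a \<Phi>] integrable_smoothing_kernel[OF b \<Phi>]
  by (simp add: smoothing_def left_diff_distrib)

lemma smoothing_add:
  assumes a: "integrable \<mu> a" and b: "integrable \<mu> b"
    and \<Phi>: "\<Phi> \<in> borel_measurable borel" "\<And>x. \<bar>\<Phi> x\<bar> \<le> C"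
  shows "smoothing (\<lambda>\<eta>. a \<eta> + b \<eta>) \<Phi> y = smoothing a \<Phi> y + smoothing b \<Phi> y"
  using integrable_smoothing_kernel[OF a \<Phi>] integrable_smoothing_kernel[OF b \<Phi>]
  by (simp add: smoothing_def distrib_right)

text \<open>Fubini on both sides of the substitution x = \<eta> y. This moves the test function from
  a convolution to a smoothing, to which a mean can be applied.\<close>

lemma integral_convolution_mult:
  assumes a: "integrable \<mu> a" and v: "integrable \<mu> v"
    and \<Phi>: "\<Phi> \<in> borel_measurable borel" "\<And>x. \<bar>\<Phi> x\<bar> \<le> C"
  shows "(LINT x|\<mu>. \<Phi> x * convolution a v x) = (LINT y|\<mu>. v y * smoothing a \<Phi> y)"
proof -
  have [measurable]: "a \<in> borel_measurable borel" "v \<in> borel_measurable borel" using a v by auto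
  note [measurable] = \<Phi>(1)
  have "integrable (\<mu> \<Otimes>\<^sub>M \<mu>) (\<lambda>p. \<Phi> (snd p) * (case p of (\<eta>, x) \<Rightarrow> a \<eta> * v (- \<eta> + x)))"
    using \<Phi> by (intro integrable_bounded_mult[OF integrable_convolution_kernel[OF a v]]) auto
  then have i1: "integrable (\<mu> \<Otimes>\<^sub>M \<mu>) (\<lambda>(\<eta>, x). \<Phi> x * (a \<eta> * v (- \<eta> + x)))"
    by (simp add: case_prod_beta')
  have "integrable (\<mu> \<Otimes>\<^sub>M \<mu>) (\<lambda>(\<eta>, y). a \<eta> * v y)"
  proof (rule pair.Fubini_integrable)
    show "(\<lambda>(\<eta>, y). a \<eta> * v y) \<in> borel_measurable (\<mu> \<Otimes>\<^sub>M \<mu>)" by measurable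
  qed (use a v in \<open>auto simp: abs_mult\<close>)
  then have "integrable (\<mu> \<Otimes>\<^sub>M \<mu>) (\<lambda>p. \<Phi> (fst p + snd p) * (case p of (\<eta>, y) \<Rightarrow> a \<eta> * v y))"
    using \<Phi> by (intro integrable_bounded_mult) auto
  then have i2: "integrable (\<mu> \<Otimes>\<^sub>M \<mu>) (\<lambda>(\<eta>, y). \<Phi> (\<eta> + y) * (a \<eta> * v y))"
    by (simp add: case_prod_beta')
  have "(LINT x|\<mu>. \<Phi> x * convolution a v x) = (LINT x|\<mu>. LINT \<eta>|\<mu>. \<Phi> x * (a \<eta> * v (- \<eta> + x)))"
    by (simp add: convolution_def)
  also have "\<dots> = (LINT \<eta>|\<mu>. LINT x|\<mu>. \<Phi> x * (a \<eta> * v (- \<eta> + x)))"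
    using pair.Fubini_integral[OF i1] .
  also have "\<dots> = (LINT \<eta>|\<mu>. LINT y|\<mu>. \<Phi> (\<eta> + y) * (a \<eta> * v (- \<eta> + (\<eta> + y))))"
    by (intro Bochner_Integration.integral_cong[OF refl] integral_left_translation[symmetric]) measurable
  also have "\<dots> = (LINT \<eta>|\<mu>. LINT y|\<mu>. \<Phi> (\<eta> + y) * (a \<eta> * v y))"
    by simp
  also have "\<dots> = (LINT y|\<mu>. LINT \<eta>|\<mu>. \<Phi> (\<eta> + y) * (a \<eta> * v y))"
    using pair.Fubini_integral[OF i2] by simp
  also have "\<dots> = (LINT y|\<mu>. v y * smoothing a \<Phi> y)"
    unfolding smoothing_def integral_mult_right_zero[symmetric]
    by (intro Bochner_Integration.integral_cong refl) (simp add: mult_ac)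
  finally show ?thesis .
qed

definition probability_density :: "('a \<Rightarrow> real) \<Rightarrow> bool" where
  "probability_density v \<longleftrightarrow> v \<in> borel_measurable borel \<and> (\<forall>x. 0 \<le> v x) \<and> integrable \<mu> v
      \<and> (LINT x|\<mu>. v x) = 1"

lemma probability_density_convolution:
  assumes "probability_density a" "probability_density v"
  shows "probability_density (convolution a v)"
  unfolding probability_density_def
proof (intro conjI allI)
  have i: "integrable \<mu> a" "integrable \<mu> v" using assms by (auto simp: probability_density_def)
  show "integrable \<mu> (convolution a v)" by (rule integrable_convolution[OF i])
  then show "convolution a v \<in> borel_measurable borel" by auto
  show "0 \<le> convolution a v x" for x
    using assms by (auto simp: convolution_def probability_density_def intro!: Bochner_Integration.integral_nonneg)
  show "(LINT x|\<mu>. convolution a v x) = 1"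
    using integral_convolution[OF i] assms by (simp add: probability_density_def)
qed

end

text \<open>The invariant state is kept only as a real functional on bounded Borel functions.
  Positivity tolerates null sets, so that lower bounds valid almost everywhere can be passed to the
  mean.\<close>

locale invariant_mean = modular_haar_measure \<mu> \<delta>
  for \<mu> :: "'a::{topological_group_add, t2_space, second_countable_topology} measure" and \<delta> +
  fixes mean :: "('a \<Rightarrow> real) \<Rightarrow> real"
  assumes mean_add: "bounded_borel \<phi> \<Longrightarrow> bounded_borel \<psi> \<Longrightarrow> mean (\<lambda>x. \<phi> x + \<psi> x) = mean \<phi> + mean \<psi>"
    and mean_cmult: "bounded_borel \<phi> \<Longrightarrow> mean (\<lambda>x. c * \<phi> x) = c * mean \<phi>"
    and mean_nonneg: "bounded_borel \<phi> \<Longrightarrow> AE x in \<mu>. 0 \<le> \<phi> x \<Longrightarrow> 0 \<le> mean \<phi>"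
    and mean_one: "mean (\<lambda>x. 1) = 1"
    and mean_translate: "bounded_borel \<phi> \<Longrightarrow> mean (\<lambda>x. \<phi> (\<zeta> + x)) = mean \<phi>"
begin

lemma mean_diff:
  assumes "bounded_borel \<phi>" "bounded_borel \<psi>"
  shows "mean (\<lambda>x. \<phi> x - \<psi> x) = mean \<phi> - mean \<psi>"
  using mean_add[OF assms(1) bounded_borel_cmult[OF assms(2), of "- 1"]] mean_cmult[OF assms(2), of
      "- 1"]
  by simp

lemma mean_const: "mean (\<lambda>x. c) = c"
  using mean_cmult[of "\<lambda>x. 1" c] mean_one by simp

lemma mean_mono:
  assumes "bounded_borel \<phi>" "bounded_borel \<psi>" "AE x in \<mu>. \<phi> x \<le> \<psi> x"
  shows "mean \<phi> \<le> mean \<psi>"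
  using mean_nonneg[OF bounded_borel_diff[OF assms(2,1)]] mean_diff[OF assms(2,1)] assms(3) by simp

lemma abs_mean_diff_le:
  assumes "bounded_borel \<phi>" "bounded_borel \<psi>" "\<And>x. \<bar>\<phi> x - \<psi> x\<bar> \<le> C"
  shows "\<bar>mean \<phi> - mean \<psi>\<bar> \<le> C"
proof -
  have "mean (\<lambda>x. \<phi> x - \<psi> x) \<le> mean (\<lambda>x. C)" "mean (\<lambda>x. - C) \<le> mean (\<lambda>x. \<phi> x - \<psi> x)"
    using assms(3) by (auto intro!: mean_mono bounded_borel_diff assms(1,2) AE_I2 simp: abs_le_iff)
      (metis minus_le_iff minus_diff_eq)
  then show ?thesis using mean_diff[OF assms(1,2)] by (simp add: mean_const)
qed

lemma mean_zero [simp]: "mean (\<lambda>x. 0) = 0"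
  by (rule mean_const)

lemma mean_sum:
  "(\<And>i. i \<in> I \<Longrightarrow> bounded_borel (\<phi> i)) \<Longrightarrow> mean (\<lambda>x. \<Sum>i\<in>I. \<phi> i x) = (\<Sum>i\<in>I. mean (\<phi> i))"
  by (induction I rule: infinite_finite_induct) (simp_all add: mean_add bounded_borel_sum)

text \<open>Continuity at the identity, in the supremum norm, of the orbit of F under left
  translation; this is what makes Riemann sums converge uniformly.\<close>

definition left_uniformly_continuous :: "('a \<Rightarrow> real) \<Rightarrow> bool" where
  "left_uniformly_continuous F \<longleftrightarrow>
     (\<forall>\<epsilon>>0. \<exists>W. open W \<and> 0 \<in> W \<and> (\<forall>z\<in>W. \<forall>y. \<bar>F (z + y) - F y\<bar> \<le> \<epsilon>))"

text \<open>A left translation of the argument can be absorbed into the kernel, which becomes a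
  normalised right translate of the indicator. Such translates are continuous in L^1, and the
  resulting bound does not depend on the argument.\<close>

lemma smoothing_indicator_uniformly_continuous:
  assumes V: "compact V" and \<Phi>: "\<Phi> \<in> borel_measurable borel" "\<And>x. \<bar>\<Phi> x\<bar> \<le> 1"
  shows "left_uniformly_continuous (smoothing (indicator V) \<Phi>)"
  unfolding left_uniformly_continuous_def
proof (intro allI impI)
  fix \<epsilon> :: real assume "\<epsilon> > 0"
  note [measurable] = \<Phi>(1) compact_borel[OF V]
  have iV: "integrable \<mu> (indicator V :: 'a \<Rightarrow> real)"
    using emeasure_compact_finite[OF V] V by simp
  obtain W where W: "open W" "(0::'a) \<in> W"
    "\<And>z. z \<in> W \<Longrightarrow> (LINT x|\<mu>. \<bar>\<delta> z * indicator V (x + - z) - indicator V x\<bar>) \<le> \<epsilon>"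
    using indicator_right_translate_continuous[OF V \<open>\<epsilon> > 0\<close>] by blast
  have "\<bar>smoothing (indicator V) \<Phi> (z + y) - smoothing (indicator V) \<Phi> y\<bar> \<le> \<epsilon>" if z: "z \<in> W" for z y
  proof -
    have "(\<lambda>x. x + z) ` V = (\<lambda>x. x + - z) -` V"
      by (auto simp: image_iff intro!: bexI[of _ "_ - z"])
    moreover have cV: "compact ((\<lambda>x. x + z) ` V)" using V
        by (intro compact_continuous_image continuous_intros)
    ultimately have "integrable \<mu> (\<lambda>x. indicator V (x + - z) :: real)"
      using emeasure_compact_finite[OF cV] compact_borel[OF cV]
      by (subst indicator_vimage[symmetric]) simp
    then have iVz: "integrable \<mu> (\<lambda>x. \<delta> z * indicator V (x + - z) :: real)" by simp
    have "smoothing (indicator V) \<Phi> (z + y) = (LINT \<xi>|\<mu>. indicator V (\<xi> + z + - z) * \<Phi> (\<xi> + z + y))"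
      by (simp add: smoothing_def add.assoc)
    also have "\<dots> = \<delta> z * (LINT \<xi>|\<mu>. indicator V (\<xi> + - z) * \<Phi> (\<xi> + y))"
      by (rule integral_right_translation) measurable
    also have "\<dots> = smoothing (\<lambda>\<xi>. \<delta> z * indicator V (\<xi> + - z)) \<Phi> y"
      by (simp add: smoothing_def mult.assoc)
    finally have "smoothing (indicator V) \<Phi> (z + y) - smoothing (indicator V) \<Phi> y
        = smoothing (\<lambda>\<xi>. \<delta> z * indicator V (\<xi> + - z) - indicator V \<xi>) \<Phi> y"
      using smoothing_diff[OF iVz iV \<Phi>] by simp
    also have "\<bar>\<dots>\<bar> \<le> (LINT \<xi>|\<mu>. \<bar>\<delta> z * indicator V (\<xi> + - z) - indicator V \<xi>\<bar>) * 1"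
      using iVz iV by (intro abs_smoothing_le \<Phi>) auto
    finally show ?thesis using W(3)[OF z] by simp
  qed
  with W(1,2) show "\<exists>W. open W \<and> 0 \<in> W \<and> (\<forall>z\<in>W. \<forall>y. \<bar>smoothing (indicator V) \<Phi> (z + y)
      - smoothing (indicator V) \<Phi> y\<bar> \<le> \<epsilon>)" by blast
qed

text \<open>A Riemann sum, by induction on the centres. The part P of B near a centre \<eta> is
  split off, and on it F(x y) is replaced by F(\<eta> y), whose mean is that of F by invariance. The
  errors add up to \<epsilon> times the measure of B.\<close>

lemma mean_smoothing_indicator_approx:
  assumes F: "bounded_borel F" and W: "open W" "\<And>z y. z \<in> W \<Longrightarrow> \<bar>F (z + y) - F y\<bar> \<le> \<epsilon>"
    and I: "finite I"
  shows "B \<in> sets borel \<Longrightarrow> emeasure \<mu> B < \<infinity> \<Longrightarrow> B \<subseteq> (\<Union>\<eta>\<in>I. (\<lambda>x. x - \<eta>) -` W)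
    \<Longrightarrow> \<bar>mean (smoothing (indicator B) F) - measure \<mu> B * mean F\<bar> \<le> \<epsilon> * measure \<mu> B"
  using I
proof (induction I arbitrary: B rule: finite_induct)
  case empty
  then show ?case by (simp add: smoothing_def[abs_def])
next
  case (insert \<eta> I)
  obtain C where C: "\<And>x. \<bar>F x\<bar> \<le> C" using F by (auto simp: bounded_borel_def)
  have Fm [measurable]: "F \<in> borel_measurable borel" using F by (simp add: bounded_borel_def)
  note [measurable] = insert.prems(1)
  have Wm: "(\<lambda>x. x - \<eta>) -` W \<in> sets borel"
  proof -
    have "open ((\<lambda>x. x + - \<eta>) -` W)" using W(1) by (intro open_vimage continuous_intros)
    then show ?thesis by simp
  qed
  define P where "P = B \<inter> (\<lambda>x. x - \<eta>) -` W"
  define Q where "Q = B - (\<lambda>x. x - \<eta>) -` W"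
  have PQm [measurable]: "P \<in> sets borel" "Q \<in> sets borel" using Wm by (auto simp: P_def Q_def)
  have fin: "emeasure \<mu> P < \<infinity>" "emeasure \<mu> Q < \<infinity>"
    using insert.prems(1,2) emeasure_mono[of P B \<mu>] emeasure_mono[of Q B \<mu>]
    by (auto simp: P_def Q_def intro: le_less_trans)
  have iPQ: "integrable \<mu> (indicator P :: 'a \<Rightarrow> real)" "integrable \<mu> (indicator Q :: 'a \<Rightarrow> real)"
    using fin by auto
  have "B = P \<union> Q" "P \<inter> Q = {}" by (auto simp: P_def Q_def)
  then have mB: "measure \<mu> B = measure \<mu> P + measure \<mu> Q"
    using fin by (simp add: measure_Union fmeasurable_def)
  have iB: "(indicator B :: 'a \<Rightarrow> real) = (\<lambda>x. indicator P x + indicator Q x)"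
    by (auto simp: P_def Q_def indicator_def fun_eq_iff)
  have sB: "smoothing (indicator B) F = (\<lambda>y. smoothing (indicator P) F y + smoothing (indicator Q) F y)"
    unfolding iB by (rule ext) (rule smoothing_add[OF iPQ Fm C])
  have bb: "bounded_borel (smoothing (indicator P) F)" "bounded_borel (smoothing (indicator Q) F)"
    by (rule bounded_borel_smoothing[OF iPQ(1) Fm C], rule bounded_borel_smoothing[OF iPQ(2) Fm C])
  have bF: "bounded_borel (\<lambda>y. measure \<mu> P * F (\<eta> + y))"
    using F by (intro bounded_borel_cmult bounded_borel_translate)
  have "\<bar>smoothing (indicator P) F y - measure \<mu> P * F (\<eta> + y)\<bar> \<le> \<epsilon> * measure \<mu> P" for y
  proof -
    have i: "integrable \<mu> (\<lambda>x. indicator P x * F (x + y))" "integrable \<mu> (\<lambda>x. indicator P x * F (\<eta>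
        + y))"
      using integrable_smoothing_kernel[OF iPQ(1) Fm C] iPQ(1) by auto
    have "smoothing (indicator P) F y - measure \<mu> P * F (\<eta> + y)
        = (LINT x|\<mu>. indicator P x * F (x + y) - indicator P x * F (\<eta> + y))"
      using i by (simp add: smoothing_def)
    also have "\<bar>\<dots>\<bar> \<le> (LINT x|\<mu>. \<bar>indicator P x * F (x + y) - indicator P x * F (\<eta> + y)\<bar>)"
      using integral_norm_bound[of \<mu> "\<lambda>x. indicator P x * F (x + y) - indicator P x * F (\<eta> + y)"]
          by simp
    also have "\<dots> \<le> (LINT x|\<mu>. \<epsilon> * indicator P x)"
    proof (rule integral_mono)
      show "\<bar>indicator P x * F (x + y) - indicator P x * F (\<eta> + y)\<bar> \<le> \<epsilon> * indicator P x" for x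
      proof (cases "x \<in> P")
        case True
        then have "x - \<eta> \<in> W" by (simp add: P_def)
        from W(2)[OF this, of "\<eta> + y"] True show ?thesis by (simp add: add.assoc[symmetric])
      qed simp
    qed (use i iPQ in auto)
    finally show ?thesis using iPQ by simp
  qed
  then have "\<bar>mean (smoothing (indicator P) F) - mean (\<lambda>y. measure \<mu> P * F (\<eta> + y))\<bar>
      \<le> \<epsilon> * measure \<mu> P"
    by (intro abs_mean_diff_le bb bF)
  moreover have "mean (\<lambda>y. measure \<mu> P * F (\<eta> + y)) = measure \<mu> P * mean F"
    using F by (simp add: mean_cmult bounded_borel_translate mean_translate)
  moreover have "\<bar>mean (smoothing (indicator Q) F) - measure \<mu> Q * mean F\<bar> \<le> \<epsilon> * measure \<mu> Q"
    using insert.prems(3) by (intro insert.IH PQm fin(2)) (auto simp: Q_def)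
  moreover have "mean (smoothing (indicator B) F) = mean (smoothing (indicator P) F)
      + mean (smoothing (indicator Q) F)"
    unfolding sB by (rule mean_add[OF bb])
  ultimately show ?case unfolding mB by (simp add: algebra_simps abs_le_iff)
qed

lemma mean_smoothing_indicator:
  assumes F: "bounded_borel F" "left_uniformly_continuous F" and K: "compact K"
  shows "mean (smoothing (indicator K) F) = measure \<mu> K * mean F"
proof -
  have "\<bar>mean (smoothing (indicator K) F) - measure \<mu> K * mean F\<bar> \<le> e" if "e > 0" for e
  proof -
    define \<epsilon> where "\<epsilon> = e / (measure \<mu> K + 1)"
    have pos: "measure \<mu> K + 1 > 0" by (simp add: add_nonneg_pos)
    then have "\<epsilon> > 0" using that by (simp add: \<epsilon>_def)
    with F(2) have "\<exists>W. open W \<and> 0 \<in> W \<and> (\<forall>z\<in>W. \<forall>y. \<bar>F (z + y) - F y\<bar> \<le> \<epsilon>)"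
      unfolding left_uniformly_continuous_def by (elim allE impE)
    then obtain W where W: "open W" "0 \<in> W" "\<And>z y. z \<in> W \<Longrightarrow> \<bar>F (z + y) - F y\<bar> \<le> \<epsilon>"
      by blast
    have op: "open ((\<lambda>x. x - \<eta>) -` W)" for \<eta>
    proof -
      have "open ((\<lambda>x. x + - \<eta>) -` W)" using W(1) by (intro open_vimage continuous_intros)
      then show ?thesis by simp
    qed
    have "K \<subseteq> (\<Union>\<eta>\<in>K. (\<lambda>x. x - \<eta>) -` W)" using W(2) by auto
    then obtain I where I: "I \<subseteq> K" "finite I" "K \<subseteq> (\<Union>\<eta>\<in>I. (\<lambda>x. x - \<eta>) -` W)"
      using compactE_image[OF K, of K "\<lambda>\<eta>. (\<lambda>x. x - \<eta>) -` W"] op by blast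
    have "\<bar>mean (smoothing (indicator K) F) - measure \<mu> K * mean F\<bar> \<le> \<epsilon> * measure \<mu> K"
      by (rule mean_smoothing_indicator_approx[OF F(1) W(1,3) I(2) compact_borel[OF K] emeasure_compact_finite[OF K] I(3)])
    also have "\<dots> \<le> \<epsilon> * (measure \<mu> K + 1)" using \<open>\<epsilon> > 0\<close> by simp
    also have "\<dots> = e" using pos by (simp add: \<epsilon>_def)
    finally show ?thesis .
  qed
  then have "\<bar>mean (smoothing (indicator K) F) - measure \<mu> K * mean F\<bar> \<le> 0"
    by (rule field_le_epsilon) simp
  then show ?thesis by simp
qed

text \<open>Smooth \<Phi> over V and then over K, and read the result in two ways. The inner
  smoothing is left uniformly continuous, so its mean comes out with the factor
  \<open>measure \<mu> K\<close>. By Fubini the same function is an integral over \<xi> in V of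
  smoothings by translates of K, each within \<epsilon> of the smoothing by K.\<close>

lemma mean_smoothing_indicators_close:
  assumes K: "compact K" and V: "compact V" and \<Phi>: "\<Phi> \<in> borel_measurable borel" "\<And>x. \<bar>\<Phi> x\<bar> \<le> 1"
    and close: "\<And>\<xi>. \<xi> \<in> V \<Longrightarrow> (LINT x|\<mu>. \<bar>indicator K (- \<xi> + x) - indicator K x :: real\<bar>) \<le> \<epsilon>"
  shows "\<bar>measure \<mu> K * mean (smoothing (indicator V) \<Phi>) - measure \<mu> V * mean (smoothing (indicator K) \<Phi>)\<bar>
    \<le> \<epsilon> * measure \<mu> V"
proof -
  note [measurable] = \<Phi>(1) compact_borel[OF K] compact_borel[OF V]
  have iK: "integrable \<mu> (indicator K :: 'a \<Rightarrow> real)" and iV: "integrable \<mu> (indicator V :: 'a \<Rightarrow> real)"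
    using emeasure_compact_finite[OF V] emeasure_compact_finite[OF K] by auto
  have iKt: "integrable \<mu> (\<lambda>x. indicator K (- \<xi> + x) :: real)" for \<xi>
    by (rule integrable_left_translation[OF iK])
  let ?F = "smoothing (indicator V) \<Phi>"
  have bF: "bounded_borel ?F" by (rule bounded_borel_smoothing[OF iV \<Phi>])
  have bK: "bounded_borel (smoothing (indicator K) \<Phi>)" by (rule bounded_borel_smoothing[OF iK \<Phi>])
  obtain C where C: "\<And>x. \<bar>?F x\<bar> \<le> C" using bF by (auto simp: bounded_borel_def)
  have Fm: "?F \<in> borel_measurable borel" using bF by (simp add: bounded_borel_def)
  have bKF: "bounded_borel (smoothing (indicator K) ?F)" by (rule bounded_borel_smoothing[OF iK Fm C])
  have "\<bar>smoothing (indicator K) ?F y - measure \<mu> V * smoothing (indicator K) \<Phi> y\<bar> \<le> \<epsilon> * measure \<mu> V"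
      for y
  proof -
    have "integrable (\<mu> \<Otimes>\<^sub>M \<mu>) (\<lambda>(\<eta>, \<xi>). indicator K \<eta> * indicator V \<xi> :: real)"
      by (rule pair.Fubini_integrable) (use iK iV in \<open>auto simp: abs_mult\<close>)
    then have "integrable (\<mu> \<Otimes>\<^sub>M \<mu>) (\<lambda>p. \<Phi> (snd p + fst p + y) * (case p of (\<eta>, \<xi>) \<Rightarrow> indicator K \<eta> * indicator V \<xi>))"
      using \<Phi>(2) by (intro integrable_bounded_mult) auto
    then have i2: "integrable (\<mu> \<Otimes>\<^sub>M \<mu>) (\<lambda>(\<eta>, \<xi>). \<Phi> (\<xi> + \<eta> + y) * (indicator K \<eta> * indicator V \<xi>))"
      by (simp add: case_prod_beta')
    have "smoothing (indicator K) ?F y = (LINT \<eta>|\<mu>. LINT \<xi>|\<mu>. \<Phi> (\<xi> + \<eta> + y) * (indicator K \<eta> * indicator V \<xi>))"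
      unfolding smoothing_def integral_mult_right_zero[symmetric]
      by (intro Bochner_Integration.integral_cong refl) (simp add: mult_ac add.assoc)
    also have "\<dots> = (LINT \<xi>|\<mu>. LINT \<eta>|\<mu>. \<Phi> (\<xi> + \<eta> + y) * (indicator K \<eta> * indicator V \<xi>))"
      using pair.Fubini_integral[OF i2] by simp
    also have "\<dots> = (LINT \<xi>|\<mu>. indicator V \<xi> * smoothing (\<lambda>\<eta>. indicator K (- \<xi> + \<eta>)) \<Phi> y)"
    proof (rule Bochner_Integration.integral_cong[OF refl])
      fix \<xi>
      have "(LINT \<eta>|\<mu>. indicator K (- \<xi> + \<eta>) * \<Phi> (\<eta> + y)) = (LINT \<eta>|\<mu>. indicator K (- \<xi> + (\<xi>
          + \<eta>)) * \<Phi> (\<xi> + \<eta> + y))"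
        by (rule integral_left_translation[symmetric]) measurable
      moreover have "(LINT \<eta>|\<mu>. \<Phi> (\<xi> + \<eta> + y) * (indicator K \<eta> * indicator V \<xi>))
          = (LINT \<eta>|\<mu>. indicator V \<xi> * (indicator K (- \<xi> + (\<xi> + \<eta>)) * \<Phi> (\<xi> + \<eta> + y)))"
        by (rule Bochner_Integration.integral_cong) (simp_all add: mult_ac)
      ultimately show "(LINT \<eta>|\<mu>. \<Phi> (\<xi> + \<eta> + y) * (indicator K \<eta> * indicator V \<xi>))
          = indicator V \<xi> * smoothing (\<lambda>\<eta>. indicator K (- \<xi> + \<eta>)) \<Phi> y"
        by (simp only: smoothing_def integral_mult_right_zero)
    qed
    finally have s1: "smoothing (indicator K) ?F y = (LINT \<xi>|\<mu>. indicator V \<xi> * smoothing (\<lambda>\<eta>. indicator K (- \<xi> + \<eta>)) \<Phi> y)" .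
    define s where "s \<xi> = smoothing (\<lambda>\<eta>. indicator K (- \<xi> + \<eta>)) \<Phi> y" for \<xi>
    define c where "c = smoothing (indicator K) \<Phi> y"
    have sm: "s \<in> borel_measurable borel"
      unfolding s_def[abs_def] smoothing_def by measurable
    have sb: "\<bar>s \<xi>\<bar> \<le> measure \<mu> K" for \<xi>
      unfolding s_def
      using abs_smoothing_le[OF iKt \<Phi>, of \<xi> y] integral_left_translation[of "indicator K :: 'a \<Rightarrow> real" "- \<xi>"] by simp
    have i3: "integrable \<mu> (\<lambda>\<xi>. indicator V \<xi> * s \<xi>)"
      using integrable_bounded_mult[OF iV, of s "measure \<mu> K"] sm sb by (simp add: mult.commute)
    then have i4: "integrable \<mu> (\<lambda>\<xi>. indicator V \<xi> * s \<xi> - indicator V \<xi> * c)" using iV by simp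
    have sc: "\<bar>s \<xi> - c\<bar> \<le> \<epsilon>" if "\<xi> \<in> V" for \<xi>
    proof -
      have "\<bar>s \<xi> - c\<bar> = \<bar>smoothing (\<lambda>\<eta>. indicator K (- \<xi> + \<eta>) - indicator K \<eta>) \<Phi> y\<bar>"
        using smoothing_diff[OF iKt iK \<Phi>] by (simp add: s_def c_def)
      also have "\<dots> \<le> (LINT x|\<mu>. \<bar>indicator K (- \<xi> + x) - indicator K x :: real\<bar>) * 1"
        by (rule abs_smoothing_le[OF Bochner_Integration.integrable_diff[OF iKt iK] \<Phi>])
      also have "\<dots> \<le> \<epsilon>" using close[OF that] by simp
      finally show ?thesis .
    qed
    have "smoothing (indicator K) ?F y - measure \<mu> V * c = (LINT \<xi>|\<mu>. indicator V \<xi> * s \<xi>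
        - indicator V \<xi> * c)"
      unfolding s1 using i3 iV by (simp add: s_def)
    moreover have "\<bar>LINT \<xi>|\<mu>. indicator V \<xi> * s \<xi> - indicator V \<xi> * c\<bar>
        \<le> (LINT \<xi>|\<mu>. \<bar>indicator V \<xi> * s \<xi> - indicator V \<xi> * c\<bar>)"
      using integral_norm_bound[of \<mu> "\<lambda>\<xi>. indicator V \<xi> * s \<xi> - indicator V \<xi> * c"] by simp
    moreover have "(LINT \<xi>|\<mu>. \<bar>indicator V \<xi> * s \<xi> - indicator V \<xi> * c\<bar>)
        \<le> (LINT \<xi>|\<mu>. \<epsilon> * indicator V \<xi>)"
    proof (rule integral_mono)
      show "\<bar>indicator V \<xi> * s \<xi> - indicator V \<xi> * c\<bar> \<le> \<epsilon> * indicator V \<xi>" for \<xi>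
        using sc[of \<xi>] by (cases "\<xi> \<in> V") auto
      show "integrable \<mu> (\<lambda>\<xi>. \<bar>indicator V \<xi> * s \<xi> - indicator V \<xi> * c\<bar>)" using i4
          by (rule integrable_abs)
      show "integrable \<mu> (\<lambda>\<xi>. \<epsilon> * indicator V \<xi>)" using iV by simp
    qed
    moreover have "(LINT \<xi>|\<mu>. \<epsilon> * indicator V \<xi>) = \<epsilon> * measure \<mu> V" by simp
    ultimately show ?thesis unfolding c_def by linarith
  qed
  then have "\<bar>mean (smoothing (indicator K) ?F) - mean (\<lambda>y. measure \<mu> V * smoothing (indicator K) \<Phi> y)\<bar> \<le> \<epsilon> * measure \<mu> V"
    by (intro abs_mean_diff_le bKF bounded_borel_cmult bK)
  moreover have "mean (smoothing (indicator K) ?F) = measure \<mu> K * mean ?F"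
    by (rule mean_smoothing_indicator[OF bF smoothing_indicator_uniformly_continuous[OF V \<Phi>] K])
  ultimately show ?thesis by (simp add: mean_cmult[OF bK])
qed

text \<open>Both means are compared with the mean of \<open>\<Phi>\<close> smoothed over one small neighbourhood of the
    identity.\<close>

lemma mean_smoothing_translate:
  assumes K: "compact K" and \<Phi>: "\<Phi> \<in> borel_measurable borel" "\<And>x. \<bar>\<Phi> x\<bar> \<le> 1"
  shows "mean (smoothing (\<lambda>\<eta>. indicator K (- \<zeta> + \<eta>)) \<Phi>) = mean (smoothing (indicator K) \<Phi>)"
proof -
  let ?L = "(\<lambda>x. \<zeta> + x) ` K"
  have L: "compact ?L" using K by (intro compact_continuous_image continuous_intros)
  have mL: "measure \<mu> ?L = measure \<mu> K"
    using emeasure_left_translate[OF compact_borel[OF K]] by (simp add: measure_def)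
  have iL: "(\<lambda>\<eta>. indicator K (- \<zeta> + \<eta>)) = (indicator ?L :: 'a \<Rightarrow> real)"
    by (auto simp: indicator_def image_iff fun_eq_iff add.assoc[symmetric] intro!: bexI[of _ "- \<zeta>
        + _"])
  let ?mK = "mean (smoothing (indicator K) \<Phi>)" and ?mL = "mean (smoothing (indicator ?L) \<Phi>)"
  have "\<bar>?mL - ?mK\<bar> \<le> e" if "e > 0" for e
  proof -
    have e: "e / 2 > 0" using that by simp
    obtain W1 where W1: "open W1" "(0::'a) \<in> W1"
      "\<And>z. z \<in> W1 \<Longrightarrow> (LINT x|\<mu>. \<bar>indicator K (- z + x) - indicator K x :: real\<bar>) \<le> e / 2"
      using indicator_left_translate_continuous[OF K e] by blast
    obtain W2 where W2: "open W2" "(0::'a) \<in> W2"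
      "\<And>z. z \<in> W2 \<Longrightarrow> (LINT x|\<mu>. \<bar>indicator ?L (- z + x) - indicator ?L x :: real\<bar>) \<le> e / 2"
      using indicator_left_translate_continuous[OF L e] by blast
    \<comment> \<open>One set V serves both K and its translate. As these have equal measure, the
      terms containing the mean over V cancel in the comparison.\<close>
    have W: "open (W1 \<inter> W2)" "W1 \<inter> W2 \<noteq> {}" using W1 W2 by auto
    obtain V where V: "compact V" "V \<subseteq> W1 \<inter> W2" "measure \<mu> V > 0"
      using compact_subset_positive_measure[OF W] by blast
    let ?mV = "mean (smoothing (indicator V) \<Phi>)"
    have "\<bar>measure \<mu> K * ?mV - measure \<mu> V * ?mK\<bar> \<le> e / 2 * measure \<mu> V"
      using V W1(3) by (intro mean_smoothing_indicators_close K \<Phi>) auto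
    moreover have "\<bar>measure \<mu> ?L * ?mV - measure \<mu> V * ?mL\<bar> \<le> e / 2 * measure \<mu> V"
      using V W2(3) by (intro mean_smoothing_indicators_close L \<Phi>) auto
    ultimately have "\<bar>measure \<mu> V * ?mL - measure \<mu> V * ?mK\<bar> \<le> e * measure \<mu> V"
      unfolding mL by linarith
    then have "measure \<mu> V * \<bar>?mL - ?mK\<bar> \<le> measure \<mu> V * e"
      using V(3) by (simp add: right_diff_distrib[symmetric] abs_mult mult.commute)
    then show ?thesis using V(3) by simp
  qed
  then have "\<bar>?mL - ?mK\<bar> \<le> 0" by (rule field_le_epsilon) simp
  then show ?thesis unfolding iL by simp
qed

end

section \<open>Almost invariant vectors\<close>

context modular_haar_measure
begin

text \<open>If the bound failed on a set of positive finite measure, the normalised indicator of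
  that set would be a density violating the hypothesis. Cutting down to compact sets provides the
  finiteness.\<close>

lemma AE_ge_if_density_integral_ge:
  assumes \<Psi>: "bounded_borel \<Psi>"
    and ge: "\<And>v. probability_density v \<Longrightarrow> c \<le> (LINT y|\<mu>. v y * \<Psi> y)"
  shows "AE y in \<mu>. c \<le> \<Psi> y"
proof -
  obtain K :: "nat \<Rightarrow> 'a set" where K: "\<And>n. compact (K n)" "(\<Union>n. K n) = UNIV"
    using exhausting_compacts by blast
  have [measurable]: "\<Psi> \<in> borel_measurable borel" using \<Psi> by (simp add: bounded_borel_def)
  obtain C where C: "\<And>x. \<bar>\<Psi> x\<bar> \<le> C" using \<Psi> by (auto simp: bounded_borel_def)
  have "AE y in \<mu>. y \<in> K n \<longrightarrow> c \<le> \<Psi> y" for n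
  proof -
    note [measurable] = compact_borel[OF K(1)]
    define S where "S = {y \<in> K n. \<Psi> y < c}"
    have S [measurable]: "S \<in> sets borel" unfolding S_def by measurable
    have "emeasure \<mu> S \<le> emeasure \<mu> (K n)" by (rule emeasure_mono) (auto simp: S_def)
    then have fin: "emeasure \<mu> S < \<infinity>" using emeasure_compact_finite[OF K(1)] by (rule le_less_trans)
    then have iS: "integrable \<mu> (indicator S :: 'a \<Rightarrow> real)" by simp
    have i: "integrable \<mu> (\<lambda>y. indicator S y * \<Psi> y)"
      using integrable_bounded_mult[OF iS, of \<Psi> C] C by (simp add: mult.commute)
    have "AE y in \<mu>. y \<notin> S"
    proof (cases "measure \<mu> S = 0")
      case True
      then have "S \<in> null_sets \<mu>" using fin by (auto simp: null_sets_def measure_def enn2real_eq_0_iff)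
      then show ?thesis by (rule AE_not_in)
    next
      case False
      then have pos: "measure \<mu> S > 0" by (simp add: zero_less_measure_iff)
      have "probability_density (\<lambda>y. indicator S y / measure \<mu> S)"
        unfolding probability_density_def using iS pos by simp
      from ge[OF this] have "c \<le> (LINT y|\<mu>. indicator S y * \<Psi> y) / measure \<mu> S" by simp
      then have le: "c * measure \<mu> S \<le> (LINT y|\<mu>. indicator S y * \<Psi> y)"
        using pos by (simp add: field_simps)
      define h where "h y = c * indicator S y - indicator S y * \<Psi> y" for y
      have h0: "0 \<le> h y" for y by (auto simp: h_def S_def indicator_def)
      have ih: "integrable \<mu> h" unfolding h_def[abs_def] using i iS by simp
      have "(LINT y|\<mu>. h y) \<le> 0" unfolding h_def using i iS le by simp
      moreover have "0 \<le> (LINT y|\<mu>. h y)" using h0 by (intro Bochner_Integration.integral_nonneg)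
      ultimately have "(LINT y|\<mu>. h y) = 0" by (rule antisym)
      then have "AE y in \<mu>. h y = 0"
        using integral_nonneg_eq_0_iff_AE[OF ih] h0 by simp
      then show ?thesis by eventually_elim (auto simp: h_def S_def indicator_def split: if_splits)
    qed
    then show ?thesis by eventually_elim (auto simp: S_def)
  qed
  then have "AE y in \<mu>. \<forall>n. y \<in> K n \<longrightarrow> c \<le> \<Psi> y" unfolding AE_all_countable by blast
  then show ?thesis by eventually_elim (use K(2) in blast)
qed

text \<open>Convergence is pointwise in the group element, which is the form that dominated
  convergence against an integrable kernel takes as input.\<close>

definition almost_invariant :: "(nat \<Rightarrow> 'a \<Rightarrow> complex) \<Rightarrow> bool" where
  "almost_invariant f \<longleftrightarrow> (\<forall>n. f n \<in> L2 \<mu> \<and> L2_norm \<mu> (f n) = 1) \<and>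
     (\<forall>\<zeta>. (\<lambda>n. L2_norm \<mu> (\<lambda>x. left_translate \<zeta> (f n) x - f n x)) \<longlonglongrightarrow> 0)"

text \<open>Square roots turn densities into unit vectors, and (sqrt a - sqrt b)^2 \<le> |a - b|
  bounds the squared L^2 distance by the L^1 distance.\<close>

lemma almost_invariant_if_densities:
  assumes u: "\<And>n. probability_density (u n)"
    and lim: "\<And>\<zeta>. (\<lambda>n. LINT x|\<mu>. \<bar>u n (- \<zeta> + x) - u n x\<bar>) \<longlonglongrightarrow> 0"
  shows "almost_invariant (\<lambda>n x. complex_of_real (sqrt (u n x)))"
  unfolding almost_invariant_def
proof (intro conjI allI)
  fix n
  have [measurable]: "u n \<in> borel_measurable borel" and u0: "\<And>x. 0 \<le> u n x"
      and iu: "integrable \<mu> (u n)"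
    and u1: "(LINT x|\<mu>. u n x) = 1"
    using u[of n] by (auto simp: probability_density_def)
  show "(\<lambda>x. complex_of_real (sqrt (u n x))) \<in> L2 \<mu>"
    using iu u0 by (simp add: L2_def)
  show "L2_norm \<mu> (\<lambda>x. complex_of_real (sqrt (u n x))) = 1"
    using u0 u1 by (simp add: L2_norm_def)
next
  fix \<zeta>
  have le: "(L2_norm \<mu> (\<lambda>x. left_translate \<zeta> (\<lambda>x. complex_of_real (sqrt (u n x))) x - complex_of_real (sqrt (u n x))))\<^sup>2
      \<le> (LINT x|\<mu>. \<bar>u n (- \<zeta> + x) - u n x\<bar>)" for n
  proof -
    have [measurable]: "u n \<in> borel_measurable borel" and u0: "\<And>x. 0 \<le> u n x"
        and iu: "integrable \<mu> (u n)"
      using u[of n] by (auto simp: probability_density_def)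
    have i: "integrable \<mu> (\<lambda>x. \<bar>u n (- \<zeta> + x) - u n x\<bar>)"
      using integrable_left_translation[OF iu] iu by simp
    have sq: "(sqrt a - sqrt b)\<^sup>2 \<le> \<bar>a - b\<bar>" if "0 \<le> a" "0 \<le> b" for a b :: real
    proof -
      have "(sqrt a - sqrt b)\<^sup>2 \<le> \<bar>sqrt a - sqrt b\<bar> * \<bar>sqrt a + sqrt b\<bar>"
        unfolding power2_eq_square using that
        by (subst abs_mult_self_eq[symmetric], intro mult_left_mono) (auto simp: abs_le_iff)
      also have "\<dots> = \<bar>a - b\<bar>"
        using that unfolding abs_mult[symmetric] by (simp add: algebra_simps)
      finally show ?thesis .
    qed
    have eq: "norm (left_translate \<zeta> (\<lambda>x. complex_of_real (sqrt (u n x))) x - complex_of_real (sqrt (u n x)))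
        = \<bar>sqrt (u n (- \<zeta> + x)) - sqrt (u n x)\<bar>" for x
      unfolding left_translate_def of_real_diff[symmetric] norm_of_real by simp
    show ?thesis
      unfolding L2_norm_power2 eq power2_abs
    proof (rule integral_mono[OF _ i])
      show "integrable \<mu> (\<lambda>x. (sqrt (u n (- \<zeta> + x)) - sqrt (u n x))\<^sup>2)"
        by (rule Bochner_Integration.integrable_bound[OF i]) (use sq u0 in auto)
      show "(sqrt (u n (- \<zeta> + x)) - sqrt (u n x))\<^sup>2 \<le> \<bar>u n (- \<zeta> + x) - u n x\<bar>" for x
        using sq u0 by simp
    qed
  qed
  have "(\<lambda>n. (L2_norm \<mu> (\<lambda>x. left_translate \<zeta> (\<lambda>x. complex_of_real (sqrt (u n x))) x
      - complex_of_real (sqrt (u n x))))\<^sup>2) \<longlonglongrightarrow> 0"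
    using le by (intro tendsto_sandwich[OF _ _ tendsto_const lim[of \<zeta>]]) auto
  then have "(\<lambda>n. sqrt ((L2_norm \<mu> (\<lambda>x. left_translate \<zeta> (\<lambda>x. complex_of_real (sqrt (u n x))) x
      - complex_of_real (sqrt (u n x))))\<^sup>2)) \<longlonglongrightarrow> sqrt 0"
    by (rule tendsto_real_sqrt)
  then show "(\<lambda>n. L2_norm \<mu> (\<lambda>x. left_translate \<zeta> (\<lambda>x. complex_of_real (sqrt (u n x))) x
      - complex_of_real (sqrt (u n x)))) \<longlonglongrightarrow> 0"
    by simp
qed

lemma Linf_of_real: "bounded_borel \<phi> \<Longrightarrow> (\<lambda>x. complex_of_real (\<phi> x)) \<in> Linf \<mu>"
  by (auto simp: bounded_borel_def Linf_def)

lemma amenable_imp_invariant_mean: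
  assumes "amenable \<mu>"
  obtains mean where "invariant_mean \<mu> \<delta> mean"
proof -
  obtain m where m: "Linf_state \<mu> m" and inv: "\<And>\<zeta> f. f \<in> Linf \<mu> \<Longrightarrow> m (left_translate \<zeta> f) = m f"
    using assms unfolding amenable_def by blast
  have add: "m (\<lambda>x. f x + g x) = m f + m g" if "f \<in> Linf \<mu>" "g \<in> Linf \<mu>" for f g
    using m that unfolding Linf_state_def by blast
  have cm: "m (\<lambda>x. c * f x) = c * m f" if "f \<in> Linf \<mu>" for f c
    using m that unfolding Linf_state_def by blast
  have pos: "m f \<in> \<real>\<^sub>\<ge>\<^sub>0" if "f \<in> Linf \<mu>" "AE x in \<mu>. f x \<in> \<real>\<^sub>\<ge>\<^sub>0" for f
    using m that unfolding Linf_state_def by blast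
  have one: "m (\<lambda>x. 1) = 1" using m unfolding Linf_state_def by blast
  let ?mean = "\<lambda>\<phi>. Re (m (\<lambda>x. complex_of_real (\<phi> x)))"
  have "invariant_mean \<mu> \<delta> ?mean"
  proof
    show "?mean (\<lambda>x. \<phi> x + \<psi> x) = ?mean \<phi> + ?mean \<psi>" if "bounded_borel \<phi>" "bounded_borel \<psi>" for \<phi> \<psi>
      using add[OF that[THEN Linf_of_real]] by simp
    show "?mean (\<lambda>x. c * \<phi> x) = c * ?mean \<phi>" if "bounded_borel \<phi>" for \<phi> c
      using cm[OF that[THEN Linf_of_real], of "complex_of_real c"] by simp
    show "0 \<le> ?mean \<phi>" if "bounded_borel \<phi>" "AE x in \<mu>. 0 \<le> \<phi> x" for \<phi>
      using pos[OF that(1)[THEN Linf_of_real]] that(2) by (auto simp: complex_nonneg_Reals_iff)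
    show "?mean (\<lambda>x. 1) = 1" using one by simp
    show "?mean (\<lambda>x. \<phi> (\<zeta> + x)) = ?mean \<phi>" if "bounded_borel \<phi>" for \<phi> \<zeta>
      using inv[OF that[THEN Linf_of_real], of "- \<zeta>"] by (simp add: left_translate_def)
  qed
  then show ?thesis by (rule that)
qed

end

section \<open>From an invariant mean to almost invariant vectors\<close>

context invariant_mean
begin

text \<open>The negated conclusion bounds the sum of the n norms from below on the whole convex set
  of tuples. Adjointness then turns the separating inequality into a lower bound, almost everywhere,
  for a function whose mean is 0.\<close>

lemma density_almost_fixed_by_convolutions:
  fixes n :: nat and \<zeta> :: "nat \<Rightarrow> 'a"
  assumes K: "compact K" and "\<epsilon> > 0"
  obtains v where "probability_density v"
    "\<And>i. i < n \<Longrightarrow> (LINT x|\<mu>. \<bar>convolution (\<lambda>\<eta>. indicator K (- \<zeta> i + \<eta>) - indicator K \<eta>) v x\<bar>) \<le> \<epsilon>"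
proof (rule ccontr)
  assume no: "\<not> thesis"
  note witness = that
  note [measurable] = compact_borel[OF K]
  define a where "a i \<eta> = (indicator K (- \<zeta> i + \<eta>) - indicator K \<eta> :: real)" for i \<eta>
  have iK: "integrable \<mu> (indicator K :: 'a \<Rightarrow> real)" using emeasure_compact_finite[OF K] by simp
  have iKt: "integrable \<mu> (\<lambda>x. indicator K (- \<xi> + x) :: real)" for \<xi>
    by (rule integrable_left_translation[OF iK])
  have ia: "integrable \<mu> (a i)" for i unfolding a_def[abs_def] using iK iKt by simp
  define N where "N = count_space {..<n} \<Otimes>\<^sub>M \<mu>"
  note N_int = finite_sum_measure_integral[OF sigma_finite_measure_axioms, of n, folded N_def]
  \<comment> \<open>Components are prescribed only almost everywhere, because convolution is affine
    in the density only up to null sets; this makes C convex.\<close>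
  define C where "C = {g :: nat \<times> 'a \<Rightarrow> real. (\<forall>i<n. integrable \<mu> (\<lambda>x. g (i, x))) \<and>
    (\<exists>v. probability_density v \<and> (\<forall>i<n. AE x in \<mu>. g (i, x) = convolution (a i) v x))}"
  define gv where "gv v p = convolution (a (fst p)) v (snd p)" for v and p :: "nat \<times> 'a"
  have iv: "integrable \<mu> v" if "probability_density v" for v using that
      by (simp add: probability_density_def)
  have gvC: "gv v \<in> C" if "probability_density v" for v
    unfolding C_def using integrable_convolution[OF ia iv[OF that]] that by (auto simp: gv_def)
  interpret S: sigma_finite_measure "count_space {..<n}"
    by (rule sigma_finite_measure_count_space_finite) simp
  interpret PN: pair_sigma_finite "count_space {..<n}" \<mu> ..
  interpret N: sigma_finite_measure N unfolding N_def by (rule PN.sigma_finite_measure_axioms)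
  obtain V where "compact V" "measure \<mu> V > 0"
    using compact_subset_positive_measure[OF open_UNIV] by auto
  then have v0: "probability_density (\<lambda>x. indicator V x / measure \<mu> V)"
    using emeasure_compact_finite[of V] compact_borel[of V] by (simp add: probability_density_def)
  obtain \<Phi> where \<Phi>: "\<Phi> \<in> borel_measurable N" "\<And>p. \<bar>\<Phi> p\<bar> \<le> 1"
    "\<And>g. g \<in> C \<Longrightarrow> \<epsilon> / 2 \<le> (LINT p|N. \<Phi> p * g p)"
  proof (rule N.L1_convex_separation[of C \<epsilon>])
    show "integrable N g" if "g \<in> C" for g using that by (intro N_int) (auto simp: C_def)
    show "C \<noteq> {}" using gvC[OF v0] by auto
    show "(\<lambda>x. (1 - t) * g x + t * h x) \<in> C" if "g \<in> C" "h \<in> C" and t: "0 < t" "t < 1" for g h t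
    proof -
      obtain v w where v: "probability_density v" "\<And>i. i < n \<Longrightarrow> AE x in \<mu>. g (i, x)
          = convolution (a i) v x"
        and w: "probability_density w" "\<And>i. i < n \<Longrightarrow> AE x in \<mu>. h (i, x) = convolution (a i) w x"
        and ig: "\<And>i. i < n \<Longrightarrow> integrable \<mu> (\<lambda>x. g (i, x))" and ih: "\<And>i. i < n
            \<Longrightarrow> integrable \<mu> (\<lambda>x. h (i, x))"
        using \<open>g \<in> C\<close> \<open>h \<in> C\<close> unfolding C_def by blast
      have vw: "probability_density (\<lambda>x. (1 - t) * v x + t * w x)"
        using v(1) w(1) t unfolding probability_density_def
        by (intro conjI borel_measurable_add borel_measurable_times) auto
      have AEc: "AE x in \<mu>. (1 - t) * g (i, x) + t * h (i, x) = convolution (a i) (\<lambda>x. (1 - t) * v x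
          + t * w x) x"
        if "i < n" for i
        using v(2)[OF that] w(2)[OF that] convolution_affine_right[OF ia iv[OF v(1)] iv[OF w(1)], of i "1 - t" t]
        by eventually_elim simp
      have "integrable \<mu> (\<lambda>x. (1 - t) * g (i, x) + t * h (i, x))" if "i < n" for i
        using ig[OF that] ih[OF that] by simp
      with vw AEc show ?thesis unfolding C_def mem_Collect_eq
        by (intro conjI allI impI exI[of _ "\<lambda>x. (1 - t) * v x + t * w x"])
    qed
    show "\<epsilon> \<le> (LINT p|N. \<bar>g p\<bar>)" if "g \<in> C" for g
    proof -
      obtain v where v: "probability_density v" "\<And>i. i < n \<Longrightarrow> AE x in \<mu>. g (i, x)
          = convolution (a i) v x"
        and ig: "\<And>i. i < n \<Longrightarrow> integrable \<mu> (\<lambda>x. g (i, x))"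
        using \<open>g \<in> C\<close> unfolding C_def by blast
      obtain i where i: "i < n" "\<epsilon> < (LINT x|\<mu>. \<bar>convolution (a i) v x\<bar>)"
      proof (rule ccontr)
        assume "\<not> ?thesis"
        with that have "i < n \<Longrightarrow> (LINT x|\<mu>. \<bar>convolution (a i) v x\<bar>) \<le> \<epsilon>" for i
          by (meson not_less)
        with witness[OF v(1)] no show False by (simp add: a_def[abs_def])
      qed
      have "(LINT x|\<mu>. \<bar>convolution (a i) v x\<bar>) = (LINT x|\<mu>. \<bar>g (i, x)\<bar>)"
        using v(2)[OF i(1)] ig[OF i(1)] integrable_convolution[OF ia iv[OF v(1)]]
        by (intro integral_cong_AE) auto
      also have "\<dots> \<le> (\<Sum>i<n. LINT x|\<mu>. \<bar>g (i, x)\<bar>)"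
        using i(1) by (intro member_le_sum) (auto intro!: Bochner_Integration.integral_nonneg)
      also have "\<dots> = (LINT p|N. \<bar>g p\<bar>)"
        using ig by (subst N_int(2)) auto
      finally show ?thesis using i(2) by simp
    qed
  qed (use \<open>\<epsilon> > 0\<close> in auto)
  have \<Phi>i: "(\<lambda>x. \<Phi> (i, x)) \<in> borel_measurable borel" if "i < n" for i
  proof -
    have "Pair i \<in> measurable \<mu> N" unfolding N_def using that by (intro measurable_Pair1') simp
    from measurable_compose[OF this \<Phi>(1)] show ?thesis by simp
  qed
  \<comment> \<open>By adjointness, pairing \<Phi> with the tuple of a density v amounts to
    integrating v against this function. Each summand is a difference of two smoothings with equal
    means.\<close>
  define \<Psi> where "\<Psi> y = (\<Sum>i<n. smoothing (a i) (\<lambda>x. \<Phi> (i, x)) y)" for y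
  have bs: "bounded_borel (smoothing (a i) (\<lambda>x. \<Phi> (i, x)))" if "i < n" for i
    by (rule bounded_borel_smoothing[OF ia \<Phi>i[OF that] \<Phi>(2)])
  have b\<Psi>: "bounded_borel \<Psi>" unfolding \<Psi>_def[abs_def] using bs by (intro bounded_borel_sum) simp
  have "\<epsilon> / 2 \<le> (LINT y|\<mu>. v y * \<Psi> y)" if v: "probability_density v" for v
  proof -
    have ic: "integrable \<mu> (\<lambda>x. \<Phi> (i, x) * convolution (a i) v x)" if "i < n" for i
      using \<Phi>i[OF that] \<Phi>(2) by (intro integrable_bounded_mult[OF integrable_convolution[OF ia iv[OF v]]]) auto
    have isv: "integrable \<mu> (\<lambda>y. v y * smoothing (a i) (\<lambda>x. \<Phi> (i, x)) y)" if i: "i < n" for i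
    proof -
      obtain D where "\<And>y. \<bar>smoothing (a i) (\<lambda>x. \<Phi> (i, x)) y\<bar> \<le> D" using bs[OF i]
          by (auto simp: bounded_borel_def)
      then have "integrable \<mu> (\<lambda>y. smoothing (a i) (\<lambda>x. \<Phi> (i, x)) y * v y)"
        using bs[OF i] by (intro integrable_bounded_mult[OF iv[OF v]]) (auto simp: bounded_borel_def)
      then show ?thesis by (simp add: mult.commute)
    qed
    have "\<epsilon> / 2 \<le> (LINT p|N. \<Phi> p * gv v p)" by (rule \<Phi>(3)[OF gvC[OF v]])
    also have "\<dots> = (\<Sum>i<n. LINT x|\<mu>. \<Phi> (i, x) * convolution (a i) v x)"
      using ic by (subst N_int(2)) (auto simp: gv_def)
    also have "\<dots> = (\<Sum>i<n. LINT y|\<mu>. v y * smoothing (a i) (\<lambda>x. \<Phi> (i, x)) y)"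
      using integral_convolution_mult[OF ia iv[OF v] \<Phi>i \<Phi>(2)] by simp
    also have "\<dots> = (LINT y|\<mu>. v y * \<Psi> y)"
      using isv by (simp add: \<Psi>_def sum_distrib_left)
    finally show ?thesis .
  qed
  then have "AE y in \<mu>. \<epsilon> / 2 \<le> \<Psi> y" by (rule AE_ge_if_density_integral_ge[OF b\<Psi>])
  then have "mean (\<lambda>y. \<epsilon> / 2) \<le> mean \<Psi>" by (intro mean_mono b\<Psi>) auto
  moreover have "mean \<Psi> = 0"
  proof -
    have "mean (smoothing (a i) (\<lambda>x. \<Phi> (i, x))) = 0" if i: "i < n" for i
    proof -
      let ?P = "\<lambda>x. \<Phi> (i, x)"
      have sm: "smoothing (a i) ?P = (\<lambda>y. smoothing (\<lambda>\<eta>. indicator K (- \<zeta> i + \<eta>)) ?P y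
          - smoothing (indicator K) ?P y)"
        unfolding a_def[abs_def] by (rule ext) (rule smoothing_diff[OF iKt iK \<Phi>i[OF i] \<Phi>(2)])
      have "mean (smoothing (a i) ?P) = mean (smoothing (\<lambda>\<eta>. indicator K (- \<zeta> i + \<eta>)) ?P)
          - mean (smoothing (indicator K) ?P)"
        unfolding sm by (rule mean_diff[OF bounded_borel_smoothing[OF iKt \<Phi>i[OF i] \<Phi>(2)]
            bounded_borel_smoothing[OF iK \<Phi>i[OF i] \<Phi>(2)]])
      also have "\<dots> = 0" using mean_smoothing_translate[OF K \<Phi>i[OF i] \<Phi>(2)] by simp
      finally show ?thesis .
    qed
    then show ?thesis unfolding \<Psi>_def[abs_def] using bs by (subst mean_sum) auto
  qed
  ultimately show False using \<open>\<epsilon> > 0\<close> by (simp add: mean_const)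
qed

lemma almost_invariant_exists:
  obtains f where "almost_invariant f"
proof -
  obtain K where K: "compact K" "measure \<mu> K > 0"
    using compact_subset_positive_measure[OF open_UNIV] by auto
  note [measurable] = compact_borel[OF K(1)]
  have iK: "integrable \<mu> (indicator K :: 'a \<Rightarrow> real)" using emeasure_compact_finite[OF K(1)] by simp
  have iKt: "integrable \<mu> (\<lambda>x. indicator K (- \<xi> + x) :: real)" for \<xi>
    by (rule integrable_left_translation[OF iK])
  define a where "a \<zeta> \<eta> = (indicator K (- \<zeta> + \<eta>) - indicator K \<eta> :: real)" for \<zeta> \<eta>
  have ia: "integrable \<mu> (a \<zeta>)" for \<zeta> unfolding a_def[abs_def] using iK iKt by simp
  obtain D :: "'a set" where D: "countable D" "\<And>X. open X \<Longrightarrow> X \<noteq> {} \<Longrightarrow> \<exists>d\<in>D. d \<in> X"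
    using countable_dense_setE by blast
  have "D \<noteq> {}" using D(2)[OF open_UNIV] by auto
  define z where "z = from_nat_into D"
  have z: "\<exists>i. z i = d" if "d \<in> D" for d
    using from_nat_into_surj[OF D(1) that] by (auto simp: z_def)
  \<comment> \<open>A diagonal choice: the n-th density handles the first n points of a dense
    sequence, with error \<open>1 / real (Suc n)\<close>.\<close>
  have "\<exists>v. probability_density v \<and> (\<forall>i<n. (LINT x|\<mu>. \<bar>convolution (a (z i)) v x\<bar>)
      \<le> 1 / real (Suc n))" for n
  proof -
    have pos: "0 < 1 / real (Suc n)" by simp
    show ?thesis
      by (rule density_almost_fixed_by_convolutions[OF K(1) pos, of n z]) (auto simp: a_def[abs_def])
  qed
  then obtain v where v: "\<And>n. probability_density (v n)"
    and va: "\<And>n i. i < n \<Longrightarrow> (LINT x|\<mu>. \<bar>convolution (a (z i)) (v n) x\<bar>) \<le> 1 / real (Suc n)"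
    by metis
  have iv: "integrable \<mu> (v n)" and v1: "(LINT x|\<mu>. \<bar>v n x\<bar>) = 1" for n
    using v[of n] by (auto simp: probability_density_def)
  have conv0: "(\<lambda>n. LINT x|\<mu>. \<bar>convolution (a \<zeta>) (v n) x\<bar>) \<longlonglongrightarrow> 0" for \<zeta>
  proof (rule LIMSEQ_I)
    fix r :: real assume "r > 0"
    then have r: "r / 2 > 0" by simp
    obtain W where W: "open W" "(0::'a) \<in> W"
      "\<And>w. w \<in> W \<Longrightarrow> (LINT x|\<mu>. \<bar>indicator K (- w + x) - indicator K x :: real\<bar>) \<le> r / 2"
      using indicator_left_translate_continuous[OF K(1) r] by blast
    have "open ((\<lambda>x. - \<zeta> + x) -` W)" using W(1) by (intro open_vimage continuous_intros)
    moreover have "\<zeta> \<in> (\<lambda>x. - \<zeta> + x) -` W" using W(2) by simp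
    ultimately obtain d where d: "d \<in> D" "- \<zeta> + d \<in> W" using D(2) by blast
    obtain i where i: "z i = d" using z[OF d(1)] by blast
    \<comment> \<open>Translating the variable by \<zeta> compares K with its translate by
      \<open>- \<zeta> + d\<close>, which lies in W. This carries the estimate from the dense point
      d to \<zeta>.\<close>
    have ad: "(LINT x|\<mu>. \<bar>a \<zeta> x - a d x\<bar>) \<le> r / 2"
    proof -
      have "(LINT x|\<mu>. \<bar>a \<zeta> x - a d x\<bar>) = (LINT x|\<mu>. \<bar>indicator K (- \<zeta> + x) - indicator K (- d
          + x) :: real\<bar>)"
        by (simp add: a_def)
      also have "\<dots> = (LINT x|\<mu>. \<bar>indicator K (- \<zeta> + (\<zeta> + x)) - indicator K (- d + (\<zeta> + x)) :: real\<bar>)"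
        by (rule integral_left_translation[symmetric]) measurable
      also have "\<dots> = (LINT x|\<mu>. \<bar>indicator K (- (- \<zeta> + d) + x) - indicator K x :: real\<bar>)"
        by (rule Bochner_Integration.integral_cong)
          (simp_all add: minus_add add.assoc abs_minus_commute del: add_uminus_conv_diff)
      also have "\<dots> \<le> r / 2" by (rule W(3)[OF d(2)])
      finally show ?thesis .
    qed
    obtain n0 where n0: "1 / real (Suc n0) < r / 2" using r reals_Archimedean[of "r / 2"]
        by (auto simp: inverse_eq_divide)
    show "\<exists>n0. \<forall>n\<ge>n0. norm ((LINT x|\<mu>. \<bar>convolution (a \<zeta>) (v n) x\<bar>) - 0) < r"
    proof (intro exI[of _ "max n0 (Suc i)"] allI impI)
      fix n assume n: "n \<ge> max n0 (Suc i)"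
      note ic = integrable_convolution[OF _ iv[of n]]
      have iad: "integrable \<mu> (\<lambda>x. a \<zeta> x - a d x)" using ia by simp
      have "(LINT x|\<mu>. \<bar>convolution (a \<zeta>) (v n) x\<bar>)
          \<le> (LINT x|\<mu>. \<bar>convolution (\<lambda>x. a \<zeta> x - a d x) (v n) x\<bar> + \<bar>convolution (a d) (v n) x\<bar>)"
      proof (rule integral_mono_AE)
        show "AE x in \<mu>. \<bar>convolution (a \<zeta>) (v n) x\<bar>
            \<le> \<bar>convolution (\<lambda>x. a \<zeta> x - a d x) (v n) x\<bar> + \<bar>convolution (a d) (v n) x\<bar>"
          using convolution_diff_left[OF ia[of \<zeta>] ia[of d] iv[of n]] by eventually_elim simp
      qed (use ic[OF ia] ic[OF iad] in auto)
      also have "\<dots> = (LINT x|\<mu>. \<bar>convolution (\<lambda>x. a \<zeta> x - a d x) (v n) x\<bar>) + (LINT x|\<mu>. \<bar>convolution (a d) (v n) x\<bar>)"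
        using ic[OF ia] ic[OF iad] by simp
      also have "\<dots> \<le> r / 2 * 1 + 1 / real (Suc n)"
      proof (rule add_mono)
        have "(LINT x|\<mu>. \<bar>convolution (\<lambda>x. a \<zeta> x - a d x) (v n) x\<bar>)
            \<le> (LINT x|\<mu>. \<bar>a \<zeta> x - a d x\<bar>) * (LINT x|\<mu>. \<bar>v n x\<bar>)"
          by (rule integral_abs_convolution_le[OF iad iv])
        then show "(LINT x|\<mu>. \<bar>convolution (\<lambda>x. a \<zeta> x - a d x) (v n) x\<bar>) \<le> r / 2 * 1"
          using ad by (simp add: v1)
        show "(LINT x|\<mu>. \<bar>convolution (a d) (v n) x\<bar>) \<le> 1 / real (Suc n)"
          using va[of i n] n i by simp
      qed
      also have "1 / real (Suc n) \<le> 1 / real (Suc n0)" using n by (intro divide_left_mono) auto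
      finally have "(LINT x|\<mu>. \<bar>convolution (a \<zeta>) (v n) x\<bar>) < r" using n0 by simp
      moreover have "0 \<le> (LINT x|\<mu>. \<bar>convolution (a \<zeta>) (v n) x\<bar>)"
          by (intro Bochner_Integration.integral_nonneg) simp
      ultimately show "norm ((LINT x|\<mu>. \<bar>convolution (a \<zeta>) (v n) x\<bar>) - 0) < r" by simp
    qed
  qed
  \<comment> \<open>After convolution with the normalised indicator, the difference between the
    density and its translate is a multiple of the convolution just estimated.\<close>
  define e where "e x = inverse (measure \<mu> K) * indicator K x" for x
  have e: "probability_density e"
    using K(2) iK by (simp add: probability_density_def e_def[abs_def])
  have ie: "integrable \<mu> e" using e by (simp add: probability_density_def)
  have "(\<lambda>n. LINT x|\<mu>. \<bar>convolution e (v n) (- \<zeta> + x) - convolution e (v n) x\<bar>) \<longlonglongrightarrow> 0" for \<zeta>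
  proof -
    have "(LINT x|\<mu>. \<bar>convolution e (v n) (- \<zeta> + x) - convolution e (v n) x\<bar>)
        = inverse (measure \<mu> K) * (LINT x|\<mu>. \<bar>convolution (a \<zeta>) (v n) x\<bar>)" for n
    proof -
      have iet: "integrable \<mu> (\<lambda>\<eta>. e (- \<zeta> + \<eta>))" by (rule integrable_left_translation[OF ie])
      note ic = integrable_convolution[OF _ iv[of n]]
      have "convolution (\<lambda>\<eta>. e (- \<zeta> + \<eta>) - e \<eta>) (v n) x = inverse (measure \<mu> K) * convolution (a \<zeta>) (v n) x" for x
      proof -
        have "convolution (\<lambda>\<eta>. e (- \<zeta> + \<eta>) - e \<eta>) (v n) x
            = (LINT \<eta>|\<mu>. inverse (measure \<mu> K) * (a \<zeta> \<eta> * v n (- \<eta> + x)))"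
          unfolding convolution_def
          by (rule Bochner_Integration.integral_cong) (simp_all add: e_def a_def algebra_simps)
        then show ?thesis by (simp add: convolution_def)
      qed
      then have "AE x in \<mu>. inverse (measure \<mu> K) * convolution (a \<zeta>) (v n) x
          = convolution e (v n) (- \<zeta> + x) - convolution e (v n) x"
        using convolution_diff_left[OF iet ie iv[of n]]
        unfolding convolution_left_translate[OF ie iv] by simp
      then have "AE x in \<mu>. \<bar>convolution e (v n) (- \<zeta> + x) - convolution e (v n) x\<bar>
          = inverse (measure \<mu> K) * \<bar>convolution (a \<zeta>) (v n) x\<bar>"
      proof eventually_elim
        case (elim x)
        show ?case unfolding elim[symmetric] abs_mult using K(2) by simp
      qed
      then have "(LINT x|\<mu>. \<bar>convolution e (v n) (- \<zeta> + x) - convolution e (v n) x\<bar>)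
          = (LINT x|\<mu>. inverse (measure \<mu> K) * \<bar>convolution (a \<zeta>) (v n) x\<bar>)"
        using integrable_left_translation[OF ic[OF ie], of "- \<zeta>"] ic[OF ie] ic[OF ia, of \<zeta>]
        by (intro integral_cong_AE) auto
      then show ?thesis by simp
    qed
    then show ?thesis using tendsto_mult_right_zero[OF conv0[of \<zeta>]] by simp
  qed
  then have "almost_invariant (\<lambda>n x. complex_of_real (sqrt (convolution e (v n) x)))"
    using probability_density_convolution[OF e v] by (intro almost_invariant_if_densities)
  then show ?thesis by (rule that)
qed

end

lemma (in modular_haar_measure) amenable_imp_almost_invariant:
  assumes "amenable \<mu>"
  obtains f where "almost_invariant f"
proof -
  obtain mean where "invariant_mean \<mu> \<delta> mean" using amenable_imp_invariant_mean[OF assms] by blast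
  then interpret invariant_mean \<mu> \<delta> mean .
  show ?thesis using almost_invariant_exists that by blast
qed

section \<open>Convolution operators\<close>

context modular_haar_measure
begin

lemma L2_left_translate:
  assumes "f \<in> L2 \<mu>"
  shows "left_translate \<zeta> f \<in> L2 \<mu>"
proof -
  have [measurable]: "f \<in> borel_measurable borel" using L2_measurable[OF assms] by simp
  have "(\<lambda>x. f (- \<zeta> + x)) \<in> borel_measurable borel" by measurable
  then show ?thesis
    using integrable_left_translation[OF L2_integrable[OF assms], of "- \<zeta>"]
    by (simp add: L2_def left_translate_def)
qed

lemma L2_norm_left_translate:
  assumes "f \<in> L2 \<mu>"
  shows "L2_norm \<mu> (left_translate \<zeta> f) = L2_norm \<mu> f"
  using integral_left_translation[of "\<lambda>x. (norm (f x))\<^sup>2" "- \<zeta>"] L2_measurable[OF assms]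
  by (simp add: L2_norm_def left_translate_def)

lemma L2_bounded_op_left_translate: "L2_bounded_op \<mu> (left_translate \<zeta>)"
  unfolding L2_bounded_op_def L2_eq_def
proof (intro conjI ballI allI impI)
  show "left_translate \<zeta> f \<in> L2 \<mu>" if "f \<in> L2 \<mu>" for f using that by (rule L2_left_translate)
  show "AE x in \<mu>. left_translate \<zeta> f x = left_translate \<zeta> g x" if "AE x in \<mu>. f x = g x" for f g
    using AE_left_translation[OF that, of "- \<zeta>"] by (simp add: left_translate_def)
  show "\<exists>C. \<forall>f\<in>L2 \<mu>. L2_norm \<mu> (left_translate \<zeta> f) \<le> C * L2_norm \<mu> f"
    using L2_norm_left_translate by (intro exI[of _ 1]) auto
qed (simp_all add: left_translate_def)

text \<open>A sum of squares instead of a product makes the bound summable along square summable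
  sequences, uniformly in \<zeta>.\<close>

lemma norm_L2_inner_left_translate_le:
  assumes f: "f \<in> L2 \<mu>" and g: "g \<in> L2 \<mu>"
  shows "norm (L2_inner \<mu> (left_translate \<zeta> f) g) \<le> (L2_norm \<mu> f)\<^sup>2 + (L2_norm \<mu> g)\<^sup>2"
proof -
  have "norm (L2_inner \<mu> (left_translate \<zeta> f) g) \<le> L2_norm \<mu> f * L2_norm \<mu> g"
    using norm_L2_inner_le[OF L2_left_translate[OF f] g] L2_norm_left_translate[OF f] by simp
  moreover have "s * t \<le> s\<^sup>2 + t\<^sup>2" if "0 \<le> s" "0 \<le> t" for s t :: real
    using sum_squares_bound[of s t] mult_nonneg_nonneg[OF that] by linarith
  ultimately show ?thesis by (meson L2_norm_nonneg order_trans)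
qed

lemma summable_L2_inner_left_translate:
  assumes "L2_square_summable \<mu> v" "L2_square_summable \<mu> w"
  shows "summable (\<lambda>n. L2_inner \<mu> (left_translate \<zeta> (v n)) (w n))"
proof (rule summable_comparison_test')
  show "summable (\<lambda>n. (L2_norm \<mu> (v n))\<^sup>2 + (L2_norm \<mu> (w n))\<^sup>2)"
    using assms by (intro summable_add) (auto simp: L2_square_summable_def)
  show "norm (L2_inner \<mu> (left_translate \<zeta> (v n)) (w n)) \<le> (L2_norm \<mu> (v n))\<^sup>2 + (L2_norm \<mu> (w n))\<^sup>2"
      for n
    using assms by (intro norm_L2_inner_left_translate_le) (auto simp: L2_square_summable_def)
qed

text \<open>An explicit operator representing the integral of the translations weighted by k. Where
  the integrand is not integrable the value is 0; for an integrable nonnegative kernel and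
  \<open>f\<close> in \<open>L2 \<mu>\<close> this happens only on a null set.\<close>

definition convolution_op :: "('a \<Rightarrow> real) \<Rightarrow> ('a \<Rightarrow> complex) \<Rightarrow> 'a \<Rightarrow> complex" where
  "convolution_op k f \<xi> = (LINT \<zeta>|\<mu>. complex_of_real (k \<zeta>) * f (- \<zeta> + \<xi>))"

context
  fixes k :: "'a \<Rightarrow> real"
  assumes k: "integrable \<mu> k" "\<And>x. 0 \<le> k x"
begin

lemma kernel_measurable [measurable]: "k \<in> borel_measurable borel"
  using k by auto

lemma convolution_op_measurable:
  assumes [measurable]: "f \<in> borel_measurable borel"
  shows "convolution_op k f \<in> borel_measurable borel"
  unfolding convolution_op_def[abs_def] by measurable

lemma nn_integral_kernel_square:
  assumes f: "f \<in> L2 \<mu>"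
  shows "(\<integral>\<^sup>+\<xi>. \<integral>\<^sup>+\<zeta>. ennreal (k \<zeta> * (norm (f (- \<zeta> + \<xi>)))\<^sup>2) \<partial>\<mu> \<partial>\<mu>)
    = ennreal ((LINT x|\<mu>. k x) * (L2_norm \<mu> f)\<^sup>2)"
proof -
  have [measurable]: "f \<in> borel_measurable borel" using L2_measurable[OF f] by simp
  have nf: "(\<integral>\<^sup>+\<xi>. ennreal ((norm (f \<xi>))\<^sup>2) \<partial>\<mu>) = ennreal ((L2_norm \<mu> f)\<^sup>2)"
    using nn_integral_eq_integral[OF L2_integrable[OF f]] by (simp add: L2_norm_power2)
  have "(\<integral>\<^sup>+\<xi>. \<integral>\<^sup>+\<zeta>. ennreal (k \<zeta> * (norm (f (- \<zeta> + \<xi>)))\<^sup>2) \<partial>\<mu> \<partial>\<mu>)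
      = (\<integral>\<^sup>+\<zeta>. \<integral>\<^sup>+\<xi>. ennreal (k \<zeta> * (norm (f (- \<zeta> + \<xi>)))\<^sup>2) \<partial>\<mu> \<partial>\<mu>)"
    by (rule pair.Fubini') measurable
  also have "\<dots> = (\<integral>\<^sup>+\<zeta>. ennreal (k \<zeta>) * (\<integral>\<^sup>+\<xi>. ennreal ((norm (f (- \<zeta> + \<xi>)))\<^sup>2) \<partial>\<mu>) \<partial>\<mu>)"
    using k by (intro nn_integral_cong) (simp add: ennreal_mult' nn_integral_cmult)
  also have "\<dots> = (\<integral>\<^sup>+\<zeta>. ennreal (k \<zeta>) * ennreal ((L2_norm \<mu> f)\<^sup>2) \<partial>\<mu>)"
    using nn_integral_left_translation[of "\<lambda>\<xi>. ennreal ((norm (f \<xi>))\<^sup>2)"] nf by simp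
  also have "\<dots> = ennreal (LINT x|\<mu>. k x) * ennreal ((L2_norm \<mu> f)\<^sup>2)"
    using nn_integral_eq_integral[OF k(1)] k(2) by (subst nn_integral_multc) auto
  finally show ?thesis using k(2) by (simp add: ennreal_mult' Bochner_Integration.integral_nonneg)
qed

text \<open>Since t \<le> 1 + t^2, it is enough that k and k |f|^2 are integrable, and the latter
  holds at almost every point by Tonelli.\<close>

lemma AE_integrable_convolution_op:
  assumes f: "f \<in> L2 \<mu>"
  shows "AE \<xi> in \<mu>. integrable \<mu> (\<lambda>\<zeta>. complex_of_real (k \<zeta>) * f (- \<zeta> + \<xi>))"
proof -
  have [measurable]: "f \<in> borel_measurable borel" using L2_measurable[OF f] by simp
  have "AE \<xi> in \<mu>. (\<integral>\<^sup>+\<zeta>. ennreal (k \<zeta> * (norm (f (- \<zeta> + \<xi>)))\<^sup>2) \<partial>\<mu>) \<noteq> \<infinity>"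
    by (rule nn_integral_PInf_AE) (use nn_integral_kernel_square[OF f] in auto)
  then show ?thesis
  proof eventually_elim
    case (elim \<xi>)
    have "integrable \<mu> (\<lambda>\<zeta>. k \<zeta> * (norm (f (- \<zeta> + \<xi>)))\<^sup>2)"
      using elim k(2) by (intro integrableI_nonneg) (auto simp: less_top)
    then have "integrable \<mu> (\<lambda>\<zeta>. k \<zeta> + k \<zeta> * (norm (f (- \<zeta> + \<xi>)))\<^sup>2)" using k(1) by simp
    then show ?case
    proof (rule Bochner_Integration.integrable_bound)
      have "norm (complex_of_real (k \<zeta>) * f (- \<zeta> + \<xi>)) \<le> k \<zeta> + k \<zeta> * (norm (f (- \<zeta> + \<xi>)))\<^sup>2" for \<zeta>
      proof -
        have "t \<le> 1 + t\<^sup>2" for t :: real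
          using sum_squares_bound[of t 1] by (smt (verit) zero_le_power2 power_one)
        from mult_left_mono[OF this k(2)[of \<zeta>]] show ?thesis
          using k(2)[of \<zeta>] by (simp add: norm_mult distrib_left)
      qed
      then show "AE \<zeta> in \<mu>. norm (complex_of_real (k \<zeta>) * f (- \<zeta> + \<xi>))
          \<le> norm (k \<zeta> + k \<zeta> * (norm (f (- \<zeta> + \<xi>)))\<^sup>2)"
        using k(2) by (intro AE_I2) (simp add: abs_of_nonneg)
    qed measurable
  qed
qed

text \<open>Splitting k into two square roots, Cauchy-Schwarz bounds the squared value at a point by
  the integral of k times that of k |f|^2. Tonelli and left invariance evaluate what
  remains.\<close>

lemma L2_convolution_op:
  assumes f: "f \<in> L2 \<mu>"
  shows "convolution_op k f \<in> L2 \<mu>"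
    and "L2_norm \<mu> (convolution_op k f) \<le> (LINT x|\<mu>. k x) * L2_norm \<mu> f"
proof -
  let ?c = "LINT x|\<mu>. k x"
  have c: "0 \<le> ?c" using k(2) by (intro Bochner_Integration.integral_nonneg)
  have [measurable]: "f \<in> borel_measurable borel" using L2_measurable[OF f] by simp
  have [measurable]: "convolution_op k f \<in> borel_measurable borel"
      by (rule convolution_op_measurable) measurable
  have pointwise: "ennreal ((norm (convolution_op k f \<xi>))\<^sup>2)
      \<le> ennreal ?c * (\<integral>\<^sup>+\<zeta>. ennreal (k \<zeta> * (norm (f (- \<zeta> + \<xi>)))\<^sup>2) \<partial>\<mu>)"
    if i: "integrable \<mu> (\<lambda>\<zeta>. complex_of_real (k \<zeta>) * f (- \<zeta> + \<xi>))" for \<xi>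
  proof -
    have "ennreal (norm (convolution_op k f \<xi>)) \<le> (\<integral>\<^sup>+\<zeta>. ennreal (norm (complex_of_real (k \<zeta>) * f (- \<zeta>
        + \<xi>))) \<partial>\<mu>)"
      unfolding convolution_op_def by (rule integral_norm_bound_ennreal[OF i])
    also have "\<dots> = (\<integral>\<^sup>+\<zeta>. ennreal (sqrt (k \<zeta>)) * ennreal (sqrt (k \<zeta>) * norm (f (- \<zeta> + \<xi>))) \<partial>\<mu>)"
      using k(2) by (intro nn_integral_cong) (simp add: norm_mult ennreal_mult'[symmetric] mult.assoc[symmetric])
    finally have "(ennreal (norm (convolution_op k f \<xi>)))\<^sup>2
        \<le> (\<integral>\<^sup>+\<zeta>. ennreal (sqrt (k \<zeta>)) * ennreal (sqrt (k \<zeta>) * norm (f (- \<zeta> + \<xi>))) \<partial>\<mu>)\<^sup>2"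
      by (rule power_mono) simp
    also have "\<dots> \<le> (\<integral>\<^sup>+\<zeta>. (ennreal (sqrt (k \<zeta>)))\<^sup>2 \<partial>\<mu>) * (\<integral>\<^sup>+\<zeta>. (ennreal (sqrt (k \<zeta>) * norm (f (- \<zeta>
        + \<xi>))))\<^sup>2 \<partial>\<mu>)"
      by (rule Cauchy_Schwarz_nn_integral) measurable
    also have "\<dots> = (\<integral>\<^sup>+\<zeta>. ennreal (k \<zeta>) \<partial>\<mu>) * (\<integral>\<^sup>+\<zeta>. ennreal (k \<zeta> * (norm (f (- \<zeta> + \<xi>)))\<^sup>2) \<partial>\<mu>)"
      using k(2) by (simp add: ennreal_power power_mult_distrib)
    also have "(\<integral>\<^sup>+\<zeta>. ennreal (k \<zeta>) \<partial>\<mu>) = ennreal ?c"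
      using nn_integral_eq_integral[OF k(1)] k(2) by simp
    finally show ?thesis by (simp add: ennreal_power)
  qed
  have "(\<integral>\<^sup>+\<xi>. ennreal ((norm (convolution_op k f \<xi>))\<^sup>2) \<partial>\<mu>)
      \<le> (\<integral>\<^sup>+\<xi>. ennreal ?c * (\<integral>\<^sup>+\<zeta>. ennreal (k \<zeta> * (norm (f (- \<zeta> + \<xi>)))\<^sup>2) \<partial>\<mu>) \<partial>\<mu>)"
    using AE_integrable_convolution_op[OF f] by (intro nn_integral_mono_AE) (auto elim!: eventually_mono intro: pointwise)
  also have "\<dots> = ennreal ?c * ennreal (?c * (L2_norm \<mu> f)\<^sup>2)"
    by (subst nn_integral_cmult) (simp_all add: nn_integral_kernel_square[OF f])
  also have "\<dots> = ennreal ((?c * L2_norm \<mu> f)\<^sup>2)"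
    using c by (simp add: ennreal_mult'[symmetric] power_mult_distrib power2_eq_square mult_ac)
  finally have bd: "(\<integral>\<^sup>+\<xi>. ennreal ((norm (convolution_op k f \<xi>))\<^sup>2) \<partial>\<mu>)
      \<le> ennreal ((?c * L2_norm \<mu> f)\<^sup>2)" .
  have int: "integrable \<mu> (\<lambda>\<xi>. (norm (convolution_op k f \<xi>))\<^sup>2)"
    by (rule integrableI_nonneg) (use bd in \<open>auto intro: le_less_trans\<close>)
  then show "convolution_op k f \<in> L2 \<mu>" by (simp add: L2_def)
  have "(L2_norm \<mu> (convolution_op k f))\<^sup>2 \<le> (?c * L2_norm \<mu> f)\<^sup>2"
    using bd nn_integral_eq_integral[OF int] by (simp add: L2_norm_power2)
  then show "L2_norm \<mu> (convolution_op k f) \<le> ?c * L2_norm \<mu> f"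
    by (rule power2_le_imp_le) (use c in simp)
qed

lemma convolution_op_add:
  assumes "f \<in> L2 \<mu>" "g \<in> L2 \<mu>"
  shows "AE x in \<mu>. convolution_op k (\<lambda>x. f x + g x) x = convolution_op k f x + convolution_op k g x"
  using AE_integrable_convolution_op[OF assms(1)] AE_integrable_convolution_op[OF assms(2)]
  by eventually_elim (simp add: convolution_op_def distrib_left)

lemma convolution_op_cmult: "convolution_op k (\<lambda>x. c * f x) x = c * convolution_op k f x"
proof -
  have "convolution_op k (\<lambda>x. c * f x) x = (LINT \<zeta>|\<mu>. c * (complex_of_real (k \<zeta>) * f (- \<zeta> + x)))"
    unfolding convolution_op_def by (rule Bochner_Integration.integral_cong) (simp_all add: mult_ac)
  then show ?thesis by (simp add: convolution_op_def)
qed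

lemma L2_bounded_op_convolution_op: "L2_bounded_op \<mu> (convolution_op k)"
  unfolding L2_bounded_op_def L2_eq_def
proof (intro conjI ballI allI impI)
  show "convolution_op k f \<in> L2 \<mu>" if "f \<in> L2 \<mu>" for f using L2_convolution_op(1)[OF that] .
  show "AE x in \<mu>. convolution_op k (\<lambda>x. f x + g x) x = convolution_op k f x + convolution_op k g x"
    if "f \<in> L2 \<mu>" "g \<in> L2 \<mu>" for f g using convolution_op_add[OF that] .
  show "AE x in \<mu>. convolution_op k (\<lambda>x. c * f x) x = c * convolution_op k f x" for f c
    by (simp add: convolution_op_cmult)
  show "\<exists>C. \<forall>f\<in>L2 \<mu>. L2_norm \<mu> (convolution_op k f) \<le> C * L2_norm \<mu> f" using L2_convolution_op(2)
      by blast
  show "AE x in \<mu>. convolution_op k f x = convolution_op k g x"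
    if f: "f \<in> L2 \<mu>" and g: "g \<in> L2 \<mu>" and fg: "AE x in \<mu>. f x = g x" for f g
  proof -
    \<comment> \<open>By additivity, agreement almost everywhere reduces to the case of a null
      function, where the norm bound forces the image to vanish almost everywhere.\<close>
    define d where "d x = g x - f x" for x
    have d: "d \<in> L2 \<mu>" unfolding d_def[abs_def] by (rule L2_diff[OF g f])
    have "L2_norm \<mu> d = L2_norm \<mu> (\<lambda>x. 0)"
      using fg by (intro L2_norm_cong[OF d]) (auto simp: L2_eq_def d_def)
    then have "L2_norm \<mu> (convolution_op k d) = 0"
      using L2_convolution_op(2)[OF d] by (simp add: antisym)
    then have "AE x in \<mu>. convolution_op k d x = 0" by (intro L2_norm_eq_0 L2_convolution_op(1)[OF d])
    moreover have "AE x in \<mu>. convolution_op k (\<lambda>x. f x + d x) x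
        = convolution_op k f x + convolution_op k d x"
      by (rule convolution_op_add[OF f d])
    ultimately show ?thesis by eventually_elim (simp add: d_def)
  qed
qed

text \<open>Fubini with the majorant k |f|^2 + k |g|^2, where f is evaluated at a translate: the
  first term is a convolution kernel and the second a product.\<close>

lemma L2_inner_convolution_op:
  assumes f: "f \<in> L2 \<mu>" and g: "g \<in> L2 \<mu>"
  shows "integrable \<mu> (\<lambda>\<zeta>. complex_of_real (k \<zeta>) * L2_inner \<mu> (left_translate \<zeta> f) g)"
    and "L2_inner \<mu> (convolution_op k f) g = (LINT \<zeta>|\<mu>. complex_of_real (k \<zeta>) * L2_inner \<mu> (left_translate \<zeta> f) g)"
proof -
  have [measurable]: "f \<in> borel_measurable borel" "g \<in> borel_measurable borel"
    using L2_measurable[OF f] L2_measurable[OF g] by auto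
  have [measurable]: "(\<lambda>x. cnj (g x)) \<in> borel_measurable borel"
    by (rule borel_measurable_continuous_on[where f = cnj]) (auto intro: continuous_intros)
  let ?h = "\<lambda>\<zeta> \<xi>. complex_of_real (k \<zeta>) * f (- \<zeta> + \<xi>) * cnj (g \<xi>)"
  have sq: "norm (?h \<zeta> \<xi>) \<le> k \<zeta> * (norm (f (- \<zeta> + \<xi>)))\<^sup>2 + k \<zeta> * (norm (g \<xi>))\<^sup>2" for \<zeta> \<xi>
  proof -
    have "s * t \<le> s\<^sup>2 + t\<^sup>2" if "0 \<le> s" "0 \<le> t" for s t :: real
      using sum_squares_bound[of s t] mult_nonneg_nonneg[OF that] by linarith
    from mult_left_mono[OF this[OF norm_ge_zero norm_ge_zero] k(2)[of \<zeta>]] show ?thesis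
      using k(2)[of \<zeta>] by (simp add: norm_mult distrib_left mult.assoc)
  qed
  have i1: "integrable (\<mu> \<Otimes>\<^sub>M \<mu>) (\<lambda>(\<zeta>, \<xi>). k \<zeta> * (norm (f (- \<zeta> + \<xi>)))\<^sup>2)"
    by (rule integrable_convolution_kernel[OF k(1) L2_integrable[OF f]])
  have i2: "integrable (\<mu> \<Otimes>\<^sub>M \<mu>) (\<lambda>(\<zeta>, \<xi>). k \<zeta> * (norm (g \<xi>))\<^sup>2)"
    by (rule pair.Fubini_integrable) (use k(1) L2_integrable[OF g] in \<open>auto simp: abs_mult\<close>)
  have i: "integrable (\<mu> \<Otimes>\<^sub>M \<mu>) (\<lambda>(\<zeta>, \<xi>). ?h \<zeta> \<xi>)"
  proof (rule Bochner_Integration.integrable_bound[OF Bochner_Integration.integrable_add[OF i1 i2]])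
    show "(\<lambda>(\<zeta>, \<xi>). ?h \<zeta> \<xi>) \<in> borel_measurable (\<mu> \<Otimes>\<^sub>M \<mu>)" by measurable
    show "AE p in \<mu> \<Otimes>\<^sub>M \<mu>. norm (case p of (\<zeta>, \<xi>) \<Rightarrow> ?h \<zeta> \<xi>)
      \<le> norm ((case p of (\<zeta>, \<xi>) \<Rightarrow> k \<zeta> * (norm (f (- \<zeta> + \<xi>)))\<^sup>2) + (case p of (\<zeta>, \<xi>) \<Rightarrow> k \<zeta> * (norm (g \<xi>))\<^sup>2))"
      using sq by (intro AE_I2) (auto split: prod.split intro: order_trans[OF _ abs_ge_self])
  qed
  have inner: "(LINT \<xi>|\<mu>. ?h \<zeta> \<xi>) = complex_of_real (k \<zeta>) * L2_inner \<mu> (left_translate \<zeta> f) g" for \<zeta>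
    unfolding L2_inner_def left_translate_def by (simp add: mult.assoc)
  show "integrable \<mu> (\<lambda>\<zeta>. complex_of_real (k \<zeta>) * L2_inner \<mu> (left_translate \<zeta> f) g)"
    using pair.integrable_fst[OF i] by (simp add: inner)
  have "L2_inner \<mu> (convolution_op k f) g = (LINT \<xi>|\<mu>. LINT \<zeta>|\<mu>. ?h \<zeta> \<xi>)"
    unfolding L2_inner_def convolution_op_def by (simp add: integral_mult_left_zero)
  also have "\<dots> = (LINT \<zeta>|\<mu>. LINT \<xi>|\<mu>. ?h \<zeta> \<xi>)" by (rule pair.Fubini_integral[OF i])
  finally show "L2_inner \<mu> (convolution_op k f) g = (LINT \<zeta>|\<mu>. complex_of_real (k \<zeta>) * L2_inner \<mu> (left_translate \<zeta> f) g)"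
    by (simp add: inner)
qed

text \<open>The inner products are dominated by a summable sequence independent of \<zeta>, so after
  multiplication by k the sum and the integral may be interchanged.\<close>

lemma L2_normal_functional_convolution_op:
  assumes v: "L2_square_summable \<mu> v" and w: "L2_square_summable \<mu> w"
  shows "integrable \<mu> (\<lambda>\<zeta>. complex_of_real (k \<zeta>) * L2_normal_functional \<mu> v w (left_translate \<zeta>))"
    and "L2_normal_functional \<mu> v w (convolution_op k)
      = (LINT \<zeta>|\<mu>. complex_of_real (k \<zeta>) * L2_normal_functional \<mu> v w (left_translate \<zeta>))"
proof -
  have vm: "v n \<in> L2 \<mu>" and wm: "w n \<in> L2 \<mu>" for n using v w by (auto simp: L2_square_summable_def)
  have sm: "summable (\<lambda>n. (L2_norm \<mu> (v n))\<^sup>2 + (L2_norm \<mu> (w n))\<^sup>2)"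
    using v w by (intro summable_add) (auto simp: L2_square_summable_def)
  have bd: "norm (L2_inner \<mu> (left_translate \<zeta> (v n)) (w n))
      \<le> (L2_norm \<mu> (v n))\<^sup>2 + (L2_norm \<mu> (w n))\<^sup>2" for \<zeta> n
    by (rule norm_L2_inner_left_translate_le[OF vm wm])
  have smi: "summable (\<lambda>n. L2_inner \<mu> (left_translate \<zeta> (v n)) (w n))" for \<zeta>
    by (rule summable_L2_inner_left_translate[OF v w])
  let ?F = "\<lambda>n \<zeta>. complex_of_real (k \<zeta>) * L2_inner \<mu> (left_translate \<zeta> (v n)) (w n)"
  have Fi: "integrable \<mu> (?F n)" for n by (rule L2_inner_convolution_op(1)[OF vm wm])
  have nF: "norm (?F n \<zeta>) \<le> k \<zeta> * ((L2_norm \<mu> (v n))\<^sup>2 + (L2_norm \<mu> (w n))\<^sup>2)" for n \<zeta>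
    using mult_left_mono[OF bd k(2)] k(2)[of \<zeta>] by (simp add: norm_mult)
  have s1: "AE \<zeta> in \<mu>. summable (\<lambda>n. norm (?F n \<zeta>))"
    using nF by (intro AE_I2 summable_comparison_test'[OF summable_mult[OF sm]]) auto
  have s2: "summable (\<lambda>n. LINT \<zeta>|\<mu>. norm (?F n \<zeta>))"
  proof (rule summable_comparison_test'[OF summable_mult[OF sm, of "LINT x|\<mu>. k x"]])
    fix n
    have "(LINT \<zeta>|\<mu>. norm (?F n \<zeta>)) \<le> (LINT \<zeta>|\<mu>. k \<zeta> * ((L2_norm \<mu> (v n))\<^sup>2 + (L2_norm \<mu> (w n))\<^sup>2))"
      using Fi[of n] k(1) nF by (intro integral_mono integrable_norm) auto
    then show "norm (LINT \<zeta>|\<mu>. norm (?F n \<zeta>)) \<le> (LINT x|\<mu>. k x) * ((L2_norm \<mu> (v n))\<^sup>2 + (L2_norm \<mu> (w n))\<^sup>2)"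
      by (simp add: Bochner_Integration.integral_nonneg)
  qed
  have eq: "(\<Sum>n. ?F n \<zeta>) = complex_of_real (k \<zeta>) * L2_normal_functional \<mu> v w (left_translate \<zeta>)"
      for \<zeta>
    unfolding L2_normal_functional_def by (rule suminf_mult[OF smi])
  show "integrable \<mu> (\<lambda>\<zeta>. complex_of_real (k \<zeta>) * L2_normal_functional \<mu> v w (left_translate \<zeta>))"
    using integrable_suminf[OF Fi s1 s2] by (simp add: eq)
  show "L2_normal_functional \<mu> v w (convolution_op k)
      = (LINT \<zeta>|\<mu>. complex_of_real (k \<zeta>) * L2_normal_functional \<mu> v w (left_translate \<zeta>))"
    using integral_suminf[OF Fi s1 s2] unfolding eq
    by (simp add: L2_normal_functional_def L2_inner_convolution_op(2)[OF vm wm])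
qed

end

text \<open>Integration over \<Omega> becomes integration over the group with the kernel cut off by
  the indicator, which reduces everything to convolution operators.\<close>

lemma has_sigma_weak_integral_convolution_op:
  fixes k :: "'a \<Rightarrow> real"
  assumes \<Omega>: "\<Omega> \<in> sets borel" and k: "integrable \<mu> (\<lambda>\<zeta>. indicator \<Omega> \<zeta> * k \<zeta>)" "\<And>x. 0 \<le> k x"
  shows "has_sigma_weak_integral (restrict_space \<mu> \<Omega>) \<mu>
    (\<lambda>\<zeta> f \<xi>. complex_of_real (k \<zeta>) * left_translate \<zeta> f \<xi>) (convolution_op (\<lambda>\<zeta>. indicator \<Omega> \<zeta> * k \<zeta>))"
  unfolding has_sigma_weak_integral_def
proof (intro conjI ballI allI impI)
  have k0: "0 \<le> indicator \<Omega> x * k x" for x using k(2) by simp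
  note conv = L2_normal_functional_convolution_op[OF k(1) k0]
  show "L2_bounded_op \<mu> (\<lambda>f \<xi>. complex_of_real (k \<zeta>) * left_translate \<zeta> f \<xi>)" for \<zeta>
    by (rule L2_bounded_op_scale[OF L2_bounded_op_left_translate])
  show "L2_bounded_op \<mu> (convolution_op (\<lambda>\<zeta>. indicator \<Omega> \<zeta> * k \<zeta>))"
    by (rule L2_bounded_op_convolution_op[OF k(1) k0])
  fix v w assume vw: "L2_square_summable \<mu> v" "L2_square_summable \<mu> w"
  have F: "L2_normal_functional \<mu> v w (\<lambda>f \<xi>. complex_of_real (k \<zeta>) * left_translate \<zeta> f \<xi>)
      = complex_of_real (k \<zeta>) * L2_normal_functional \<mu> v w (left_translate \<zeta>)" for \<zeta>
    unfolding L2_normal_functional_def L2_inner_cmult_left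
    by (rule suminf_mult[OF summable_L2_inner_left_translate[OF vw]])
  have \<Omega>': "\<Omega> \<inter> space \<mu> \<in> sets \<mu>" using \<Omega> by simp
  have ind: "indicator \<Omega> \<zeta> *\<^sub>R (complex_of_real (k \<zeta>) * z) = complex_of_real (indicator \<Omega> \<zeta> * k \<zeta>) * z" for \<zeta> z
    by (simp add: scaleR_conv_of_real)
  show "integrable (restrict_space \<mu> \<Omega>) (\<lambda>\<zeta>. L2_normal_functional \<mu> v w (\<lambda>f \<xi>. complex_of_real (k \<zeta>) * left_translate \<zeta> f \<xi>))"
    using conv(1)[OF vw] unfolding F integrable_restrict_space[OF \<Omega>'] by (simp only: ind)
  show "L2_normal_functional \<mu> v w (convolution_op (\<lambda>\<zeta>. indicator \<Omega> \<zeta> * k \<zeta>))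
    = (LINT \<zeta>|restrict_space \<mu> \<Omega>. L2_normal_functional \<mu> v w (\<lambda>f \<xi>. complex_of_real (k \<zeta>) * left_translate \<zeta> f \<xi>))"
    using conv(2)[OF vw] unfolding F integral_restrict_space[OF \<Omega>'] by (simp only: ind)
qed

end

section \<open>Spectrum and almost invariance\<close>

context modular_haar_measure
begin

context
  fixes k :: "'a \<Rightarrow> real"
  assumes k: "integrable \<mu> k" "\<And>x. 0 \<le> k x"
begin

lemma L2_norm_translate_diff_measurable [measurable]:
  assumes "f \<in> L2 \<mu>" "h \<in> L2 \<mu>"
  shows "(\<lambda>\<zeta>. L2_norm \<mu> (\<lambda>x. left_translate \<zeta> f x - h x)) \<in> borel_measurable borel"
proof -
  have [measurable]: "f \<in> borel_measurable borel" "h \<in> borel_measurable borel"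
    using assms[THEN L2_measurable] by auto
  show ?thesis unfolding L2_norm_def left_translate_def by measurable
qed

text \<open>Minkowski's integral inequality, obtained by pairing the difference h with itself: its
  squared norm is an integral of inner products with h, and Cauchy-Schwarz leaves one factor of the
  norm of h to cancel.\<close>

lemma L2_norm_convolution_op_diff_le:
  assumes f: "f \<in> L2 \<mu>"
  shows "integrable \<mu> (\<lambda>\<zeta>. k \<zeta> * L2_norm \<mu> (\<lambda>x. left_translate \<zeta> f x - f x))"
    and "L2_norm \<mu> (\<lambda>x. convolution_op k f x - complex_of_real (LINT x|\<mu>. k x) * f x)
      \<le> (LINT \<zeta>|\<mu>. k \<zeta> * L2_norm \<mu> (\<lambda>x. left_translate \<zeta> f x - f x))"
proof -
  let ?d = "\<lambda>\<zeta>. L2_norm \<mu> (\<lambda>x. left_translate \<zeta> f x - f x)"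
  let ?c = "complex_of_real (LINT x|\<mu>. k x)"
  have d2: "?d \<zeta> \<le> 2 * L2_norm \<mu> f" for \<zeta>
    using L2_norm_diff_le[OF L2_left_translate[OF f] f, of \<zeta>] L2_norm_left_translate[OF f, of \<zeta>]
        by simp
  have "integrable \<mu> (\<lambda>\<zeta>. ?d \<zeta> * k \<zeta>)"
    using d2 by (intro integrable_bounded_mult[OF k(1), where C = "2 * L2_norm \<mu> f"])
      (auto intro: L2_norm_translate_diff_measurable[OF f f])
  then show i: "integrable \<mu> (\<lambda>\<zeta>. k \<zeta> * ?d \<zeta>)" by (simp add: mult.commute)
  define h where "h x = convolution_op k f x - ?c * f x" for x
  note Tf = L2_convolution_op(1)[OF k f]
  have h: "h \<in> L2 \<mu>" unfolding h_def[abs_def] by (intro L2_diff Tf L2_cmult f)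
  note ti = L2_inner_convolution_op[OF k f h]
  have "complex_of_real ((L2_norm \<mu> h)\<^sup>2) = L2_inner \<mu> h h" by (simp only: L2_inner_self)
  also have "\<dots> = L2_inner \<mu> (convolution_op k f) h - ?c * L2_inner \<mu> f h"
    using L2_inner_diff_left[OF Tf L2_cmult[OF f] h, of ?c]
    by (simp add: h_def[abs_def, symmetric] L2_inner_cmult_left)
  also have "\<dots> = (LINT \<zeta>|\<mu>. complex_of_real (k \<zeta>) * L2_inner \<mu> (left_translate \<zeta> f) h)
      - (LINT \<zeta>|\<mu>. complex_of_real (k \<zeta>) * L2_inner \<mu> f h)"
    unfolding ti(2) by simp
  also have "\<dots> = (LINT \<zeta>|\<mu>. complex_of_real (k \<zeta>) * L2_inner \<mu> (left_translate \<zeta> f) h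
      - complex_of_real (k \<zeta>) * L2_inner \<mu> f h)"
    using ti(1) k(1) by (subst Bochner_Integration.integral_diff) auto
  also have "\<dots> = (LINT \<zeta>|\<mu>. complex_of_real (k \<zeta>) * L2_inner \<mu> (\<lambda>x. left_translate \<zeta> f x - f x) h)"
    by (simp add: L2_inner_diff_left[OF L2_left_translate[OF f] f h] right_diff_distrib)
  finally have eq: "complex_of_real ((L2_norm \<mu> h)\<^sup>2)
      = (LINT \<zeta>|\<mu>. complex_of_real (k \<zeta>) * L2_inner \<mu> (\<lambda>x. left_translate \<zeta> f x - f x) h)" .
  have "(L2_norm \<mu> h)\<^sup>2 = norm (complex_of_real ((L2_norm \<mu> h)\<^sup>2))" by (simp only: norm_of_real) simp
  also have "\<dots> \<le> (LINT \<zeta>|\<mu>. norm (complex_of_real (k \<zeta>) * L2_inner \<mu> (\<lambda>x. left_translate \<zeta> f x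
      - f x) h))"
    unfolding eq by (rule integral_norm_bound)
  also have "\<dots> \<le> (LINT \<zeta>|\<mu>. (k \<zeta> * ?d \<zeta>) * L2_norm \<mu> h)"
  proof (rule integral_mono')
    show "integrable \<mu> (\<lambda>\<zeta>. (k \<zeta> * ?d \<zeta>) * L2_norm \<mu> h)" using i by simp
    show "norm (complex_of_real (k \<zeta>) * L2_inner \<mu> (\<lambda>x. left_translate \<zeta> f x - f x) h)
        \<le> (k \<zeta> * ?d \<zeta>) * L2_norm \<mu> h" for \<zeta>
      using mult_left_mono[OF norm_L2_inner_le[OF L2_diff[OF L2_left_translate[OF f] f] h] k(2)[of \<zeta>]] k(2)[of \<zeta>]
      by (simp add: norm_mult mult.assoc)
    show "0 \<le> (k \<zeta> * ?d \<zeta>) * L2_norm \<mu> h" for \<zeta> using k(2) by simp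
  qed
  also have "\<dots> = (LINT \<zeta>|\<mu>. k \<zeta> * ?d \<zeta>) * L2_norm \<mu> h" by simp
  finally have le: "L2_norm \<mu> h * L2_norm \<mu> h \<le> (LINT \<zeta>|\<mu>. k \<zeta> * ?d \<zeta>) * L2_norm \<mu> h"
    by (simp add: power2_eq_square)
  have "0 \<le> (LINT \<zeta>|\<mu>. k \<zeta> * ?d \<zeta>)" using k(2) by (intro Bochner_Integration.integral_nonneg) simp
  with le have "L2_norm \<mu> h \<le> (LINT \<zeta>|\<mu>. k \<zeta> * ?d \<zeta>)"
    using L2_norm_nonneg[of \<mu> h] by (cases "L2_norm \<mu> h = 0") auto
  then show "L2_norm \<mu> (\<lambda>x. convolution_op k f x - ?c * f x) \<le> (LINT \<zeta>|\<mu>. k \<zeta> * ?d \<zeta>)"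
    by (simp add: h_def[abs_def])
qed

text \<open>Let T be the operator and c the integral of k. A bounded left inverse of T - c would
  keep the norms of \<open>T (f n) - c * f n\<close> away from 0. They are bounded by integrals of k
  times the displacement, which tend to 0 by dominated convergence with majorant 2 k.\<close>

lemma integral_in_spectrum_if_almost_invariant:
  assumes f: "almost_invariant f"
  shows "complex_of_real (LINT x|\<mu>. k x) \<in> L2_spectrum \<mu> (convolution_op k)"
proof (rule ccontr)
  let ?c = "complex_of_real (LINT x|\<mu>. k x)"
  assume "?c \<notin> L2_spectrum \<mu> (convolution_op k)"
  then obtain S where S: "L2_bounded_op \<mu> S"
    and inv: "\<And>g. g \<in> L2 \<mu> \<Longrightarrow> L2_eq \<mu> (S (\<lambda>x. convolution_op k g x - ?c * g x)) g"
    unfolding L2_spectrum_def by blast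
  obtain C where C: "0 < C" "\<And>g. g \<in> L2 \<mu> \<Longrightarrow> L2_norm \<mu> (S g) \<le> C * L2_norm \<mu> g"
    using L2_bounded_op_bound[OF S] by blast
  have fm: "f n \<in> L2 \<mu>" and f1: "L2_norm \<mu> (f n) = 1" for n using f
      by (auto simp: almost_invariant_def)
  let ?d = "\<lambda>n \<zeta>. L2_norm \<mu> (\<lambda>x. left_translate \<zeta> (f n) x - f n x)"
  have ge: "1 \<le> C * (LINT \<zeta>|\<mu>. k \<zeta> * ?d n \<zeta>)" for n
  proof -
    have m: "(\<lambda>x. convolution_op k (f n) x - ?c * f n x) \<in> L2 \<mu>"
      by (intro L2_diff L2_convolution_op(1)[OF k] L2_cmult fm)
    have "1 = L2_norm \<mu> (S (\<lambda>x. convolution_op k (f n) x - ?c * f n x))"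
      using L2_norm_cong[OF L2_bounded_op_mem[OF S m] fm inv[OF fm]] f1 by simp
    also have "\<dots> \<le> C * L2_norm \<mu> (\<lambda>x. convolution_op k (f n) x - ?c * f n x)" by (rule C(2)[OF m])
    also have "\<dots> \<le> C * (LINT \<zeta>|\<mu>. k \<zeta> * ?d n \<zeta>)"
      using C(1) L2_norm_convolution_op_diff_le(2)[OF fm] by (intro mult_left_mono) auto
    finally show ?thesis .
  qed
  have "(\<lambda>n. LINT \<zeta>|\<mu>. k \<zeta> * ?d n \<zeta>) \<longlonglongrightarrow> (LINT \<zeta>|\<mu>. 0)"
  proof (rule integral_dominated_convergence[where w = "\<lambda>\<zeta>. 2 * k \<zeta>"])
    show "(\<lambda>\<zeta>. k \<zeta> * ?d n \<zeta>) \<in> borel_measurable \<mu>" for n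
      using L2_norm_convolution_op_diff_le(1)[OF fm] by (rule borel_measurable_integrable)
    show "AE \<zeta> in \<mu>. (\<lambda>n. k \<zeta> * ?d n \<zeta>) \<longlonglongrightarrow> 0"
      using f by (intro AE_I2 tendsto_mult_right_zero) (simp add: almost_invariant_def)
    show "AE \<zeta> in \<mu>. norm (k \<zeta> * ?d n \<zeta>) \<le> 2 * k \<zeta>" for n
    proof (rule AE_I2)
      fix \<zeta>
      have "?d n \<zeta> \<le> 2"
        using L2_norm_diff_le[OF L2_left_translate[OF fm] fm, of \<zeta> n n] L2_norm_left_translate[OF fm, of \<zeta> n] f1 by simp
      then show "norm (k \<zeta> * ?d n \<zeta>) \<le> 2 * k \<zeta>"
        using mult_left_mono[of "?d n \<zeta>" 2 "k \<zeta>"] k(2)[of \<zeta>] by (simp add: abs_mult mult.commute)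
    qed
  qed (use k(1) in auto)
  then have "(\<lambda>n. C * (LINT \<zeta>|\<mu>. k \<zeta> * ?d n \<zeta>)) \<longlonglongrightarrow> C * 0" by (intro tendsto_mult_left) simp
  then have "1 \<le> C * 0" using ge by (intro LIMSEQ_le_const) auto
  then show False by simp
qed

text \<open>The natural centre \<open>h\<close> is the k-weighted average of the orbit, a multiple
  of T f. Expanding the square as a variance gives c - |T f|^2 / c for the total mass c, and the
  spectral condition supplies a unit vector f for which the norm of T f is nearly c.\<close>

lemma almost_constant_orbit_if_in_spectrum:
  assumes spec: "complex_of_real (LINT x|\<mu>. k x) \<in> L2_spectrum \<mu> (convolution_op k)" and "\<epsilon> > 0"
  obtains f h where "f \<in> L2 \<mu>" "h \<in> L2 \<mu>" "L2_norm \<mu> f = 1"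
    "integrable \<mu> (\<lambda>\<zeta>. k \<zeta> * (L2_norm \<mu> (\<lambda>x. left_translate \<zeta> f x - h x))\<^sup>2)"
    "(LINT \<zeta>|\<mu>. k \<zeta> * (L2_norm \<mu> (\<lambda>x. left_translate \<zeta> f x - h x))\<^sup>2) \<le> \<epsilon>"
proof -
  define c where "c = (LINT x|\<mu>. k x)"
  \<comment> \<open>If the norm of T f is at least c - e, the variance is at most 2 e.\<close>
  define e where "e = \<epsilon> / 2"
  have e: "e > 0" using \<open>\<epsilon> > 0\<close> by (simp add: e_def)
  have c0: "0 \<le> c" unfolding c_def using k(2) by (intro Bochner_Integration.integral_nonneg)
  let ?T = "convolution_op k"
  note T = L2_bounded_op_convolution_op[OF k]
  have "\<exists>f\<in>L2 \<mu>. L2_norm \<mu> f = 1 \<and> c - e \<le> L2_norm \<mu> (?T f)"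
  proof (rule ccontr)
    assume no: "\<not> ?thesis"
    have "L2_norm \<mu> (?T f) \<le> max 0 (c - e) * L2_norm \<mu> f" if f: "f \<in> L2 \<mu>" for f
    proof (cases "L2_norm \<mu> f = 0")
      case True
      then show ?thesis using L2_convolution_op(2)[OF k f] by simp
    next
      case False
      define a where "a = complex_of_real (inverse (L2_norm \<mu> f))"
      have na: "norm a = inverse (L2_norm \<mu> f)" by (simp add: a_def norm_inverse)
      have "L2_norm \<mu> (\<lambda>x. a * f x) = 1" unfolding L2_norm_cmult na using False by simp
      then have "L2_norm \<mu> (?T (\<lambda>x. a * f x)) < c - e"
        using no L2_cmult[OF f, of a] by (metis linorder_not_le)
      moreover have "?T (\<lambda>x. a * f x) = (\<lambda>x. a * ?T f x)" by (rule ext) (rule convolution_op_cmult[OF k])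
      ultimately have "inverse (L2_norm \<mu> f) * L2_norm \<mu> (?T f) < c - e"
          by (simp add: L2_norm_cmult na)
      then have "L2_norm \<mu> (?T f) \<le> (c - e) * L2_norm \<mu> f"
        using False L2_norm_nonneg[of \<mu> f] by (simp add: field_simps)
      also have "\<dots> \<le> max 0 (c - e) * L2_norm \<mu> f" by (intro mult_right_mono) auto
      finally show ?thesis .
    qed
    moreover have "max 0 (c - e) < norm (complex_of_real c)"
    proof -
      \<comment> \<open>For c = 0 the bound would not lie strictly below |c|. In that case every
        unit vector satisfies the claim, so it is enough to exhibit one.\<close>
      have "c \<noteq> 0"
      proof
        assume "c = 0"
        obtain V where V: "compact V" "measure \<mu> V > 0"
          using compact_subset_positive_measure[OF open_UNIV] by auto
        define g where "g x = complex_of_real (inverse (sqrt (measure \<mu> V)) * indicator V x)" for x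
        have g: "g \<in> L2 \<mu>" "L2_norm \<mu> g = 1"
        proof -
          note [measurable] = compact_borel[OF V(1)]
          have "(norm (g x))\<^sup>2 = inverse (measure \<mu> V) * indicator V x" for x
            using V(2) by (simp add: g_def norm_mult power_mult_distrib power_inverse indicator_def norm_inverse)
          moreover have "integrable \<mu> (indicator V :: 'a \<Rightarrow> real)"
            using emeasure_compact_finite[OF V(1)] V(1) by simp
          moreover have "g \<in> borel_measurable borel" unfolding g_def[abs_def] by measurable
          ultimately show "g \<in> L2 \<mu>" "L2_norm \<mu> g = 1" using V(2)
              by (simp_all add: L2_def L2_norm_def)
        qed
        have "c - e \<le> L2_norm \<mu> (?T g)" using \<open>c = 0\<close> e L2_norm_nonneg[of \<mu> "?T g"] by linarith
        with no g show False by blast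
      qed
      then show ?thesis using c0 e by simp
    qed
    ultimately have "complex_of_real c \<notin> L2_spectrum \<mu> ?T"
      by (intro not_in_L2_spectrum[OF T, where C = "max 0 (c - e)"]) auto
    with spec show False by (simp add: c_def)
  qed
  then obtain f where f: "f \<in> L2 \<mu>" and f1: "L2_norm \<mu> f = 1" and ge: "c - e \<le> L2_norm \<mu> (?T f)"
      by blast
  note Tf = L2_convolution_op(1)[OF k f]
  define t where "t = L2_norm \<mu> (?T f)"
  \<comment> \<open>For c = 0 this is 0, and so is \<open>h\<close>; the case
    \<open>c \<le> e\<close> below covers it.\<close>
  define a where "a = complex_of_real (inverse c)"
  define h where "h x = a * ?T f x" for x
  have h: "h \<in> L2 \<mu>" unfolding h_def[abs_def] by (rule L2_cmult[OF Tf])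
  have nh: "L2_norm \<mu> h = inverse c * t"
    unfolding h_def[abs_def] L2_norm_cmult t_def a_def using c0 by (simp add: norm_inverse)
  have d: "(L2_norm \<mu> (\<lambda>x. left_translate \<zeta> f x - h x))\<^sup>2
      = 1 - 2 * Re (L2_inner \<mu> (left_translate \<zeta> f) h) + (inverse c * t)\<^sup>2" for \<zeta>
    using L2_norm_diff_power2[OF L2_left_translate[OF f] h, of \<zeta>]
        by (simp add: L2_norm_left_translate[OF f] f1 nh)
  note ti = L2_inner_convolution_op[OF k f h]
  have iRe: "integrable \<mu> (\<lambda>\<zeta>. k \<zeta> * Re (L2_inner \<mu> (left_translate \<zeta> f) h))"
    using integrable_Re[OF ti(1)] by simp
  have eqd: "k \<zeta> * (L2_norm \<mu> (\<lambda>x. left_translate \<zeta> f x - h x))\<^sup>2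
      = k \<zeta> - 2 * (k \<zeta> * Re (L2_inner \<mu> (left_translate \<zeta> f) h)) + (inverse c * t)\<^sup>2 * k \<zeta>" for \<zeta>
    unfolding d by (simp add: algebra_simps)
  have "(LINT \<zeta>|\<mu>. k \<zeta> * Re (L2_inner \<mu> (left_translate \<zeta> f) h))
      = Re (LINT \<zeta>|\<mu>. complex_of_real (k \<zeta>) * L2_inner \<mu> (left_translate \<zeta> f) h)"
    using integral_Re[OF ti(1)] by simp
  also have "\<dots> = Re (L2_inner \<mu> (?T f) h)" by (simp only: ti(2))
  also have "\<dots> = inverse c * t\<^sup>2"
  proof -
    have "L2_inner \<mu> (?T f) h = cnj a * L2_inner \<mu> (?T f) (?T f)"
      unfolding L2_inner_def h_def by (simp add: mult_ac flip: integral_mult_right_zero)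
    then show ?thesis by (simp add: L2_inner_self a_def t_def flip: of_real_power of_real_mult of_real_inverse)
  qed
  finally have iv: "(LINT \<zeta>|\<mu>. k \<zeta> * Re (L2_inner \<mu> (left_translate \<zeta> f) h)) = inverse c * t\<^sup>2" .
  have "(LINT \<zeta>|\<mu>. k \<zeta> * (L2_norm \<mu> (\<lambda>x. left_translate \<zeta> f x - h x))\<^sup>2)
      = c - 2 * (inverse c * t\<^sup>2) + (inverse c * t)\<^sup>2 * c"
    unfolding eqd using iRe k(1) iv by (simp add: c_def)
  also have "\<dots> = c - inverse c * t\<^sup>2"
    by (cases "c = 0") (simp_all add: power2_eq_square field_simps)
  also have "\<dots> \<le> \<epsilon>"
  proof (cases "c \<le> e")
    case True
    then show ?thesis using c0 e by (simp add: e_def) (smt (verit) divide_nonneg_nonneg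
        zero_le_power2 inverse_eq_divide mult_nonneg_nonneg inverse_nonnegative_iff_nonnegative)
  next
    case False
    then have cp: "c > 0" using e by simp
    have "(c - e)\<^sup>2 \<le> t\<^sup>2" using ge False by (intro power_mono) (auto simp: t_def)
    then have "c * c - 2 * e * c \<le> t\<^sup>2" by (simp add: power2_eq_square algebra_simps) (smt (verit) zero_le_square)
    then have "c * c - t\<^sup>2 \<le> \<epsilon> * c" by (simp add: e_def)
    then show ?thesis using cp by (simp add: field_simps power2_eq_square)
  qed
  finally have "(LINT \<zeta>|\<mu>. k \<zeta> * (L2_norm \<mu> (\<lambda>x. left_translate \<zeta> f x - h x))\<^sup>2) \<le> \<epsilon>" .
  moreover have "integrable \<mu> (\<lambda>\<zeta>. k \<zeta> * (L2_norm \<mu> (\<lambda>x. left_translate \<zeta> f x - h x))\<^sup>2)"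
    unfolding eqd using iRe k(1) by simp
  ultimately show ?thesis using that f h f1 by blast
qed

end

section \<open>From almost constant orbits to almost invariance\<close>

lemma AE_imp_ex:
  assumes "AE x in \<mu>. P x"
  shows "\<exists>x. P x"
proof (rule ccontr)
  assume "\<nexists>x. P x"
  then have "AE x in \<mu>. False" using assms by simp
  then have "emeasure \<mu> UNIV = 0" using ae_filter_eq_bot_iff[of \<mu>] by (simp add: eventually_False)
  then show False using haar by (simp add: left_haar_measure_def)
qed

lemma left_translate_add: "left_translate (\<zeta> + \<eta>) f = left_translate \<zeta> (left_translate \<eta> f)"
  by (simp add: left_translate_def minus_add add.assoc fun_eq_iff del: add_uminus_conv_diff)

lemma left_translate_diff: "left_translate \<zeta> (\<lambda>x. f x - g x)
    = (\<lambda>x. left_translate \<zeta> f x - left_translate \<zeta> g x)"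
  by (simp add: left_translate_def)

text \<open>The translations under which \<open>f\<close> is asymptotically invariant form a conull subgroup, hence all
    of \<open>G\<close>.\<close>

lemma almost_invariant_if_AE_orbit_constant:
  assumes f: "\<And>n. f n \<in> L2 \<mu>" "\<And>n. L2_norm \<mu> (f n) = 1" and h: "\<And>n. h n \<in> L2 \<mu>"
    and lim: "AE \<zeta> in \<mu>. (\<lambda>n. L2_norm \<mu> (\<lambda>x. left_translate \<zeta> (f n) x - h n x)) \<longlonglongrightarrow> 0"
  shows "almost_invariant f"
proof -
  define d where "d \<zeta> n = L2_norm \<mu> (\<lambda>x. left_translate \<zeta> (f n) x - f n x)" for \<zeta> n
  define H where "H = {\<zeta>. d \<zeta> \<longlonglongrightarrow> 0}"
  note tm = L2_left_translate[OF f(1)]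
  have d0: "0 \<le> d \<zeta> n" for \<zeta> n by (simp add: d_def)
  \<comment> \<open>Left translation is isometric, so the displacement by
    \<open>- \<zeta> + \<eta>\<close> equals the distance between two points of the orbit of
    \<open>f n\<close>.\<close>
  have shift: "d (- \<zeta> + \<eta>) n = L2_norm \<mu> (\<lambda>x. left_translate \<eta> (f n) x - left_translate \<zeta> (f n) x)"
      for \<zeta> \<eta> n
  proof -
    have "left_translate \<zeta> (\<lambda>x. left_translate (- \<zeta> + \<eta>) (f n) x - f n x)
        = (\<lambda>x. left_translate \<eta> (f n) x - left_translate \<zeta> (f n) x)"
      unfolding left_translate_diff by (simp add: left_translate_add[symmetric] add.assoc[symmetric])
    then show ?thesis
      using L2_norm_left_translate[OF L2_diff[OF tm f(1)], of \<zeta> "- \<zeta> + \<eta>" n n] by (simp add: d_def)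
  qed
  have Hdiff: "- \<zeta> + \<eta> \<in> H" if "\<zeta> \<in> H" "\<eta> \<in> H" for \<zeta> \<eta>
  proof -
    have "(\<lambda>n. d \<eta> n + d \<zeta> n) \<longlonglongrightarrow> 0 + 0" using that unfolding H_def by (intro tendsto_add) auto
    moreover have "d (- \<zeta> + \<eta>) n \<le> d \<eta> n + d \<zeta> n" for n
    proof -
      have "d (- \<zeta> + \<eta>) n \<le> d \<eta> n + L2_norm \<mu> (\<lambda>x. f n x - left_translate \<zeta> (f n) x)"
        unfolding shift unfolding d_def by (rule L2_norm_triangle_diff[OF tm f(1) tm])
      also have "L2_norm \<mu> (\<lambda>x. f n x - left_translate \<zeta> (f n) x) = d \<zeta> n"
        by (simp add: d_def L2_norm_def norm_minus_commute)
      finally show ?thesis .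
    qed
    ultimately have "d (- \<zeta> + \<eta>) \<longlonglongrightarrow> 0"
      using d0 by (intro tendsto_sandwich[OF _ _ tendsto_const, of _ "d (- \<zeta> + \<eta>)" _ "\<lambda>n. d \<eta> n
          + d \<zeta> n"]) auto
    then show ?thesis by (simp add: H_def)
  qed
  \<comment> \<open>The vectors \<open>h n\<close> are eliminated by comparison with one orbit point
    that also approaches them.\<close>
  obtain \<zeta>0 where \<zeta>0: "(\<lambda>n. L2_norm \<mu> (\<lambda>x. left_translate \<zeta>0 (f n) x - h n x)) \<longlonglongrightarrow> 0"
    using AE_imp_ex[OF lim] by blast
  have AEH: "AE \<zeta> in \<mu>. \<zeta> \<in> H"
    using AE_left_translation[OF lim, of \<zeta>0]
  proof eventually_elim
    case (elim \<zeta>)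
    let ?g = "\<lambda>\<zeta> n. L2_norm \<mu> (\<lambda>x. left_translate \<zeta> (f n) x - h n x)"
    have "(\<lambda>n. ?g (\<zeta>0 + \<zeta>) n + ?g \<zeta>0 n) \<longlonglongrightarrow> 0 + 0" using elim \<zeta>0 by (rule tendsto_add)
    moreover have "d \<zeta> n \<le> ?g (\<zeta>0 + \<zeta>) n + ?g \<zeta>0 n" for n
    proof -
      have "d \<zeta> n = L2_norm \<mu> (\<lambda>x. left_translate (\<zeta>0 + \<zeta>) (f n) x - left_translate \<zeta>0 (f n) x)"
        using shift[of \<zeta>0 "\<zeta>0 + \<zeta>" n] by (simp add: add.assoc[symmetric])
      also have "\<dots> \<le> ?g (\<zeta>0 + \<zeta>) n + L2_norm \<mu> (\<lambda>x. h n x - left_translate \<zeta>0 (f n) x)"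
        by (rule L2_norm_triangle_diff[OF tm h tm])
      also have "L2_norm \<mu> (\<lambda>x. h n x - left_translate \<zeta>0 (f n) x) = ?g \<zeta>0 n"
        by (simp add: L2_norm_def norm_minus_commute)
      finally show ?thesis .
    qed
    ultimately have "d \<zeta> \<longlonglongrightarrow> 0"
      using d0 by (intro tendsto_sandwich[OF _ _ tendsto_const, of _ "d \<zeta>" _ "\<lambda>n. ?g (\<zeta>0 + \<zeta>) n
          + ?g \<zeta>0 n"]) auto
    then show ?case by (simp add: H_def)
  qed
  have "\<xi> \<in> H" for \<xi>
  proof -
    \<comment> \<open>A conull set meets its translates. With \<zeta> and
      \<open>- \<xi> + \<zeta>\<close> in the subgroup H, the quotient \<open>- \<xi>\<close> lies
      in H as well.\<close>
    have "AE \<zeta> in \<mu>. - \<xi> + \<zeta> \<in> H" by (rule AE_left_translation[OF AEH])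
    with AEH have "AE \<zeta> in \<mu>. \<zeta> \<in> H \<and> - \<xi> + \<zeta> \<in> H" by eventually_elim simp
    then obtain \<zeta> where \<zeta>: "\<zeta> \<in> H" "- \<xi> + \<zeta> \<in> H" using AE_imp_ex by blast
    have "0 \<in> H" using Hdiff[OF \<zeta>(1) \<zeta>(1)] by simp
    have "- (- \<xi> + \<zeta>) \<in> H" using Hdiff[OF \<zeta>(2) \<open>0 \<in> H\<close>] by simp
    moreover have "- \<zeta> \<in> H" using Hdiff[OF \<zeta>(1) \<open>0 \<in> H\<close>] by simp
    ultimately have "- (- (- \<xi> + \<zeta>)) + - \<zeta> \<in> H" by (rule Hdiff)
    then have "- \<xi> \<in> H" by (simp add: add.assoc)
    from Hdiff[OF this \<open>0 \<in> H\<close>] show ?thesis by simp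
  qed
  then show ?thesis using f by (auto simp: almost_invariant_def H_def d_def[abs_def])
qed

end

section \<open>Invariant means from almost invariant vectors\<close>

text \<open>Tychonoff's theorem for a product of closed discs. A cluster point rather than the limit
  of a subsequence is taken because the index set may be uncountable; it still lets any finitely
  many coordinates be approximated at one common, arbitrarily late n.\<close>

lemma pointwise_cluster_point:
  fixes m :: "nat \<Rightarrow> 'b \<Rightarrow> complex"
  assumes bd: "\<And>n \<phi>. norm (m n \<phi>) \<le> C \<phi>"
  obtains M where
    "\<And>F \<epsilon> N. finite F \<Longrightarrow> \<epsilon> > 0 \<Longrightarrow> \<exists>n\<ge>N. \<forall>\<phi>\<in>F. norm (m n \<phi> - M \<phi>) < \<epsilon>"
proof -
  define K where "K = (\<Pi>\<^sub>E \<phi>\<in>UNIV. cball (0::complex) (C \<phi>))"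
  have "compactin (product_topology (\<lambda>_. euclidean) UNIV) K"
    unfolding K_def by (subst compactin_PiE) auto
  then have K: "compact K" by (simp add: euclidean_product_topology)
  have "eventually (\<lambda>x. x \<in> K) (filtermap m sequentially)"
    using bd by (auto simp: eventually_filtermap K_def PiE_iff intro!: always_eventually)
  moreover have "filtermap m sequentially \<noteq> bot" by (simp add: filtermap_bot_iff)
  ultimately obtain M where M: "inf (nhds M) (filtermap m sequentially) \<noteq> bot"
    using K unfolding compact_filter by blast
  show ?thesis
  proof (rule that)
    fix F :: "'b set" and \<epsilon> :: real and N assume F: "finite F" "\<epsilon> > 0"
    define U where "U = {g. \<forall>\<phi>\<in>F. g \<phi> \<in> ball (M \<phi>) \<epsilon>}"
    have "open U"
      unfolding U_def using product_topology_basis'[of F "\<lambda>\<phi>. ball (M \<phi>) \<epsilon>" "\<lambda>\<phi>. \<phi>"] F by simp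
    then have 1: "eventually (\<lambda>g. g \<in> U) (nhds M)"
      using F by (intro eventually_nhds_in_open) (auto simp: U_def)
    have "\<exists>n\<ge>N. m n \<in> U"
    proof (rule ccontr)
      assume "\<not> ?thesis"
      then have "eventually (\<lambda>n. m n \<notin> U) sequentially" by (auto simp: eventually_sequentially)
      then have 2: "eventually (\<lambda>g. g \<notin> U) (filtermap m sequentially)"
          by (simp add: eventually_filtermap)
      have "eventually (\<lambda>g. False) (inf (nhds M) (filtermap m sequentially))"
        unfolding eventually_inf using 1 2 by blast
      with M show False by (simp add: eventually_False)
    qed
    then show "\<exists>n\<ge>N. \<forall>\<phi>\<in>F. norm (m n \<phi> - M \<phi>) < \<epsilon>"
      by (auto simp: U_def dist_norm norm_minus_commute)
  qed
qed

context modular_haar_measure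
begin

text \<open>Relations between finitely many values of the functionals pass to the cluster point,
  which gives a state. For invariance, ||a|^2 - |b|^2| \<le> |a - b| (|a| + |b|) and Cauchy-Schwarz
  bound the L^1 displacement of the densities by twice the L^2 displacement of the unit
  vectors.\<close>

lemma amenable_if_almost_invariant:
  assumes f: "almost_invariant f"
  shows "amenable \<mu>"
proof -
  have fm: "f n \<in> L2 \<mu>" and f1: "L2_norm \<mu> (f n) = 1" for n using f
      by (auto simp: almost_invariant_def)
  have fb: "f n \<in> borel_measurable borel" for n using L2_measurable[OF fm] by simp
  note [measurable] = fb
  define w where "w n x = (norm (f n x))\<^sup>2" for n x
  have wi: "integrable \<mu> (w n)" for n unfolding w_def[abs_def] by (rule L2_integrable[OF fm])
  have w1: "(LINT x|\<mu>. w n x) = 1" for n using f1[of n] by (simp add: w_def L2_norm_def)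
  have w0: "0 \<le> w n x" for n x by (simp add: w_def)
  have wm [measurable]: "w n \<in> borel_measurable borel" for n unfolding w_def[abs_def] by measurable
  \<comment> \<open>The value 0 off \<open>Linf \<mu>\<close> yields a bound for every argument, as
    the compactness argument uses one disc for each function.\<close>
  define m where "m n \<phi> = (if \<phi> \<in> Linf \<mu> then LINT x|\<mu>. \<phi> x * complex_of_real (w n x) else 0)" for n \<phi>
  have "\<exists>C. 0 \<le> C \<and> (\<phi> \<in> Linf \<mu> \<longrightarrow> (AE x in \<mu>. norm (\<phi> x) \<le> C))" for \<phi>
  proof (cases "\<phi> \<in> Linf \<mu>")
    case True
    then obtain C where C: "AE x in \<mu>. norm (\<phi> x) \<le> C" by (auto simp: Linf_def)
    then have "AE x in \<mu>. norm (\<phi> x) \<le> max 0 C" by eventually_elim simp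
    then show ?thesis by (intro exI[of _ "max 0 C"]) auto
  qed auto
  then obtain C where C0: "\<And>\<phi>. 0 \<le> C \<phi>" and C: "\<And>\<phi>. \<phi> \<in> Linf \<mu> \<Longrightarrow> AE x in \<mu>. norm (\<phi> x) \<le> C \<phi>" by metis
  have \<phi>i: "integrable \<mu> (\<lambda>x. \<phi> x * complex_of_real (v x))" and
    \<phi>bd: "norm (LINT x|\<mu>. \<phi> x * complex_of_real (v x)) \<le> C \<phi> * (LINT x|\<mu>. \<bar>v x\<bar>)"
    if \<phi>: "\<phi> \<in> Linf \<mu>" and v: "integrable \<mu> v" for \<phi> v
  proof -
    have [measurable]: "\<phi> \<in> borel_measurable borel" "v \<in> borel_measurable borel" using \<phi> v
        by (auto simp: Linf_def)
    have le: "AE x in \<mu>. norm (\<phi> x * complex_of_real (v x)) \<le> C \<phi> * \<bar>v x\<bar>"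
      using C[OF \<phi>] by eventually_elim (simp add: norm_mult mult_right_mono)
    show i: "integrable \<mu> (\<lambda>x. \<phi> x * complex_of_real (v x))"
    proof (rule Bochner_Integration.integrable_bound)
      show "integrable \<mu> (\<lambda>x. C \<phi> * \<bar>v x\<bar>)" using v by simp
      show "(\<lambda>x. \<phi> x * complex_of_real (v x)) \<in> borel_measurable \<mu>" by measurable
      show "AE x in \<mu>. norm (\<phi> x * complex_of_real (v x)) \<le> norm (C \<phi> * \<bar>v x\<bar>)"
        using le by eventually_elim (simp add: abs_mult C0)
    qed
    have "norm (LINT x|\<mu>. \<phi> x * complex_of_real (v x)) \<le> (LINT x|\<mu>. norm (\<phi> x * complex_of_real (v x)))"
      by (rule integral_norm_bound)
    also have "\<dots> \<le> (LINT x|\<mu>. C \<phi> * \<bar>v x\<bar>)"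
      using i v le by (intro integral_mono_AE integrable_norm) auto
    finally show "norm (LINT x|\<mu>. \<phi> x * complex_of_real (v x)) \<le> C \<phi> * (LINT x|\<mu>. \<bar>v x\<bar>)" by simp
  qed
  have mC: "norm (m n \<phi>) \<le> C \<phi>" for n \<phi>
    using \<phi>bd[OF _ wi, of \<phi> n] w1[of n] w0 C0[of \<phi>] by (simp add: m_def)
  obtain M where M: "\<And>F \<epsilon> N. finite F \<Longrightarrow> \<epsilon> > 0 \<Longrightarrow> \<exists>n\<ge>N. \<forall>\<phi>\<in>F. norm (m n \<phi> - M \<phi>) < \<epsilon>"
    using pointwise_cluster_point[of m C, OF mC] by blast
  have triangle3: "norm (a + b - c) \<le> \<epsilon>" if "norm a \<le> \<epsilon> / 3" "norm b \<le> \<epsilon> / 3" "norm c \<le> \<epsilon> / 3"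
    for a b c :: complex and \<epsilon>
    using norm_triangle_ineq4[of "a + b" c] norm_triangle_ineq[of a b] that by linarith
  have add: "(\<lambda>x. \<phi> x + \<psi> x) \<in> Linf \<mu>" if "\<phi> \<in> Linf \<mu>" "\<psi> \<in> Linf \<mu>" for \<phi> \<psi>
  proof -
    have "AE x in \<mu>. norm (\<phi> x + \<psi> x) \<le> C \<phi> + C \<psi>"
      using C[OF that(1)] C[OF that(2)] by eventually_elim (rule norm_triangle_mono)
    then show ?thesis using that by (auto simp: Linf_def)
  qed
  have cmult: "(\<lambda>x. c * \<phi> x) \<in> Linf \<mu>" if "\<phi> \<in> Linf \<mu>" for \<phi> c
  proof -
    have "AE x in \<mu>. norm (c * \<phi> x) \<le> norm c * C \<phi>"
      using C[OF that] by eventually_elim (simp add: norm_mult mult_left_mono)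
    then show ?thesis using that by (auto simp: Linf_def)
  qed
  have one: "(\<lambda>x. 1) \<in> Linf \<mu>" by (auto simp: Linf_def)
  have trans: "left_translate \<zeta> \<phi> \<in> Linf \<mu>" if "\<phi> \<in> Linf \<mu>" for \<phi> \<zeta>
  proof -
    have [measurable]: "\<phi> \<in> borel_measurable borel" using that by (simp add: Linf_def)
    have "AE x in \<mu>. norm (\<phi> (- \<zeta> + x)) \<le> C \<phi>" by (rule AE_left_translation[OF C[OF that]])
    then show ?thesis by (auto simp: Linf_def left_translate_def[abs_def])
  qed
  have eqI: "a = b" if "\<And>\<epsilon>. \<epsilon> > 0 \<Longrightarrow> norm (a - b) \<le> \<epsilon>" for a b :: complex
  proof -
    have "norm (a - b) \<le> 0" by (rule field_le_epsilon) (use that in simp)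
    then show ?thesis by simp
  qed
  have "Linf_state \<mu> M"
    unfolding Linf_state_def
  proof (intro conjI ballI allI impI)
    fix \<phi> \<psi> assume \<phi>: "\<phi> \<in> Linf \<mu>" and \<psi>: "\<psi> \<in> Linf \<mu>"
    let ?s = "\<lambda>x. \<phi> x + \<psi> x"
    show "M ?s = M \<phi> + M \<psi>"
    proof (rule eqI)
      fix \<epsilon> :: real assume "\<epsilon> > 0"
      then obtain n where n: "norm (m n \<phi> - M \<phi>) < \<epsilon> / 3" "norm (m n \<psi> - M \<psi>)
          < \<epsilon> / 3" "norm (m n ?s - M ?s) < \<epsilon> / 3"
        using M[of "{\<phi>, \<psi>, ?s}" "\<epsilon> / 3" 0] by auto
      have "m n ?s = m n \<phi> + m n \<psi>"
        using \<phi> \<psi> add[OF \<phi> \<psi>] \<phi>i[OF \<phi> wi] \<phi>i[OF \<psi> wi] by (simp add: m_def distrib_right)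
      then have "M ?s - (M \<phi> + M \<psi>) = (m n \<phi> - M \<phi>) + (m n \<psi> - M \<psi>) - (m n ?s - M ?s)" by simp
      also have "norm \<dots> \<le> \<epsilon>" using n by (intro triangle3 less_imp_le)
      finally show "norm (M ?s - (M \<phi> + M \<psi>)) \<le> \<epsilon>" .
    qed
  next
    fix \<phi> c assume \<phi>: "\<phi> \<in> Linf \<mu>"
    let ?s = "\<lambda>x. c * \<phi> x"
    show "M ?s = c * M \<phi>"
    proof (rule eqI)
      fix \<epsilon> :: real assume "\<epsilon> > 0"
      \<comment> \<open>Two errors of size e occur, one of them multiplied by c.\<close>
      define e where "e = \<epsilon> / (1 + norm c)"
      have p: "1 + norm c > 0" by (simp add: add_pos_nonneg)
      then have "e > 0" using \<open>\<epsilon> > 0\<close> by (simp add: e_def)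
      then obtain n where n: "norm (m n \<phi> - M \<phi>) < e" "norm (m n ?s - M ?s) < e"
        using M[of "{\<phi>, ?s}" e 0] by auto
      have "m n ?s = c * m n \<phi>"
        using \<phi> cmult[OF \<phi>] by (simp add: m_def mult.assoc)
      then have "M ?s - c * M \<phi> = c * (m n \<phi> - M \<phi>) - (m n ?s - M ?s)" by (simp add: algebra_simps)
      also have "norm \<dots> \<le> norm c * e + e"
      proof -
        have "norm (c * (m n \<phi> - M \<phi>)) \<le> norm c * e"
          unfolding norm_mult using n(1) by (intro mult_left_mono) auto
        then show ?thesis
          using norm_triangle_ineq4[of "c * (m n \<phi> - M \<phi>)" "m n ?s - M ?s"] n(2) by linarith
      qed
      also have "\<dots> = e * (1 + norm c)" by (simp add: algebra_simps)
      also have "\<dots> = \<epsilon>" using p by (simp add: e_def)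
      finally show "norm (M ?s - c * M \<phi>) \<le> \<epsilon>" .
    qed
  next
    fix \<phi> assume \<phi>: "\<phi> \<in> Linf \<mu>" and pos: "AE x in \<mu>. \<phi> x \<in> \<real>\<^sub>\<ge>\<^sub>0"
    have mn: "m n \<phi> \<in> \<real>\<^sub>\<ge>\<^sub>0" for n
    proof -
      have [measurable]: "\<phi> \<in> borel_measurable borel" using \<phi> by (simp add: Linf_def)
      have "m n \<phi> = (LINT x|\<mu>. complex_of_real (Re (\<phi> x) * w n x))"
      proof -
        have "AE x in \<mu>. \<phi> x * complex_of_real (w n x) = complex_of_real (Re (\<phi> x) * w n x)"
          using pos by eventually_elim (auto simp: complex_nonneg_Reals_iff complex_eq_iff)
        then have "(LINT x|\<mu>. \<phi> x * complex_of_real (w n x)) = (LINT x|\<mu>. complex_of_real (Re (\<phi> x) * w n x))"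
          by (intro integral_cong_AE) simp_all
        then show ?thesis using \<phi> by (simp add: m_def)
      qed
      moreover have "0 \<le> (LINT x|\<mu>. Re (\<phi> x) * w n x)"
        by (rule integral_nonneg_AE) (use pos w0 in \<open>auto elim!: eventually_mono simp: complex_nonneg_Reals_iff\<close>)
      ultimately show ?thesis
        by (simp only: integral_complex_of_real nonneg_Reals_of_real_iff)
    qed
    \<comment> \<open>Positivity is a closed condition, so approximating this one value is
      enough.\<close>
    have "M \<phi> \<in> closure \<real>\<^sub>\<ge>\<^sub>0"
      unfolding closure_approachable
    proof (intro allI impI)
      fix \<epsilon> :: real assume "\<epsilon> > 0"
      then obtain n where "norm (m n \<phi> - M \<phi>) < \<epsilon>" using M[of "{\<phi>}" \<epsilon> 0] by auto
      then show "\<exists>y\<in>\<real>\<^sub>\<ge>\<^sub>0. dist y (M \<phi>) < \<epsilon>" using mn by (auto simp: dist_norm)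
    qed
    then show "M \<phi> \<in> \<real>\<^sub>\<ge>\<^sub>0" using closed_nonneg_Reals_complex by (simp add: closure_closed)
  next
    show "M (\<lambda>x. 1) = 1"
    proof (rule eqI)
      fix \<epsilon> :: real assume "\<epsilon> > 0"
      then obtain n where n: "norm (m n (\<lambda>x. 1) - M (\<lambda>x. 1)) < \<epsilon>" using M[of "{\<lambda>x. 1}" \<epsilon> 0] by auto
      moreover have "m n (\<lambda>x. 1) = 1" using one w1[of n] by (simp add: m_def)
      ultimately show "norm (M (\<lambda>x. 1) - 1) \<le> \<epsilon>" by (simp add: norm_minus_commute)
    qed
  qed
  moreover have "M (left_translate \<zeta> \<phi>) = M \<phi>" if \<phi>: "\<phi> \<in> Linf \<mu>" for \<zeta> \<phi>
  proof (rule eqI)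
    fix \<epsilon> :: real assume "\<epsilon> > 0"
    \<comment> \<open>Moving the translation from \<phi> to the density inverts it.\<close>
    let ?d = "\<lambda>n. L2_norm \<mu> (\<lambda>x. left_translate (- \<zeta>) (f n) x - f n x)"
    have close: "norm (m n (left_translate \<zeta> \<phi>) - m n \<phi>) \<le> C \<phi> * (2 * ?d n)" for n
    proof -
      have [measurable]: "\<phi> \<in> borel_measurable borel" using \<phi> by (simp add: Linf_def)
      have wt: "integrable \<mu> (\<lambda>x. w n (\<zeta> + x))" by (rule integrable_left_translation[OF wi])
      have "(LINT x|\<mu>. \<phi> (- \<zeta> + x) * complex_of_real (w n x))
          = (LINT x|\<mu>. \<phi> (- \<zeta> + (\<zeta> + x)) * complex_of_real (w n (\<zeta> + x)))"
        by (rule integral_left_translation[symmetric]) measurable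
      then have "m n (left_translate \<zeta> \<phi>) - m n \<phi> = (LINT x|\<mu>. \<phi> x * complex_of_real (w n (\<zeta> + x)
          - w n x))"
        using \<phi> trans[OF \<phi>] \<phi>i[OF \<phi> wt] \<phi>i[OF \<phi> wi]
        by (simp add: m_def left_translate_def right_diff_distrib)
      also have "norm \<dots> \<le> C \<phi> * (LINT x|\<mu>. \<bar>w n (\<zeta> + x) - w n x\<bar>)"
        by (rule \<phi>bd[OF \<phi>]) (use wt wi in simp)
      also have "(LINT x|\<mu>. \<bar>w n (\<zeta> + x) - w n x\<bar>) \<le> 2 * ?d n"
      proof -
        let ?t = "left_translate (- \<zeta>) (f n)"
        have t: "?t \<in> L2 \<mu>" "L2_norm \<mu> ?t = 1" using L2_left_translate[OF fm] L2_norm_left_translate[OF fm] f1 by auto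
        have D: "(\<lambda>x. ?t x - f n x) \<in> L2 \<mu>" by (rule L2_diff[OF t(1) fm])
        note b1 = L2_norm_mult_integral_le[OF D t(1)] and b2 = L2_norm_mult_integral_le[OF D fm[of n]]
        have "(LINT x|\<mu>. \<bar>w n (\<zeta> + x) - w n x\<bar>)
            \<le> (LINT x|\<mu>. norm (?t x - f n x) * norm (?t x) + norm (?t x - f n x) * norm (f n x))"
        proof (rule integral_mono)
          show "integrable \<mu> (\<lambda>x. \<bar>w n (\<zeta> + x) - w n x\<bar>)" using wt wi by simp
          show "integrable \<mu> (\<lambda>x. norm (?t x - f n x) * norm (?t x) + norm (?t x - f n x) * norm (f n x))"
            using b1(1) b2(1) by simp
          have sq: "\<bar>(norm a)\<^sup>2 - (norm b)\<^sup>2\<bar> \<le> norm (a - b) * norm a + norm (a - b) * norm b"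
              for a b :: complex
          proof -
            have "\<bar>(norm a)\<^sup>2 - (norm b)\<^sup>2\<bar> = \<bar>norm a - norm b\<bar> * (norm a + norm b)"
              by (simp add: power2_eq_square square_diff_square_factored abs_mult mult.commute)
            also have "\<dots> \<le> norm (a - b) * (norm a + norm b)"
              by (intro mult_right_mono norm_triangle_ineq3) simp
            finally show ?thesis by (simp add: distrib_left)
          qed
          show "\<bar>w n (\<zeta> + x) - w n x\<bar> \<le> norm (?t x - f n x) * norm (?t x) + norm (?t x
              - f n x) * norm (f n x)" for x
            using sq[of "?t x" "f n x"] by (simp add: w_def left_translate_def)
        qed
        also have "\<dots> \<le> ?d n * 1 + ?d n * 1"
          using b1 b2 t(2) f1[of n] by (simp add: add_mono)
        finally show ?thesis by simp
      qed
      finally show ?thesis using C0 by (simp add: mult_left_mono)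
    qed
    have "(\<lambda>n. C \<phi> * (2 * ?d n)) \<longlonglongrightarrow> C \<phi> * (2 * 0)"
      using f by (intro tendsto_mult_left) (simp add: almost_invariant_def)
    then have "eventually (\<lambda>n. C \<phi> * (2 * ?d n) < \<epsilon> / 3) sequentially"
      using \<open>\<epsilon> > 0\<close> by (intro order_tendstoD(2)[where y = "C \<phi> * (2 * 0)"]) auto
    then obtain N where N: "\<And>n. n \<ge> N \<Longrightarrow> C \<phi> * (2 * ?d n) < \<epsilon> / 3"
        by (auto simp: eventually_sequentially)
    \<comment> \<open>The index has to be late: near invariance holds only beyond N, and both
      approximations must hold at that same index.\<close>
    obtain n where n: "n \<ge> N" "norm (m n \<phi> - M \<phi>) < \<epsilon> / 3"
      "norm (m n (left_translate \<zeta> \<phi>) - M (left_translate \<zeta> \<phi>)) < \<epsilon> / 3"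
      using M[of "{\<phi>, left_translate \<zeta> \<phi>}" "\<epsilon> / 3" N] \<open>\<epsilon> > 0\<close> by auto
    have "M (left_translate \<zeta> \<phi>) - M \<phi> = (m n \<phi> - M \<phi>) + (m n (left_translate \<zeta> \<phi>) - m n \<phi>)
        - (m n (left_translate \<zeta> \<phi>) - M (left_translate \<zeta> \<phi>))" by simp
    also have "norm \<dots> \<le> \<epsilon>"
    proof (rule triangle3)
      show "norm (m n (left_translate \<zeta> \<phi>) - m n \<phi>) \<le> \<epsilon> / 3" using close[of n] N[OF n(1)] by linarith
    qed (use n in \<open>auto intro: less_imp_le\<close>)
    finally show "norm (M (left_translate \<zeta> \<phi>) - M \<phi>) \<le> \<epsilon>" .
  qed
  ultimately show ?thesis unfolding amenable_def by blast
qed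

text \<open>The chosen operator is known only up to equality almost everywhere on
  \<open>L2 \<mu>\<close>. The spectrum does not see the difference, so the explicit convolution
  operator can be used.\<close>

lemma spectrum_sigma_weak_integral:
  fixes k :: "'a \<Rightarrow> real"
  assumes \<Omega>: "\<Omega> \<in> sets borel" and k: "integrable \<mu> (\<lambda>\<zeta>. indicator \<Omega> \<zeta> * k \<zeta>)" "\<And>x. 0 \<le> k x"
  shows "L2_spectrum \<mu> (sigma_weak_integral (restrict_space \<mu> \<Omega>) \<mu> (\<lambda>\<zeta> f \<xi>. complex_of_real (k \<zeta>) * left_translate \<zeta> f \<xi>))
    = L2_spectrum \<mu> (convolution_op (\<lambda>\<zeta>. indicator \<Omega> \<zeta> * k \<zeta>))"
proof -
  note T = has_sigma_weak_integral_convolution_op[OF \<Omega> k]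
  have S: "has_sigma_weak_integral (restrict_space \<mu> \<Omega>) \<mu> (\<lambda>\<zeta> f \<xi>. complex_of_real (k \<zeta>) * left_translate \<zeta> f \<xi>)
    (sigma_weak_integral (restrict_space \<mu> \<Omega>) \<mu> (\<lambda>\<zeta> f \<xi>. complex_of_real (k \<zeta>) * left_translate \<zeta> f \<xi>))"
    unfolding sigma_weak_integral_def by (rule someI[where P = "has_sigma_weak_integral _ _ _", OF T])
  show ?thesis
  proof (rule L2_spectrum_cong)
    show "L2_eq \<mu> (sigma_weak_integral (restrict_space \<mu> \<Omega>) \<mu>
        (\<lambda>\<zeta> f \<xi>. complex_of_real (k \<zeta>) * left_translate \<zeta> f \<xi>) f) (convolution_op (\<lambda>\<zeta>. indicator \<Omega> \<zeta> * k \<zeta>) f)"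
      if "f \<in> L2 \<mu>" for f using has_sigma_weak_integral_unique[OF S T that] .
  qed (use S T in \<open>auto simp: has_sigma_weak_integral_def\<close>)
qed

section \<open>The spectral conditions for powers of the modular element\<close>

lemma integrable_modular_powr:
  assumes [measurable]: "\<Omega> \<in> sets borel" and fin: "(\<integral>\<^sup>+\<zeta>\<in>\<Omega>. ennreal (\<delta> \<zeta> powr p) \<partial>\<mu>) < \<infinity>"
  shows "integrable \<mu> (\<lambda>\<zeta>. indicator \<Omega> \<zeta> * \<delta> \<zeta> powr p)"
proof (rule integrableI_nonneg)
  have "(\<integral>\<^sup>+\<zeta>. ennreal (indicator \<Omega> \<zeta> * \<delta> \<zeta> powr p) \<partial>\<mu>) = (\<integral>\<^sup>+\<zeta>\<in>\<Omega>. ennreal (\<delta> \<zeta> powr p) \<partial>\<mu>)"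
    by (rule nn_integral_cong) (auto simp: indicator_def)
  with fin show "(\<integral>\<^sup>+\<zeta>. ennreal (indicator \<Omega> \<zeta> * \<delta> \<zeta> powr p) \<partial>\<mu>) < \<infinity>" by simp
qed auto

definition integral_in_spectrum :: "real \<Rightarrow> 'a set \<Rightarrow> bool" where
  "integral_in_spectrum p \<Omega> \<longleftrightarrow>
    complex_of_real (LINT \<zeta>:\<Omega>|\<mu>. \<delta> \<zeta> powr p) \<in>
      L2_spectrum \<mu> (sigma_weak_integral (restrict_space \<mu> \<Omega>) \<mu>
        (\<lambda>\<zeta> f \<xi>. complex_of_real (\<delta> \<zeta> powr p) * left_translate \<zeta> f \<xi>))"

lemma integral_in_spectrum_iff:
  assumes "\<Omega> \<in> sets borel" "(\<integral>\<^sup>+\<zeta>\<in>\<Omega>. ennreal (\<delta> \<zeta> powr p) \<partial>\<mu>) < \<infinity>"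
  shows "integral_in_spectrum p \<Omega> \<longleftrightarrow>
    complex_of_real (LINT \<zeta>|\<mu>. indicator \<Omega> \<zeta> * \<delta> \<zeta> powr p) \<in>
      L2_spectrum \<mu> (convolution_op (\<lambda>\<zeta>. indicator \<Omega> \<zeta> * \<delta> \<zeta> powr p))"
  unfolding integral_in_spectrum_def set_lebesgue_integral_def
  using spectrum_sigma_weak_integral[OF assms(1) integrable_modular_powr[OF assms]] by simp

lemma integral_in_spectrum_if_amenable:
  assumes "amenable \<mu>" and \<Omega>: "\<Omega> \<in> sets borel" "(\<integral>\<^sup>+\<zeta>\<in>\<Omega>. ennreal (\<delta> \<zeta> powr p) \<partial>\<mu>) < \<infinity>"
  shows "integral_in_spectrum p \<Omega>"
proof -
  obtain f where f: "almost_invariant f" using amenable_imp_almost_invariant[OF assms(1)] by blast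
  show ?thesis
    unfolding integral_in_spectrum_iff[OF \<Omega>]
    by (rule integral_in_spectrum_if_almost_invariant[OF integrable_modular_powr[OF \<Omega>] _ f]) simp
qed

lemma modular_powr_integral_compact_finite:
  assumes K: "compact K"
  shows "(\<integral>\<^sup>+\<zeta>\<in>K. ennreal (\<delta> \<zeta> powr p) \<partial>\<mu>) < \<infinity>"
proof -
  note [measurable] = compact_borel[OF K]
  have "continuous_on K (\<lambda>x. \<delta> x powr p)"
    using continuous_on_subset[OF continuous_on_modular, of K]
    by (intro continuous_on_powr continuous_on_const) (auto simp: less_imp_neq[symmetric])
  then have "bounded ((\<lambda>x. \<delta> x powr p) ` K)" using K
      by (intro compact_imp_bounded compact_continuous_image)
  then obtain B where B: "\<And>x. x \<in> K \<Longrightarrow> norm (\<delta> x powr p) \<le> B" unfolding bounded_iff by blast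
  have "(\<integral>\<^sup>+\<zeta>\<in>K. ennreal (\<delta> \<zeta> powr p) \<partial>\<mu>) \<le> (\<integral>\<^sup>+\<zeta>. ennreal B * indicator K \<zeta> \<partial>\<mu>)"
    using B by (intro nn_integral_mono) (auto simp: indicator_def intro: ennreal_leI)
  also have "\<dots> = ennreal B * emeasure \<mu> K" by (rule nn_integral_cmult_indicator) simp
  also have "\<dots> < \<infinity>" using emeasure_compact_finite[OF K] by (simp add: ennreal_mult_less_top)
  finally show ?thesis .
qed

text \<open>With kernels \<delta>^p on increasing compact sets, every group element eventually
  carries a fixed positive weight. Errors that are summable in n therefore force the orbit to
  approach \<open>h n\<close> at almost every group element.\<close>

lemma amenable_if_integral_in_spectrum:
  assumes spec: "\<And>\<Omega>. \<Omega> \<in> sets borel \<Longrightarrow> uminus ` \<Omega> = \<Omega> \<Longrightarrow>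
    (\<integral>\<^sup>+\<zeta>\<in>\<Omega>. ennreal (\<delta> \<zeta> powr p) \<partial>\<mu>) < \<infinity> \<Longrightarrow> integral_in_spectrum p \<Omega>"
  shows "amenable \<mu>"
proof -
  obtain K :: "nat \<Rightarrow> 'a set" where K: "\<And>n. compact (K n)" "(\<Union>n. K n) = UNIV"
    using exhausting_compacts by blast
  \<comment> \<open>The sets are symmetric to meet the hypothesis, and increasing so that each point
    lies in all of them from some index on.\<close>
  define \<Omega> where "\<Omega> n = (\<Union>i\<le>n. K i \<union> uminus ` K i)" for n
  have \<Omega>c: "compact (\<Omega> n)" for n
    unfolding \<Omega>_def using K(1)
    by (intro compact_UN compact_Un compact_continuous_image continuous_intros) auto
  have \<Omega>s: "uminus ` \<Omega> n = \<Omega> n" for n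
    unfolding \<Omega>_def image_UN image_Un image_image by (simp add: Un_commute)
  define k where "k n \<zeta> = indicator (\<Omega> n) \<zeta> * \<delta> \<zeta> powr p" for n \<zeta>
  note fin = modular_powr_integral_compact_finite[OF \<Omega>c]
  have ki: "integrable \<mu> (k n)" for n
    unfolding k_def[abs_def] by (rule integrable_modular_powr[OF compact_borel[OF \<Omega>c] fin])
  have k0: "0 \<le> k n x" for n x by (simp add: k_def)
  have spec_k: "complex_of_real (LINT x|\<mu>. k n x) \<in> L2_spectrum \<mu> (convolution_op (k n))" for n
    using spec[OF compact_borel[OF \<Omega>c] \<Omega>s fin, of n]
    unfolding integral_in_spectrum_iff[OF compact_borel[OF \<Omega>c] fin] by (simp add: k_def[abs_def])
  define Q where "Q n f h \<longleftrightarrow> f \<in> L2 \<mu> \<and> h \<in> L2 \<mu> \<and> L2_norm \<mu> f = 1 \<and>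
      integrable \<mu> (\<lambda>\<zeta>. k n \<zeta> * (L2_norm \<mu> (\<lambda>x. left_translate \<zeta> f x - h x))\<^sup>2) \<and>
      (LINT \<zeta>|\<mu>. k n \<zeta> * (L2_norm \<mu> (\<lambda>x. left_translate \<zeta> f x - h x))\<^sup>2) \<le> (1 / 2) ^ n" for n f h
  have "\<exists>f h. Q n f h" for n
  proof -
    have pos: "0 < (1 / 2 :: real) ^ n" by simp
    show ?thesis
      using almost_constant_orbit_if_in_spectrum[OF ki k0 spec_k pos] unfolding Q_def by blast
  qed
  then obtain f h where "\<And>n. Q n (f n) (h n)" by metis
  then have f: "\<And>n. f n \<in> L2 \<mu>" and h: "\<And>n. h n \<in> L2 \<mu>" and f1: "\<And>n. L2_norm \<mu> (f n) = 1"
    and di: "\<And>n. integrable \<mu> (\<lambda>\<zeta>. k n \<zeta> * (L2_norm \<mu> (\<lambda>x. left_translate \<zeta> (f n) x - h n x))\<^sup>2)"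
    and dle: "\<And>n. (LINT \<zeta>|\<mu>. k n \<zeta> * (L2_norm \<mu> (\<lambda>x. left_translate \<zeta> (f n) x - h n x))\<^sup>2)
        \<le> (1 / 2) ^ n"
    unfolding Q_def by blast+
  define d where "d n \<zeta> = L2_norm \<mu> (\<lambda>x. left_translate \<zeta> (f n) x - h n x)" for n \<zeta>
  have "AE \<zeta> in \<mu>. summable (\<lambda>n. k n \<zeta> * (d n \<zeta>)\<^sup>2)"
  proof (rule AE_summable_if_summable_integral)
    show "integrable \<mu> (\<lambda>\<zeta>. k n \<zeta> * (d n \<zeta>)\<^sup>2)" for n using di by (simp add: d_def)
    show "0 \<le> k n \<zeta> * (d n \<zeta>)\<^sup>2" for n \<zeta> using k0 by simp
    show "summable (\<lambda>n. LINT \<zeta>|\<mu>. k n \<zeta> * (d n \<zeta>)\<^sup>2)"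
    proof (rule summable_comparison_test')
      show "summable (\<lambda>n. (1 / 2 :: real) ^ n)" by (intro summable_geometric) simp
      show "norm (LINT \<zeta>|\<mu>. k n \<zeta> * (d n \<zeta>)\<^sup>2) \<le> (1 / 2) ^ n" for n
        using dle[of n] k0 by (simp add: d_def Bochner_Integration.integral_nonneg)
    qed
  qed
  then have "AE \<zeta> in \<mu>. (\<lambda>n. d n \<zeta>) \<longlonglongrightarrow> 0"
  proof eventually_elim
    case (elim \<zeta>)
    obtain N where N: "\<zeta> \<in> K N" using K(2) by blast
    have kz: "k n \<zeta> = \<delta> \<zeta> powr p" if "n \<ge> N" for n
      using N that by (auto simp: k_def \<Omega>_def indicator_def)
    have "(\<lambda>n. inverse (\<delta> \<zeta> powr p) * (k n \<zeta> * (d n \<zeta>)\<^sup>2)) \<longlonglongrightarrow> inverse (\<delta> \<zeta> powr p) * 0"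
      by (intro tendsto_mult_left summable_LIMSEQ_zero[OF elim])
    moreover have "eventually (\<lambda>n. inverse (\<delta> \<zeta> powr p) * (k n \<zeta> * (d n \<zeta>)\<^sup>2) = (d n \<zeta>)\<^sup>2) sequentially"
      using eventually_ge_at_top[of N]
    proof eventually_elim
      case (elim n)
      moreover have "\<delta> \<zeta> powr p \<noteq> 0" using modular_pos[of \<zeta>] by (simp add: less_imp_neq[symmetric])
      ultimately show ?case by (simp add: kz)
    qed
    ultimately have "(\<lambda>n. (d n \<zeta>)\<^sup>2) \<longlonglongrightarrow> 0" by (simp add: tendsto_cong)
    then have "(\<lambda>n. sqrt ((d n \<zeta>)\<^sup>2)) \<longlonglongrightarrow> sqrt 0" by (rule tendsto_real_sqrt)
    then show ?case by (simp add: d_def)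
  qed
  then have "almost_invariant f"
    unfolding d_def by (rule almost_invariant_if_AE_orbit_constant[OF f f1 h])
  then show ?thesis by (rule amenable_if_almost_invariant)
qed

end

theorem corollary13p9:
  fixes \<mu> :: "'a::{topological_group_add, t2_space, second_countable_topology} measure"
    and \<delta> :: "'a \<Rightarrow> real"
  assumes "locally_compact_space (euclidean :: 'a topology)"
    and "left_haar_measure \<mu>"
    and "modular_element \<mu> \<delta>"
  shows
    "(amenable \<mu> \<longleftrightarrow>
       (\<forall>p::real. \<forall>\<Omega>\<in>sets \<mu>. (\<integral>\<^sup>+\<zeta>\<in>\<Omega>. ennreal (\<delta> \<zeta> powr p) \<partial>\<mu>) < \<infinity> \<longrightarrow>
          complex_of_real (LINT \<zeta>:\<Omega>|\<mu>. \<delta> \<zeta> powr p) \<in>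
          L2_spectrum \<mu> (sigma_weak_integral (restrict_space \<mu> \<Omega>) \<mu>
            (\<lambda>\<zeta> f \<xi>. complex_of_real (\<delta> \<zeta> powr p) * left_translate \<zeta> f \<xi>)))) \<and>
     (amenable \<mu> \<longleftrightarrow>
       (\<forall>\<Omega>\<in>sets \<mu>. uminus ` \<Omega> = \<Omega> \<longrightarrow> (\<integral>\<^sup>+\<zeta>\<in>\<Omega>. ennreal (\<delta> \<zeta> powr (1/2)) \<partial>\<mu>) < \<infinity> \<longrightarrow>
          complex_of_real (LINT \<zeta>:\<Omega>|\<mu>. \<delta> \<zeta> powr (1/2)) \<in>
          L2_spectrum \<mu> (sigma_weak_integral (restrict_space \<mu> \<Omega>) \<mu>
            (\<lambda>\<zeta> f \<xi>. complex_of_real (\<delta> \<zeta> powr (1/2)) * left_translate \<zeta> f \<xi>))))"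
proof -
  interpret modular_haar_measure \<mu> \<delta> by unfold_locales fact+
  \<comment> \<open>The exponent 1/2 serves both converses, since the second condition contains the
    third.\<close>
  show ?thesis
    unfolding integral_in_spectrum_def[symmetric] sets_haar
    using integral_in_spectrum_if_amenable amenable_if_integral_in_spectrum[of "1 / 2"] by blast
qed

end
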